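(* Let $X$ be a compact space, let $P$ be a directed set which is either not countably directed or satisfies $P=_T 1$, and let $Y$ be a continuous image of $X$. If $P$ is not countably directed and $X$ satisfies any of the following (equivalent) conditions, then $Y$ satisfies the same conditions: (1) it embeds in $C_p(S(\mathcal F))$ for some infinite set $S$ and free filter $\mathcal F$ on $S$ such that $S(\mathcal F)$ has a $P$-ordered compact cover; (2) it has a $P$-point finite almost subbase; (3) it has a $P$-point additively Noetherian base; (4) it has a $P$-point additively Noetherian expandable network; (5) it has a $P$-additively Noetherian strong point network; (6) it has a $P$-additively Noetherian point network. If $P=_T 1$ and $X$ satisfies any of the following (equivalent) conditions, then $Y$ satisfies the same conditions: (1) it embeds in $C_p(A(\kappa))$ for some infinite cardinal $\kappa$; and (2)--(6), which are the conditions (2)--(6) above with $P$ replaced by $\mathbb N$.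
   Context: All spaces are Tychonoff (completely regular Hausdorff). $\mathbb N=\{1,2,\dots\}$ with its usual order. A directed set is a partially ordered set in which any two elements have an upper bound; it is countably directed if every countable subset has an upper bound. A Tukey quotient $\phi:P\to Q$ of directed sets is an order-preserving map with $\phi(P)$ cofinal in $Q$; $P=_T Q$ means there are Tukey quotients in both directions. $1$ is the one-element directed set. Filter spaces. For an infinite set $S$ and a free filter $\mathcal F$ on $S$ (the possibility that $\mathcal F$ is the whole power set of $S$ is allowed), $S(\mathcal F)$ is the space with underlying set $S\cup\{\ast\}$ ($\ast\notin S$) in which points of $S$ are isolated and neighborhoods of $\ast$ are the sets $\{\ast\}\cup U$, $U\in\mathcal F$. $A(\kappa)$ is the one-point compactification of a discrete space of size $\kappa$. $C_p(Z)$ is the set of continuous functions $Z\to\mathbb R$ as a subspace of $\mathbb R^Z$. A $P$-ordered compact cover of a space $Z$ is a cover $\{C_p:p\in P\}$ by compact sets with $C_p\subseteq C_{p'}$ whenever $p\le p'$. $P$-ordering. A collection $\mathcal C$ is $P$-ordered as $\mathcal C=\bigcup_{p\in P}\mathcal C_p$ if $p\le p'$ implies $\mathcal C_p\subseteq\mathcal C_{p'}$. For a property $\mathcal Q$ of collections, $\mathcal C$ is $P$-$\mathcal Q$ if it can be $P$-ordered so that every $\mathcal C_p$ has $\mathcal Q$. For a collection $\mathcal C$ of subsets of $X$ and $x\in X$, $(\mathcal C)_x=\{C\in\mathcal C:x\in C\}$; for a collection $\mathcal C$ of pairs of subsets, $(\mathcal C)_x=\{(C_1,C_2)\in\mathcal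 C:x\in C_2\}$. $\mathcal C$ is point finite if every $(\mathcal C)_x$ is finite, and point additively Noetherian if every $(\mathcal C)_x$ is additively Noetherian. Noetherian. A family of sets is Noetherian if every subfamily well-ordered by $\subseteq$ is finite; it is additively Noetherian if the collection of all unions of its members is Noetherian. For a family of pairs $(N,V)$, additively Noetherian refers to the family of first coordinates $N$. Almost subbase. A (co)zero set of $X$ is the (co)zero set of some continuous $f:X\to[0,1]$. A $U$-representation of $V\subseteq X$ is a sequence $U(V)=\{U_n(V):n\in\mathbb N\}$ with $V=\bigcup_n U_n(V)$, $U_n(V)\subseteq U_{n+1}(V)$, $U_{2n-1}(V)$ a zero set and $U_{2n}(V)$ a cozero set for all $n$. A family $\alpha$ of subsets of $X$ is an almost subbase if one can choose $U$-representations $U(V)$, $V\in\alpha$, such that $\alpha\cup\{X\setminus U_{2n-1}(V):V\in\alpha,n\in\mathbb N\}$ is a subbase of $X$. Expandable network. A collection $\mathcal N$ of pairs $(N,V)$ of subsets of $X$ with $N\subseteq V$ and $V$ open, such that whenever $x\in U$, $U$ open, there is $(N,V)\in\mathcal N$ with $x\in N\subseteq U$. Point networks. A $P$-$\mathcal Q$ point network (respectively strong point network) for $X$ is $\mathcal W=\{\mathcal W(x):x\in X\}$, where each $\mathcal W(x)=\bigcup_{p\in P}\mathcal W_p(x)$ is a collection of subsets of $X$ containing $x$, each $\mathcal W_p(x)$ has $\mathcal Q$, $p\le p'$ implies $\mathcal W_p(x)\subseteq\mathcal W_{p'}(x)$, and whenever a point $x$ is in an open set $U$ there are an open $V$ with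 $x\in V\subseteq U$ and a $p\in P$ such that for every $y\in V$ there is $W\in\mathcal W_p(y)$ with $x\in W\subseteq U$ (respectively $x\in W\subseteq V$). *)

theory Defs
  imports "HOL-Analysis.Analysis"
begin

section \<open>Spaces\<close>

definition tychonoff_space :: "'a topology \<Rightarrow> bool" where
  "tychonoff_space X \<longleftrightarrow> completely_regular_space X \<and> Hausdorff_space X"

definition zeroset_in :: "'a topology \<Rightarrow> 'a set \<Rightarrow> bool" where
  "zeroset_in X Z \<longleftrightarrow>
     (\<exists>f::'a \<Rightarrow> real. continuous_map X (top_of_set {0..1}) f \<and> Z = {x \<in> topspace X. f x = 0})"

definition cozeroset_in :: "'a topology \<Rightarrow> 'a set \<Rightarrow> bool" where
  "cozeroset_in X U \<longleftrightarrow>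
     (\<exists>f::'a \<Rightarrow> real. continuous_map X (top_of_set {0..1}) f \<and> U = {x \<in> topspace X. f x \<noteq> 0})"

definition base_of :: "'a topology \<Rightarrow> 'a set set \<Rightarrow> bool" where
  "base_of X \<B> \<longleftrightarrow> openin X = arbitrary union_of (\<lambda>U. U \<in> \<B>)"

text \<open>The empty intersection counts as the whole space.\<close>

definition subbase_of :: "'a topology \<Rightarrow> 'a set set \<Rightarrow> bool" where
  "subbase_of X \<S> \<longleftrightarrow> (\<forall>S\<in>\<S>. S \<subseteq> topspace X) \<and>
     openin X = arbitrary union_of (finite intersection_of (\<lambda>U. U \<in> \<S>) relative_to topspace X)"

text \<open>The space \<open>C\<^sub>p(Z)\<close>; its points are the continuous functions that are \<open>undefined\<close>
  outside the carrier of \<open>Z\<close>.\<close>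

definition Cp :: "'a topology \<Rightarrow> ('a \<Rightarrow> real) topology" where
  "Cp Z = subtopology (product_topology (\<lambda>_. euclideanreal) (topspace Z))
            {f. continuous_map Z euclideanreal f}"

definition embeds_in :: "'a topology \<Rightarrow> 'b topology \<Rightarrow> bool" where
  "embeds_in X Z \<longleftrightarrow> (\<exists>e. embedding_map X Z e)"


section \<open>Filter spaces\<close>

text \<open>A filter on \<open>S\<close> is given by a filter \<open>F\<close> on the surrounding type that contains \<open>S\<close>; its
  members are the \<open>U \<subseteq> S\<close> with \<open>\<forall>\<^sub>F s in F. s \<in> U\<close>. The value \<open>F = bot\<close>, where the members are
  all the subsets of \<open>S\<close>, is allowed.\<close>

definition free_filter_on :: "'s set \<Rightarrow> 's filter \<Rightarrow> bool" where
  "free_filter_on S F \<longleftrightarrow>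
     F \<le> principal S \<and> \<Inter>{U. U \<subseteq> S \<and> (\<forall>\<^sub>F s in F. s \<in> U)} = {}"

text \<open>The point \<open>\<ast>\<close> is \<open>None\<close>.\<close>

definition filter_space :: "'s set \<Rightarrow> 's filter \<Rightarrow> 's option topology" where
  "filter_space S F = topology (\<lambda>W. W \<subseteq> insert None (Some ` S) \<and>
     (None \<in> W \<longrightarrow> (\<forall>\<^sub>F s in F. Some s \<in> W)))"

lemma openin_filter_space:
  "openin (filter_space S F) W \<longleftrightarrow>
     W \<subseteq> insert None (Some ` S) \<and> (None \<in> W \<longrightarrow> (\<forall>\<^sub>F s in F. Some s \<in> W))"
proof -
  let ?P = "\<lambda>W. W \<subseteq> insert None (Some ` S) \<and> (None \<in> W \<longrightarrow> (\<forall>\<^sub>F s in F. Some s \<in> W))"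
  have "istopology ?P"
    unfolding istopology_def
  proof (intro conjI allI impI)
    fix V W assume V: "?P V" and W: "?P W"
    show "V \<inter> W \<subseteq> insert None (Some ` S)"
      using V by blast
    assume "None \<in> V \<inter> W"
    with V W have "(\<forall>\<^sub>F s in F. Some s \<in> V) \<and> (\<forall>\<^sub>F s in F. Some s \<in> W)"
      by blast
    then show "\<forall>\<^sub>F s in F. Some s \<in> V \<inter> W"
      by (simp add: eventually_conj_iff)
  next
    fix \<K> assume K: "\<forall>W\<in>\<K>. ?P W"
    then show "\<Union>\<K> \<subseteq> insert None (Some ` S)"
      by blast
    assume "None \<in> \<Union>\<K>"
    then obtain W where W: "W \<in> \<K>" "None \<in> W"
      by blast
    with K have "\<forall>\<^sub>F s in F. Some s \<in> W"
      by blast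
    then show "\<forall>\<^sub>F s in F. Some s \<in> \<Union>\<K>"
      by (rule eventually_mono) (use W in blast)
  qed
  then show ?thesis
    by (simp add: filter_space_def)
qed

lemma topspace_filter_space:
  assumes "F \<le> principal S"
  shows "topspace (filter_space S F) = insert None (Some ` S)"
proof
  show "topspace (filter_space S F) \<subseteq> insert None (Some ` S)"
    using openin_filter_space openin_topspace by blast
  have "\<forall>\<^sub>F s in F. s \<in> S"
    using assms by (simp add: le_principal)
  then have "openin (filter_space S F) (insert None (Some ` S))"
    by (simp add: openin_filter_space image_iff)
  then show "insert None (Some ` S) \<subseteq> topspace (filter_space S F)"
    by (rule openin_subset)
qed


section \<open>Directed sets\<close>

text \<open>Posets are types of class \<open>order\<close>, so they are nonempty. The directed set of positive
  integers is represented by the order isomorphic type \<open>nat\<close>, and \<open>1\<close> by \<open>unit\<close>.\<close>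

definition directed_poset :: "'p::order itself \<Rightarrow> bool" where
  "directed_poset TYPE('p) \<longleftrightarrow> (\<forall>p q::'p. \<exists>r. p \<le> r \<and> q \<le> r)"

definition countably_directed :: "'p::order itself \<Rightarrow> bool" where
  "countably_directed TYPE('p) \<longleftrightarrow> (\<forall>A::'p set. countable A \<longrightarrow> bdd_above A)"

definition tukey_quotient :: "('p::order \<Rightarrow> 'q::order) \<Rightarrow> bool" where
  "tukey_quotient \<phi> \<longleftrightarrow> mono \<phi> \<and> (\<forall>q. \<exists>p. q \<le> \<phi> p)"

definition tukey_equivalent :: "'p::order itself \<Rightarrow> 'q::order itself \<Rightarrow> bool" where
  "tukey_equivalent TYPE('p) TYPE('q) \<longleftrightarrow>
     (\<exists>\<phi>::'p \<Rightarrow> 'q. tukey_quotient \<phi>) \<and> (\<exists>\<psi>::'q \<Rightarrow> 'p. tukey_quotient \<psi>)"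

definition has_ordered_compact_cover :: "'p::order itself \<Rightarrow> 'a topology \<Rightarrow> bool" where
  "has_ordered_compact_cover TYPE('p) Z \<longleftrightarrow>
     (\<exists>C::'p \<Rightarrow> 'a set. mono C \<and> (\<forall>p. compactin Z (C p)) \<and> (\<Union>p. C p) = topspace Z)"

text \<open>\<open>ordered_property TYPE('p) Q \<C>\<close>: the collection \<open>\<C>\<close> is \<open>P\<close>-\<open>Q\<close>.\<close>

definition ordered_property :: "'p::order itself \<Rightarrow> ('c set \<Rightarrow> bool) \<Rightarrow> 'c set \<Rightarrow> bool" where
  "ordered_property TYPE('p) Q \<C> \<longleftrightarrow>
     (\<exists>C::'p \<Rightarrow> 'c set. mono C \<and> \<C> = (\<Union>p. C p) \<and> (\<forall>p. Q (C p)))"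


section \<open>Properties of collections\<close>

definition Noetherian_family :: "'a set set \<Rightarrow> bool" where
  "Noetherian_family \<C> \<longleftrightarrow>
     (\<forall>\<D>\<subseteq>\<C>. well_order_on \<D> {(A, B). A \<in> \<D> \<and> B \<in> \<D> \<and> A \<subseteq> B} \<longrightarrow> finite \<D>)"

definition additively_Noetherian :: "'a set set \<Rightarrow> bool" where
  "additively_Noetherian \<C> \<longleftrightarrow> Noetherian_family {\<Union>\<D> |\<D>. \<D> \<subseteq> \<C>}"

definition point_finite :: "'a topology \<Rightarrow> 'a set set \<Rightarrow> bool" where
  "point_finite X \<C> \<longleftrightarrow> (\<forall>x \<in> topspace X. finite {C \<in> \<C>. x \<in> C})"

definition point_additively_Noetherian :: "'a topology \<Rightarrow> 'a set set \<Rightarrow> bool" where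
  "point_additively_Noetherian X \<C> \<longleftrightarrow>
     (\<forall>x \<in> topspace X. additively_Noetherian {C \<in> \<C>. x \<in> C})"

definition point_additively_Noetherian_pairs ::
    "'a topology \<Rightarrow> ('a set \<times> 'a set) set \<Rightarrow> bool" where
  "point_additively_Noetherian_pairs X \<N> \<longleftrightarrow>
     (\<forall>x \<in> topspace X. additively_Noetherian (fst ` {(N, V) \<in> \<N>. x \<in> V}))"


section \<open>Almost subbases and networks\<close>

text \<open>Representations are indexed from \<open>1\<close>; the value at \<open>0\<close> is ignored.\<close>

definition U_representation :: "'a topology \<Rightarrow> 'a set \<Rightarrow> (nat \<Rightarrow> 'a set) \<Rightarrow> bool" where
  "U_representation X V U \<longleftrightarrow>
     V = (\<Union>n\<in>{1..}. U n) \<and>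
     (\<forall>n\<ge>1. U n \<subseteq> U (n + 1)) \<and>
     (\<forall>n\<ge>1. zeroset_in X (U (2 * n - 1)) \<and> cozeroset_in X (U (2 * n)))"

definition almost_subbase :: "'a topology \<Rightarrow> 'a set set \<Rightarrow> bool" where
  "almost_subbase X \<alpha> \<longleftrightarrow>
     (\<exists>U::'a set \<Rightarrow> nat \<Rightarrow> 'a set.
        (\<forall>V\<in>\<alpha>. U_representation X V (U V)) \<and>
        subbase_of X (\<alpha> \<union> {topspace X - U V (2 * n - 1) |V n. V \<in> \<alpha> \<and> n \<ge> 1}))"

definition expandable_network :: "'a topology \<Rightarrow> ('a set \<times> 'a set) set \<Rightarrow> bool" where
  "expandable_network X \<N> \<longleftrightarrow>
     (\<forall>(N, V)\<in>\<N>. N \<subseteq> V \<and> openin X V) \<and>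
     (\<forall>x U. openin X U \<and> x \<in> U \<longrightarrow> (\<exists>(N, V)\<in>\<N>. x \<in> N \<and> N \<subseteq> U))"

definition ordered_point_collections ::
    "('a set set \<Rightarrow> bool) \<Rightarrow> 'a topology \<Rightarrow> ('p::order \<Rightarrow> 'a \<Rightarrow> 'a set set) \<Rightarrow> bool" where
  "ordered_point_collections Q X W \<longleftrightarrow>
     (\<forall>x \<in> topspace X. mono (\<lambda>p. W p x) \<and>
        (\<forall>p. Q (W p x) \<and> (\<forall>A \<in> W p x. x \<in> A \<and> A \<subseteq> topspace X)))"

definition has_point_network ::
    "'p::order itself \<Rightarrow> ('a set set \<Rightarrow> bool) \<Rightarrow> 'a topology \<Rightarrow> bool" where
  "has_point_network TYPE('p) Q X \<longleftrightarrow>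
     (\<exists>W::'p \<Rightarrow> 'a \<Rightarrow> 'a set set. ordered_point_collections Q X W \<and>
        (\<forall>x U. openin X U \<and> x \<in> U \<longrightarrow>
           (\<exists>V p. openin X V \<and> x \<in> V \<and> V \<subseteq> U \<and> (\<forall>y\<in>V. \<exists>A \<in> W p y. x \<in> A \<and> A \<subseteq> U))))"

definition has_strong_point_network ::
    "'p::order itself \<Rightarrow> ('a set set \<Rightarrow> bool) \<Rightarrow> 'a topology \<Rightarrow> bool" where
  "has_strong_point_network TYPE('p) Q X \<longleftrightarrow>
     (\<exists>W::'p \<Rightarrow> 'a \<Rightarrow> 'a set set. ordered_point_collections Q X W \<and>
        (\<forall>x U. openin X U \<and> x \<in> U \<longrightarrow>
           (\<exists>V p. openin X V \<and> x \<in> V \<and> V \<subseteq> U \<and> (\<forall>y\<in>V. \<exists>A \<in> W p y. x \<in> A \<and> A \<subseteq> V))))"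


section \<open>The conditions\<close>

text \<open>HOL cannot quantify over types inside a formula, so in the next two definitions the type
  \<open>'s\<close> from which the infinite set \<open>S\<close> is taken is a parameter. In a premise it should be an
  arbitrary type variable. For a conclusion about a compact Hausdorff space on \<open>'a\<close> the type
  \<open>'a set \<times> nat\<close> is large enough: as many points of \<open>S\<close> as the weight of the space suffice
  to separate its points, and one can restrict to them and countably many more.\<close>

definition embeds_in_Cp_filter_space ::
    "'s itself \<Rightarrow> 'p::order itself \<Rightarrow> 'a topology \<Rightarrow> bool" where
  "embeds_in_Cp_filter_space TYPE('s) TYPE('p) X \<longleftrightarrow>
     (\<exists>(S::'s set) F. infinite S \<and> free_filter_on S F \<and>
        has_ordered_compact_cover TYPE('p) (filter_space S F) \<and>
        embeds_in X (Cp (filter_space S F)))"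

definition embeds_in_Cp_Alexandroff :: "'s itself \<Rightarrow> 'a topology \<Rightarrow> bool" where
  "embeds_in_Cp_Alexandroff TYPE('s) X \<longleftrightarrow>
     (\<exists>S::'s set. infinite S \<and>
        embeds_in X (Cp (Alexandroff_compactification (discrete_topology S))))"

definition has_point_finite_almost_subbase :: "'p::order itself \<Rightarrow> 'a topology \<Rightarrow> bool" where
  "has_point_finite_almost_subbase TYPE('p) X \<longleftrightarrow>
     (\<exists>\<alpha>. almost_subbase X \<alpha> \<and> ordered_property TYPE('p) (point_finite X) \<alpha>)"

definition has_point_additively_Noetherian_base ::
    "'p::order itself \<Rightarrow> 'a topology \<Rightarrow> bool" where
  "has_point_additively_Noetherian_base TYPE('p) X \<longleftrightarrow>
     (\<exists>\<B>. base_of X \<B> \<and> ordered_property TYPE('p) (point_additively_Noetherian X) \<B>)"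

definition has_point_additively_Noetherian_expandable_network ::
    "'p::order itself \<Rightarrow> 'a topology \<Rightarrow> bool" where
  "has_point_additively_Noetherian_expandable_network TYPE('p) X \<longleftrightarrow>
     (\<exists>\<N>. expandable_network X \<N> \<and>
        ordered_property TYPE('p) (point_additively_Noetherian_pairs X) \<N>)"

end

theory Submission
  imports Defs "HOL-Library.Ramsey"
begin

text \<open>
  All the conditions are linked by a cycle in which one implication is deep: a compact space with
  a \<open>P\<close>-additively Noetherian point network carries a \<open>P\<close>-point finite family of continuous
  functions that separates its points (\<open>ex_separating_family\<close>). Level sets of these functions form
  an almost subbase; finite intersections of its members and of the open sets that belong to it
  form a base; a base yields a strong point network and an expandable network; and the
  \<open>U\<close>-representations of an almost subbase produce the functions of an embedding into a space
  \<open>C\<^sub>p(S(\<F>))\<close>, whose coordinates form a separating family again. The weakest condition, the point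
  network, is also the one that visibly passes to a continuous image \<open>Y\<close>: choose one point \<open>x\<^sub>z\<close> in
  the fibre of every \<open>z\<close>, and map the collections at \<open>x\<^sub>z\<close> forward
  (\<open>continuous_image_point_network\<close>). So \<open>Y\<close> inherits everything.

  Additive Noetherianity is used in the form that there are no bad sequences: whenever \<open>x\<^sub>n \<in> A\<^sub>n\<close> for
  all \<open>n\<close>, some \<open>x\<^sub>j\<close> lies in an earlier \<open>A\<^sub>i\<close>. Ramsey's theorem carries this property over to finite
  unions, to intersections and to pairs.

  The deep implication goes by induction on the cardinality of sets of continuous functions. Call a
  set small if \<open>P\<close> indexes it so that each \<open>p\<close> bounds only finitely many of the indices. A small set
  of functions is a separating family for the quotient space that it determines. Let \<open>A\<close> be a set
  that is not small. Well-order the continuous functions, and let \<open>I a b\<close> consist of the functions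
  that are first to separate some pair \<open>(x, y)\<close> and that the network detects from \<open>(a, b)\<close>. There are
  no bad sequences, so \<open>I a b\<close> is small, and a set of fewer than \<open>|A|\<close> functions still has fewer than
  \<open>|A|\<close> elements after it has been closed under \<open>I\<close>. On the other hand the quotient of \<open>X\<close> by a closed set of functions
  is realised by a retraction of \<open>X\<close>. Well-ordering \<open>A\<close> in its cardinal type gives an increasing chain
  of retractions \<open>lower b\<close>, \<open>upper b\<close> for \<open>b \<in> A\<close>, to which the induction hypothesis applies, and the
  functions \<open>f \<circ> upper b - f \<circ> lower b\<close> with \<open>f\<close> from the family of stage \<open>b\<close> separate points.

  It remains to see that a point \<open>y\<close> meets the supports of few of them: for a given label \<open>p\<close> only
  finitely many \<open>b\<close> with \<open>lower b y \<noteq> upper b y\<close> may occur. The network at the pair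
  \<open>(lower b x, x)\<close> links \<open>b\<close>, in a neighbourhood of \<open>x\<close>, to an earlier place \<open>c\<close> where \<open>x\<close> is moved, or
  to the bottom of the chain; and a bad sequence would arise if infinitely many \<open>b\<close> were linked at \<open>y\<close>
  to the same place with labels below \<open>p\<close> (\<open>finite_link\<close>). Descending along links ends after finitely
  many steps. So the \<open>b\<close> that reach the bottom in at most \<open>\<phi> p\<close> links with label \<open>p\<close> are finite in
  number, and since a truncated support is compact, one label serves for all of its points.

  The map \<open>\<phi>\<close> from \<open>P\<close> to the natural numbers, monotone and unbounded, exists exactly because \<open>P\<close> is
  not countably directed; it absorbs countably many additional indices. When \<open>P\<close> is Tukey equivalent
  to \<open>1\<close>, all conditions refer to the natural numbers, and \<open>\<phi>\<close> is the identity.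
\<close>

unbundle cardinal_syntax

section \<open>Bad sequences in families of sets\<close>

lemma ramsey_sequence:
  fixes R :: "nat \<Rightarrow> nat \<Rightarrow> bool"
  obtains s :: "nat \<Rightarrow> nat" where "strict_mono s" "\<And>i j. i < j \<Longrightarrow> R (s i) (s j)"
    | s :: "nat \<Rightarrow> nat" where "strict_mono s" "\<And>i j. i < j \<Longrightarrow> \<not> R (s i) (s j)"
proof -
  define f where "f = (\<lambda>Z. if R (Min Z) (Max Z) then 1 else 0::nat)"
  have "\<exists>Y t. Y \<subseteq> UNIV \<and> infinite Y \<and> t < 2 \<and> (\<forall>x\<in>Y. \<forall>y\<in>Y. x \<noteq> y \<longrightarrow> f {x, y} = t)"
    by (rule Ramsey2) (auto simp: f_def)
  then obtain Y t where Y: "infinite Y" and t: "\<forall>x\<in>Y. \<forall>y\<in>Y. x \<noteq> y \<longrightarrow> f {x, y} = t"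
    by blast
  define s where "s = enumerate Y"
  have s: "strict_mono s"
    unfolding s_def by (intro strict_monoI enumerate_mono Y)
  have "f {s i, s j} = t" if "i < j" for i j
    using t enumerate_in_set[OF Y] strict_monoD[OF s that] unfolding s_def by (metis less_irrefl)
  moreover have "f {s i, s j} = (if R (s i) (s j) then 1 else 0)" if "i < j" for i j
    using strict_monoD[OF s that] by (simp add: f_def)
  ultimately have "(R (s i) (s j) \<longleftrightarrow> t = 1)" if "i < j" for i j
    using that by (metis zero_neq_one)
  then show thesis
    using that s by (cases "t = 1") blast+
qed

text \<open>Among the two alternatives that Ramsey's theorem leaves for an injective sequence, an infinite
  descent is excluded by well-foundedness.\<close>

lemma increasing_sequence_in_wellorder:
  assumes "wf R" and "infinite Z"
    and total: "\<And>x y. x \<in> Z \<Longrightarrow> y \<in> Z \<Longrightarrow> x \<noteq> y \<Longrightarrow> (x, y) \<in> R \<or> (y, x) \<in> R"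
  obtains s :: "nat \<Rightarrow> 'c" where "\<And>n. s n \<in> Z" and "\<And>i j. i < j \<Longrightarrow> (s i, s j) \<in> R"
proof -
  obtain e :: "nat \<Rightarrow> 'c" where e: "inj e" "range e \<subseteq> Z"
    using infinite_countable_subset[OF \<open>infinite Z\<close>] by blast
  show thesis
  proof (rule ramsey_sequence[of "\<lambda>i j. (e i, e j) \<in> R"])
    fix s :: "nat \<Rightarrow> nat" assume "strict_mono s" "\<And>i j. i < j \<Longrightarrow> (e (s i), e (s j)) \<in> R"
    then show thesis
      using e(2) by (intro that[of "\<lambda>i. e (s i)"]) blast+
  next
    fix s :: "nat \<Rightarrow> nat" assume s: "strict_mono s" "\<And>i j. i < j \<Longrightarrow> (e (s i), e (s j)) \<notin> R"
    have "(e (s (Suc i)), e (s i)) \<in> R" for i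
    proof -
      have "s i \<noteq> s (Suc i)"
        using strict_monoD[OF s(1), of i "Suc i"] by simp
      then have "e (s i) \<noteq> e (s (Suc i))"
        using e(1) by (meson injD)
      then show ?thesis
        using total e(2) s(2)[of i "Suc i"] by blast
    qed
    then have "\<exists>f. \<forall>i. (f (Suc i), f i) \<in> R"
      by (intro exI[of _ "\<lambda>i. e (s i)"]) blast
    then show thesis
      using \<open>wf R\<close> wf_iff_no_infinite_down_chain by metis
  qed
qed

text \<open>This is to additively Noetherian families what the absence of bad sequences is to well-quasi-orders,
  and it is the only form in which Noetherian conditions are used below.\<close>

definition no_bad_sequence :: "'a set set \<Rightarrow> bool" where
  "no_bad_sequence \<F> \<longleftrightarrow>
     (\<forall>(A :: nat \<Rightarrow> 'a set) x. (\<forall>n. A n \<in> \<F> \<and> x n \<in> A n) \<longrightarrow> (\<exists>i j. i < j \<and> x j \<in> A i))"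

lemma no_bad_sequenceD:
  assumes "no_bad_sequence \<F>" "\<And>n::nat. A n \<in> \<F>" "\<And>n. x n \<in> A n"
  obtains i j where "i < j" "x j \<in> A i"
  using assms unfolding no_bad_sequence_def by blast

text \<open>A subsequence on which membership always fails would be a bad sequence, so Ramsey's theorem leaves
  one on which it always holds. This upgrade from one pair \<open>i < j\<close> to all pairs is what makes finite
  intersections and pairs of families tractable.\<close>

lemma no_bad_sequence_subsequence:
  assumes "no_bad_sequence \<F>" "\<And>n::nat. A n \<in> \<F>" "\<And>n. x n \<in> A n"
  obtains s :: "nat \<Rightarrow> nat" where "strict_mono s" "\<And>i j. i < j \<Longrightarrow> x (s j) \<in> A (s i)"
proof (rule ramsey_sequence[of "\<lambda>i j. x j \<in> A i"])
  fix s :: "nat \<Rightarrow> nat" assume s: "strict_mono s" "\<And>i j. i < j \<Longrightarrow> x (s j) \<notin> A (s i)"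
  then show thesis
    using no_bad_sequenceD[OF assms(1), of "\<lambda>n. A (s n)" "\<lambda>n. x (s n)"] assms(2,3) by metis
qed (use that in blast)

lemma Noetherian_family_no_ascending_sequence:
  assumes "Noetherian_family \<C>" and "\<And>n::nat. D n \<in> \<C>"
  shows "\<exists>n. \<not> D n \<subset> D (Suc n)"
proof (rule ccontr)
  assume "\<nexists>n. \<not> D n \<subset> D (Suc n)"
  then have mono: "strict_mono D"
    by (intro strict_mono_Suc_iff[THEN iffD2]) blast
  have le: "D m \<subseteq> D n \<longleftrightarrow> m \<le> n" for m n
    using strict_mono_less_eq[OF mono] by blast
  have inj: "inj D"
    by (rule strict_mono_imp_inj_on[OF mono])
  define r where "r = {(A, B). A \<in> range D \<and> B \<in> range D \<and> A \<subseteq> B}"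
  have "r - Id \<subseteq> inv_image less_than (inv D)"
    unfolding r_def using inj le by (auto simp: inv_f_f le_less)
  then have "wf (r - Id)"
    using wf_inv_image wf_less_than wf_subset by blast
  moreover have "linear_order_on (range D) r"
    unfolding r_def linear_order_on_def partial_order_on_def preorder_on_def refl_on_def
      trans_def antisym_def total_on_def
    using le by (auto simp: linear)
  ultimately have "well_order_on (range D) r"
    by (simp add: well_order_on_def)
  then have "finite (range D)"
    using assms unfolding Noetherian_family_def r_def by blast
  then show False
    using range_inj_infinite[OF inj] by blast
qed

text \<open>The partial unions along a bad sequence would be a strictly increasing sequence of unions of members.\<close>

lemma additively_Noetherian_imp_no_bad_sequence:
  assumes "additively_Noetherian \<F>"
  shows "no_bad_sequence \<F>"
  unfolding no_bad_sequence_def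
proof (intro allI impI)
  fix A x assume *: "\<forall>n::nat. A n \<in> \<F> \<and> x n \<in> A n"
  define D where "D n = \<Union> (A ` {..n})" for n
  have "D n \<in> {\<Union>\<D> |\<D>. \<D> \<subseteq> \<F>}" for n
    unfolding D_def using * by blast
  then obtain n where "\<not> D n \<subset> D (Suc n)"
    using Noetherian_family_no_ascending_sequence[OF assms[unfolded additively_Noetherian_def], of D]
    by blast
  moreover have "D n \<subseteq> D (Suc n)"
    unfolding D_def by (intro Union_mono image_mono) auto
  moreover have "x (Suc n) \<in> D (Suc n)"
    using * unfolding D_def by blast
  ultimately have "x (Suc n) \<in> D n"
    by blast
  then obtain i where "i \<le> n" "x (Suc n) \<in> A i"
    unfolding D_def by blast
  then show "\<exists>i j. i < j \<and> x j \<in> A i"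
    using le_imp_less_Suc by blast
qed

text \<open>From an infinite well-ordered set of unions take an increasing sequence \<open>D\<close>, and pick a member of
  the family inside \<open>D (n + 1)\<close> that contains a point outside \<open>D n\<close>; these members form a bad sequence.\<close>

lemma no_bad_sequence_imp_additively_Noetherian:
  assumes "no_bad_sequence \<F>"
  shows "additively_Noetherian \<F>"
  unfolding additively_Noetherian_def Noetherian_family_def
proof (intro allI impI)
  fix \<D> assume sub: "\<D> \<subseteq> {\<Union>\<D> |\<D>. \<D> \<subseteq> \<F>}"
    and wo: "well_order_on \<D> {(A, B). A \<in> \<D> \<and> B \<in> \<D> \<and> A \<subseteq> B}" (is "well_order_on \<D> ?r")
  show "finite \<D>"
  proof (rule ccontr)
    assume inf: "infinite \<D>"
    have "wf (?r - Id)" and tot: "total_on \<D> ?r"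
      using wo by (auto simp: well_order_on_def linear_order_on_def)
    obtain D where D: "\<And>n::nat. D n \<in> \<D>" "\<And>i j. i < j \<Longrightarrow> (D i, D j) \<in> ?r - Id"
      using increasing_sequence_in_wellorder[OF \<open>wf (?r - Id)\<close> inf] tot
      unfolding total_on_def by blast
    have "\<exists>x A. A \<in> \<F> \<and> x \<in> A \<and> x \<notin> D n \<and> A \<subseteq> D (Suc n)" for n
    proof -
      obtain x where x: "x \<in> D (Suc n)" "x \<notin> D n"
        using D(2)[of n "Suc n"] by blast
      then show ?thesis
        using D(1)[of "Suc n"] sub by blast
    qed
    then have "\<exists>x. \<forall>n. \<exists>A. A \<in> \<F> \<and> x n \<in> A \<and> x n \<notin> D n \<and> A \<subseteq> D (Suc n)"
      by (intro choice allI)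
    then obtain x where "\<forall>n. \<exists>A. A \<in> \<F> \<and> x n \<in> A \<and> x n \<notin> D n \<and> A \<subseteq> D (Suc n)" ..
    from choice[OF this] obtain A
      where "\<forall>n. A n \<in> \<F> \<and> x n \<in> A n \<and> x n \<notin> D n \<and> A n \<subseteq> D (Suc n)" ..
    then have *: "A n \<in> \<F>" "x n \<in> A n" "x n \<notin> D n" "A n \<subseteq> D (Suc n)" for n
      by simp_all
    obtain i j where "i < j" "x j \<in> A i"
      by (rule no_bad_sequenceD[OF assms *(1,2)])
    moreover have "D (Suc i) \<subseteq> D j"
      using D(2)[of "Suc i" j] \<open>i < j\<close> by (cases "Suc i = j") auto
    ultimately show False
      using * by blast
  qed
qed

lemma additively_Noetherian_iff_no_bad_sequence:
  "additively_Noetherian \<F> \<longleftrightarrow> no_bad_sequence \<F>"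
  using additively_Noetherian_imp_no_bad_sequence no_bad_sequence_imp_additively_Noetherian by blast

lemma no_bad_sequence_subset:
  "no_bad_sequence \<F> \<Longrightarrow> \<G> \<subseteq> \<F> \<Longrightarrow> no_bad_sequence \<G>"
  unfolding no_bad_sequence_def by blast

lemma no_bad_sequence_finite:
  assumes "finite \<F>"
  shows "no_bad_sequence \<F>"
  unfolding no_bad_sequence_def
proof (intro allI impI)
  fix A x assume *: "\<forall>n::nat. A n \<in> \<F> \<and> x n \<in> A n"
  then have "range A \<subseteq> \<F>"
    by blast
  then have "\<not> inj A"
    using assms finite_subset range_inj_infinite by blast
  then obtain i j where "A i = A j" "i < j"
    unfolding inj_on_def by (metis linorder_neqE_nat)
  then show "\<exists>i j. i < j \<and> x j \<in> A i"
    using * by metis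
qed

lemma no_bad_sequence_Un:
  assumes "no_bad_sequence \<F>" "no_bad_sequence \<G>"
  shows "no_bad_sequence (\<F> \<union> \<G>)"
  unfolding no_bad_sequence_def
proof (intro allI impI)
  fix A x assume *: "\<forall>n::nat. A n \<in> \<F> \<union> \<G> \<and> x n \<in> A n"
  have sub: "\<exists>i j. i < j \<and> x j \<in> A i"
    if s: "strict_mono s" "\<And>n. A (s n) \<in> \<H>" "no_bad_sequence \<H>" for s :: "nat \<Rightarrow> nat" and \<H>
  proof -
    obtain i j where "i < j" "x (s j) \<in> A (s i)"
      using no_bad_sequenceD[OF s(3), of "\<lambda>n. A (s n)" "\<lambda>n. x (s n)"] s(2) * by blast
    then show ?thesis
      using strict_monoD[OF s(1)] by blast
  qed
  show "\<exists>i j. i < j \<and> x j \<in> A i"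
  proof (cases "infinite {n. A n \<in> \<F>}")
    case True
    show ?thesis
      using sub[OF _ _ assms(1), of "enumerate {n. A n \<in> \<F>}"] enumerate_in_set[OF True]
        strict_mono_enumerate[OF True] by blast
  next
    case False
    then have inf: "infinite {n. A n \<in> \<G>}"
      using * finite_subset[of UNIV "{n. A n \<in> \<F>} \<union> {n. A n \<in> \<G>}"] infinite_UNIV_nat by blast
    show ?thesis
      using sub[OF _ _ assms(2), of "enumerate {n. A n \<in> \<G>}"] enumerate_in_set[OF inf]
        strict_mono_enumerate[OF inf] by blast
  qed
qed

lemma no_bad_sequence_UN:
  assumes "finite I" "\<And>i. i \<in> I \<Longrightarrow> no_bad_sequence (\<F> i)"
  shows "no_bad_sequence (\<Union>i\<in>I. \<F> i)"
  using assms
  by (induction I) (auto intro: no_bad_sequence_Un no_bad_sequence_finite)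

lemma no_bad_sequence_Int:
  assumes "no_bad_sequence \<F>" "no_bad_sequence \<G>"
  shows "no_bad_sequence {A \<inter> B |A B. A \<in> \<F> \<and> B \<in> \<G>}"
  unfolding no_bad_sequence_def
proof (intro allI impI)
  fix C x assume *: "\<forall>n::nat. C n \<in> {A \<inter> B |A B. A \<in> \<F> \<and> B \<in> \<G>} \<and> x n \<in> C n"
  then have "\<forall>n. \<exists>A B. A \<in> \<F> \<and> B \<in> \<G> \<and> C n = A \<inter> B"
    by blast
  then obtain A B where AB: "\<And>n. A n \<in> \<F>" "\<And>n. B n \<in> \<G>" "\<And>n. C n = A n \<inter> B n"
    by metis
  obtain s :: "nat \<Rightarrow> nat" where s: "strict_mono s" "\<And>i j. i < j \<Longrightarrow> x (s j) \<in> A (s i)"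
    using AB * by (rule_tac no_bad_sequence_subsequence[OF assms(1), of A x]) blast+
  obtain i j where "i < j" "x (s j) \<in> B (s i)"
    using no_bad_sequenceD[OF assms(2), of "\<lambda>n. B (s n)" "\<lambda>n. x (s n)"] AB * by blast
  then show "\<exists>i j. i < j \<and> x j \<in> C i"
    using s AB by (metis IntI strict_monoD)
qed

text \<open>The family of rectangles \<open>A \<times> B\<close> has no bad sequence, stated without forming the products.\<close>

lemma no_bad_sequence_product:
  assumes "no_bad_sequence \<F>" "no_bad_sequence \<G>"
    and "\<And>n::nat. A n \<in> \<F>" "\<And>n. x n \<in> A n" "\<And>n. B n \<in> \<G>" "\<And>n. y n \<in> B n"
  obtains i j where "i < j" "x j \<in> A i" "y j \<in> B i"
proof -
  obtain s :: "nat \<Rightarrow> nat" where s: "strict_mono s" "\<And>i j. i < j \<Longrightarrow> x (s j) \<in> A (s i)"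
    using no_bad_sequence_subsequence[of \<F> A x, OF assms(1,3,4)] by blast
  obtain i j where "i < j" "y (s j) \<in> B (s i)"
    using no_bad_sequenceD[OF assms(2), of "\<lambda>n. B (s n)" "\<lambda>n. y (s n)"] assms(5,6) by blast
  then show thesis
    using s that by (metis strict_monoD)
qed

lemma no_bad_sequence_image:
  assumes "no_bad_sequence \<F>"
  shows "no_bad_sequence ((`) f ` \<F>)"
  unfolding no_bad_sequence_def
proof (intro allI impI)
  fix C y assume *: "\<forall>n::nat. C n \<in> (`) f ` \<F> \<and> y n \<in> C n"
  then have "\<forall>n. \<exists>A x. A \<in> \<F> \<and> C n = f ` A \<and> x \<in> A \<and> y n = f x"
    by blast
  then obtain A x where A: "\<And>n. A n \<in> \<F>" "\<And>n. C n = f ` A n" "\<And>n. x n \<in> A n" "\<And>n. y n = f (x n)"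
    by metis
  then obtain i j where "i < j" "x j \<in> A i"
    using no_bad_sequenceD[OF assms, of A x] by blast
  then show "\<exists>i j. i < j \<and> y j \<in> C i"
    using A by blast
qed

text \<open>Adding one point \<open>a\<close> to all members helps in enlarging the sets \<open>N\<close> of an expandable network to sets
  that contain the point at which they are used.\<close>

lemma no_bad_sequence_insert_point:
  assumes "no_bad_sequence \<F>"
  shows "no_bad_sequence (insert a ` \<F>)"
  unfolding no_bad_sequence_def
proof (intro allI impI)
  fix C x assume *: "\<forall>n::nat. C n \<in> insert a ` \<F> \<and> x n \<in> C n"
  show "\<exists>i j. i < j \<and> x j \<in> C i"
  proof (cases "\<exists>j>0. x j = a")
    case True
    then show ?thesis
      using * by (metis image_iff insertI1)
  next
    case False
    have "\<forall>n. \<exists>A. A \<in> \<F> \<and> C n = insert a A"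
      using * by blast
    then obtain A where A: "\<And>n. A n \<in> \<F>" "\<And>n. C n = insert a (A n)"
      by metis
    have "x (Suc n) \<in> A (Suc n)" for n
      using * A(2)[of "Suc n"] False by (metis insertE zero_less_Suc)
    then obtain i j where "i < j" "x (Suc j) \<in> A (Suc i)"
      using no_bad_sequenceD[OF assms, of "\<lambda>n. A (Suc n)" "\<lambda>n. x (Suc n)"] A by blast
    then show ?thesis
      using A(2) by blast
  qed
qed

section \<open>Smallness relative to a directed set\<close>

text \<open>The map \<open>\<phi>\<close> stands for the fact that \<open>P \<times> nat\<close> can be indexed by \<open>P\<close>: every countable number of
  choices made along the way is charged to \<open>\<phi> p\<close>.\<close>

locale unbounded_directed =
  fixes \<phi> :: "'p::order \<Rightarrow> nat"
  assumes directed: "directed_poset TYPE('p)"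
    and mono_\<phi>: "mono \<phi>"
    and unbounded_\<phi>: "\<exists>p. n \<le> \<phi> p"
begin

lemma upper_bound2:
  obtains r :: 'p where "p \<le> r" "q \<le> r"
  using directed unfolding directed_poset_def by blast

lemma finite_upper_bound:
  assumes "finite Q"
  obtains r :: 'p where "\<And>q. q \<in> Q \<Longrightarrow> q \<le> r"
proof -
  have "\<exists>r. \<forall>q\<in>Q. q \<le> r"
    using assms
  proof (induction Q)
    case (insert q Q)
    then obtain r where "\<forall>q\<in>Q. q \<le> r"
      by blast
    moreover obtain r' where "q \<le> r'" "r \<le> r'"
      using upper_bound2 by blast
    ultimately show ?case
      by (metis insert_iff order_trans)
  qed simp
  then show thesis
    using that by blast
qed

lemma upper_bound2_index:
  obtains r :: 'p where "p \<le> r" "q \<le> r" "n \<le> \<phi> r"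
proof -
  obtain s where "n \<le> \<phi> s"
    using unbounded_\<phi> by blast
  moreover obtain r where "\<And>t. t \<in> {p, q, s} \<Longrightarrow> t \<le> r"
    using finite_upper_bound[of "{p, q, s}"] by blast
  ultimately show thesis
    using monoD[OF mono_\<phi>, of s r] by (intro that[of r]) auto
qed

end

text \<open>In terms of Tukey reductions, \<open>B\<close> is small iff the finite subsets of \<open>B\<close> form a Tukey quotient of
  \<open>P\<close>. For such index sets every family can be \<open>P\<close>-ordered with finite levels, so all conditions of
  the theorem become trivial.\<close>

definition small_for :: "'p::order itself \<Rightarrow> 'b set \<Rightarrow> bool" where
  "small_for TYPE('p) B \<longleftrightarrow> (\<exists>h :: 'b \<Rightarrow> 'p. \<forall>p. finite {b \<in> B. h b \<le> p})"

text \<open>A union of small sets indexed by \<open>J\<close>. The cases \<open>J\<close> a singleton (smallness itself) and \<open>J\<close> an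
  infinite set, which bounds the cardinality, obey the same closure laws as soon as \<open>J \<times> J\<close> embeds
  into \<open>J\<close>; treating them together avoids proving these laws twice.\<close>

definition small_union :: "'p::order itself \<Rightarrow> 'j set \<Rightarrow> 'b set \<Rightarrow> bool" where
  "small_union TYPE('p) J B \<longleftrightarrow>
     (\<exists>k (h :: 'b \<Rightarrow> 'p). k ` B \<subseteq> J \<and> (\<forall>j p. finite {b \<in> B. k b = j \<and> h b \<le> p}))"

definition squarable :: "'j set \<Rightarrow> bool" where
  "squarable J \<longleftrightarrow> J \<noteq> {} \<and> (\<exists>f. inj_on f (J \<times> J) \<and> f ` (J \<times> J) \<subseteq> J)"

lemma squarable_singleton: "squarable {j}"
  unfolding squarable_def by (auto intro!: exI[of _ "\<lambda>_. j"] simp: inj_on_def)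

lemma squarable_infinite:
  assumes "infinite J"
  shows "squarable J"
proof -
  have "|J \<times> J| \<le>o |J|"
    using assms card_of_Times_same_infinite ordIso_iff_ordLeq by blast
  then show ?thesis
    using assms unfolding squarable_def card_of_ordLeq[symmetric] by blast
qed

context unbounded_directed
begin

lemma small_union_subset:
  assumes "small_union TYPE('p) J B" "C \<subseteq> B"
  shows "small_union TYPE('p) J C"
proof -
  obtain k h where "k ` B \<subseteq> J" and fin: "\<And>j p. finite {b \<in> B. k b = j \<and> h b \<le> (p::'p)}"
    using assms(1) unfolding small_union_def by blast
  moreover have "finite {b \<in> C. k b = j \<and> h b \<le> p}" for j p
    using assms(2) by (intro finite_subset[OF _ fin[of j p]]) blast
  ultimately show ?thesis
    using assms(2) unfolding small_union_def by blast
qed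

lemma small_imp_small_union:
  assumes "small_for TYPE('p) B" "j \<in> J"
  shows "small_union TYPE('p) J B"
proof -
  obtain h where fin: "\<And>p. finite {b \<in> B. h b \<le> (p::'p)}"
    using assms(1) unfolding small_for_def by blast
  have "finite {b \<in> B. (\<lambda>_. j) b = j' \<and> h b \<le> p}" for j' p
    by (rule finite_subset[OF _ fin[of p]]) blast
  then show ?thesis
    using assms(2) unfolding small_union_def
    by (intro exI[of _ "\<lambda>_. j"] exI[of _ h]) blast
qed

lemma small_union_singleton_iff: "small_union TYPE('p) {j} B \<longleftrightarrow> small_for TYPE('p) B"
proof
  assume "small_union TYPE('p) {j} B"
  then obtain k h where "k ` B \<subseteq> {j}" and fin: "\<And>j p. finite {b \<in> B. k b = j \<and> h b \<le> (p::'p)}"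
    unfolding small_union_def by blast
  then have "{b \<in> B. h b \<le> p} = {b \<in> B. k b = j \<and> h b \<le> p}" for p
    by blast
  then show "small_for TYPE('p) B"
    using fin[of j] unfolding small_for_def by (intro exI[of _ h]) simp
qed (simp add: small_imp_small_union)

text \<open>An element \<open>b\<close> inherits an upper bound of two labels, that of a chosen \<open>i\<close> with \<open>b \<in> B i\<close> and that
  within \<open>B i\<close>; so a label below \<open>p\<close> leaves finitely many \<open>i\<close> and finitely many \<open>b\<close> for each of them.\<close>

lemma small_union_UNION:
  assumes J: "squarable J" and I: "small_union TYPE('p) J I"
    and B: "\<And>i. i \<in> I \<Longrightarrow> small_union TYPE('p) J (B i)"
  shows "small_union TYPE('p) J (\<Union>i\<in>I. B i)"
proof -
  obtain \<pi> where \<pi>: "inj_on \<pi> (J \<times> J)" "\<pi> ` (J \<times> J) \<subseteq> J"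
    using J unfolding squarable_def by blast
  obtain k h where k: "k ` I \<subseteq> J" and fin: "\<And>j p. finite {i \<in> I. k i = j \<and> h i \<le> (p::'p)}"
    using I unfolding small_union_def by blast
  have "\<forall>i\<in>I. \<exists>k h. k ` B i \<subseteq> J \<and> (\<forall>j p. finite {b \<in> B i. k b = j \<and> h b \<le> (p::'p)})"
    using B unfolding small_union_def by simp
  from bchoice[OF this] obtain K
    where "\<forall>i\<in>I. \<exists>h. K i ` B i \<subseteq> J \<and> (\<forall>j p. finite {b \<in> B i. K i b = j \<and> h b \<le> (p::'p)})" ..
  from bchoice[OF this] obtain H where
    "\<forall>i\<in>I. K i ` B i \<subseteq> J \<and> (\<forall>j p. finite {b \<in> B i. K i b = j \<and> H i b \<le> (p::'p)})" ..
  then have K: "K i ` B i \<subseteq> J" and KH: "finite {b \<in> B i. K i b = j \<and> H i b \<le> p}"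
    if "i \<in> I" for i j p
    using that by simp_all
  define i where "i b = (SOME i. i \<in> I \<and> b \<in> B i)" for b
  have i: "i b \<in> I" "b \<in> B (i b)" if "b \<in> (\<Union>i\<in>I. B i)" for b
    using someI_ex[of "\<lambda>i. i \<in> I \<and> b \<in> B i"] that unfolding i_def by auto
  have "\<forall>b. \<exists>r. h (i b) \<le> r \<and> H (i b) b \<le> r"
    using upper_bound2 by metis
  from choice[OF this] obtain h' where h': "\<forall>b. h (i b) \<le> h' b \<and> H (i b) b \<le> h' b" ..
  define k' where "k' b = \<pi> (k (i b), K (i b) b)" for b
  have in_J: "(k (i b), K (i b) b) \<in> J \<times> J" if "b \<in> (\<Union>i\<in>I. B i)" for b
    using i[OF that] k K by blast
  have "finite {b \<in> \<Union>i\<in>I. B i. k' b = j \<and> h' b \<le> p}" for j p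
  proof (cases "\<exists>j1\<in>J. \<exists>j2\<in>J. \<pi> (j1, j2) = j")
    case True
    then obtain j1 j2 where j: "j1 \<in> J" "j2 \<in> J" "\<pi> (j1, j2) = j"
      by blast
    have "{b \<in> \<Union>i\<in>I. B i. k' b = j \<and> h' b \<le> p} \<subseteq>
        (\<Union>i\<in>{i \<in> I. k i = j1 \<and> h i \<le> p}. {b \<in> B i. K i b = j2 \<and> H i b \<le> p})"
    proof
      fix b assume b: "b \<in> {b \<in> \<Union>i\<in>I. B i. k' b = j \<and> h' b \<le> p}"
      then have "(k (i b), K (i b) b) = (j1, j2)"
        using in_J[of b] j inj_onD[OF \<pi>(1)] unfolding k'_def by blast
      moreover have "h (i b) \<le> p" "H (i b) b \<le> p"
        using h' b order_trans by blast+
      moreover have "i b \<in> I" "b \<in> B (i b)"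
        using b i by blast+
      ultimately show "b \<in> (\<Union>i\<in>{i \<in> I. k i = j1 \<and> h i \<le> p}.
          {b \<in> B i. K i b = j2 \<and> H i b \<le> p})"
        by blast
    qed
    moreover have "finite (\<Union>i\<in>{i \<in> I. k i = j1 \<and> h i \<le> p}.
        {b \<in> B i. K i b = j2 \<and> H i b \<le> p})"
      using fin KH by blast
    ultimately show ?thesis
      by (rule finite_subset)
  next
    case False
    then have "{b \<in> \<Union>i\<in>I. B i. k' b = j \<and> h' b \<le> p} = {}"
      using in_J unfolding k'_def by blast
    then show ?thesis
      by (simp only: finite.emptyI)
  qed
  moreover have "k' ` (\<Union>i\<in>I. B i) \<subseteq> J"
    using in_J \<pi>(2) unfolding k'_def by blast
  ultimately show ?thesis
    unfolding small_union_def by blast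
qed

lemma small_union_image:
  assumes "small_union TYPE('p) J B"
  shows "small_union TYPE('p) J (f ` B)"
proof -
  obtain k h where k: "k ` B \<subseteq> J" and fin: "\<And>j p. finite {b \<in> B. k b = j \<and> h b \<le> (p::'p)}"
    using assms unfolding small_union_def by blast
  define g where "g = inv_into B f"
  have g: "g c \<in> B" "f (g c) = c" if "c \<in> f ` B" for c
    using that inv_into_into[of c f B] f_inv_into_f[of c f B] unfolding g_def by auto
  have "finite {c \<in> f ` B. k (g c) = j \<and> h (g c) \<le> p}" for j p
  proof (rule finite_subset)
    show "{c \<in> f ` B. k (g c) = j \<and> h (g c) \<le> p} \<subseteq> f ` {b \<in> B. k b = j \<and> h b \<le> p}"
      using g by (intro subsetI) (metis (mono_tags, lifting) image_eqI mem_Collect_eq)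
  qed (use fin in blast)
  then show ?thesis
    using k g(1) unfolding small_union_def
    by (intro exI[of _ "k \<circ> g"] exI[of _ "h \<circ> g"]) auto
qed

text \<open>This is where the unboundedness of \<open>\<phi>\<close> enters.\<close>

lemma small_countable:
  assumes "countable B"
  shows "small_for TYPE('p) B"
proof -
  have "\<forall>b. \<exists>p. to_nat_on B b \<le> \<phi> p"
    using unbounded_\<phi> by blast
  then obtain h where h: "\<And>b. to_nat_on B b \<le> \<phi> (h b)"
    by metis
  have "finite {b \<in> B. h b \<le> p}" for p
  proof (rule inj_on_finite)
    show "inj_on (to_nat_on B) {b \<in> B. h b \<le> p}"
      using inj_on_to_nat_on[OF assms] by (rule inj_on_subset) blast
    show "to_nat_on B ` {b \<in> B. h b \<le> p} \<subseteq> {..\<phi> p}"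
      using h monoD[OF mono_\<phi>] order_trans by auto blast
  qed simp
  then show ?thesis
    unfolding small_for_def by blast
qed

lemma small_union_countable:
  assumes "countable B" "squarable J"
  shows "small_union TYPE('p) J B"
proof -
  obtain j where "j \<in> J"
    using assms(2) unfolding squarable_def by blast
  then show ?thesis
    using small_imp_small_union small_countable[OF assms(1)] by metis
qed

lemma small_union_Un:
  assumes "squarable J" "small_union TYPE('p) J A" "small_union TYPE('p) J B"
  shows "small_union TYPE('p) J (A \<union> B)"
proof -
  have "small_union TYPE('p) J (\<Union>C\<in>{A, B}. C)"
    using assms by (intro small_union_UNION[OF assms(1) small_union_countable[OF _ assms(1)]]) auto
  then show ?thesis
    by simp
qed

lemma small_union_Times_countable:
  assumes J: "squarable J" "small_union TYPE('p) J A" and "countable C"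
  shows "small_union TYPE('p) J (A \<times> C)"
proof -
  have "small_union TYPE('p) J (\<Union>a\<in>A. Pair a ` C)"
    using assms by (intro small_union_UNION[OF J] small_union_image small_union_countable)
  moreover have "A \<times> C = (\<Union>a\<in>A. Pair a ` C)"
    by blast
  ultimately show ?thesis
    by simp
qed

lemma small_union_finite_subsets:
  assumes J: "squarable J" and B: "small_union TYPE('p) J B"
  shows "small_union TYPE('p) J {t. finite t \<and> t \<subseteq> B}"
proof -
  have len: "small_union TYPE('p) J {xs. set xs \<subseteq> B \<and> length xs = n}" for n
  proof (induction n)
    case 0
    have "{xs. set xs \<subseteq> B \<and> length xs = 0} = {[]}"
      by auto
    then show ?case
      using J small_union_countable by (metis countable_empty countable_insert)
  next
    case (Suc n)
    have "{xs. set xs \<subseteq> B \<and> length xs = Suc n} =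
        (\<Union>x\<in>B. (#) x ` {xs. set xs \<subseteq> B \<and> length xs = n})"
      by (auto simp: length_Suc_conv image_iff)
    then show ?case
      using J B Suc by (simp add: small_union_UNION small_union_image)
  qed
  have "small_union TYPE('p) J (\<Union>n::nat. {xs. set xs \<subseteq> B \<and> length xs = n})"
    using J len by (intro small_union_UNION[OF J small_union_countable[OF _ J]]) auto
  then have "small_union TYPE('p) J (set ` (\<Union>n::nat. {xs. set xs \<subseteq> B \<and> length xs = n}))"
    by (rule small_union_image)
  moreover have "{t. finite t \<and> t \<subseteq> B} \<subseteq> set ` (\<Union>n::nat. {xs. set xs \<subseteq> B \<and> length xs = n})"
  proof
    fix t assume t: "t \<in> {t. finite t \<and> t \<subseteq> B}"
    then obtain xs where "set xs = t"
      using finite_list by blast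
    then show "t \<in> set ` (\<Union>n::nat. {xs. set xs \<subseteq> B \<and> length xs = n})"
      using t by blast
  qed
  ultimately show ?thesis
    by (rule small_union_subset)
qed

lemma small_ordLeq:
  assumes "small_for TYPE('p) B" "|A| \<le>o |B|"
  shows "small_for TYPE('p) A"
proof -
  obtain f where f: "inj_on f A" "f ` A \<subseteq> B"
    using assms(2) unfolding card_of_ordLeq[symmetric] by blast
  obtain h where h: "\<And>p. finite {b \<in> B. h b \<le> (p::'p)}"
    using assms(1) unfolding small_for_def by blast
  have "finite {a \<in> A. h (f a) \<le> p}" for p
  proof (rule inj_on_finite[of f _ "{b \<in> B. h b \<le> p}"])
    show "inj_on f {a \<in> A. h (f a) \<le> p}"
      using f(1) by (rule inj_on_subset) blast
  qed (use f(2) h in blast)+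
  then show ?thesis
    unfolding small_for_def by (intro exI[of _ "h \<circ> f"]) simp
qed

lemma small_union_self: "small_union TYPE('p) S S"
  unfolding small_union_def
proof (intro exI conjI allI)
  fix j and p :: 'p
  show "finite {b \<in> S. (\<lambda>b. b) b = j \<and> undefined \<le> p}"
    by (rule finite_subset[of _ "{j}"]) auto
qed auto

text \<open>A small set embeds into every set \<open>S\<close> that is not small, for otherwise \<open>S\<close> would embed into it.\<close>

lemma small_union_ordLeq:
  assumes H: "small_union TYPE('p) S H" and S: "\<not> small_for TYPE('p) S"
  shows "|H| \<le>o |S|"
proof -
  obtain k h where k: "k ` H \<subseteq> S" and fin: "\<And>j p. finite {b \<in> H. k b = j \<and> h b \<le> (p::'p)}"
    using H unfolding small_union_def by blast
  have "infinite S"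
    using S small_countable countable_finite by blast
  moreover have "|{b \<in> H. k b = j}| \<le>o |S|" for j
  proof -
    have "small_for TYPE('p) {b \<in> H. k b = j}"
      unfolding small_for_def using fin[of j] by (intro exI[of _ h]) (simp add: conj_assoc)
    then have "\<not> |S| \<le>o |{b \<in> H. k b = j}|"
      using S small_ordLeq by blast
    then show ?thesis
      using ordLeq_total[OF card_of_Well_order card_of_Well_order] by blast
  qed
  ultimately have "|\<Union>j\<in>S. {b \<in> H. k b = j}| \<le>o |S|"
    by (intro card_of_UNION_ordLeq_infinite) (auto intro: ordIso_imp_ordLeq card_of_refl)
  moreover have "H = (\<Union>j\<in>S. {b \<in> H. k b = j})"
    using k by blast
  ultimately show ?thesis
    by simp
qed

end

section \<open>Closing sets of functions off\<close>

definition rational_box ::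
    "'a topology \<Rightarrow> (('a \<Rightarrow> real) \<times> rat \<times> rat) set \<Rightarrow> 'a set" where
  "rational_box X t =
     {x \<in> topspace X. \<forall>(g, l, u)\<in>t. of_rat l < g x \<and> g x < of_rat u}"

text \<open>One point is chosen in every nonempty basic set that functions from \<open>A\<close> and rational bounds describe;
  these points are dense in the topology that \<open>A\<close> induces on the space.\<close>

definition box_points :: "'a topology \<Rightarrow> ('a \<Rightarrow> real) set \<Rightarrow> 'a set" where
  "box_points X A =
     {SOME x. x \<in> rational_box X t |t. finite t \<and> t \<subseteq> A \<times> UNIV \<and> rational_box X t \<noteq> {}}"

text \<open>\<open>I a b\<close> will be the set of separating functions that the network detects from the pair \<open>(a, b)\<close>. A
  stable set of functions contains all those detected from its own box points, and this is what makes
  it separate the points of their closure. Stable sets play the role of elementary submodels.\<close>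

definition box_stable :: "'a topology \<Rightarrow> ('a \<Rightarrow> 'a \<Rightarrow> ('a \<Rightarrow> real) set) \<Rightarrow> ('a \<Rightarrow> real) set \<Rightarrow> bool" where
  "box_stable X I A \<longleftrightarrow> (\<forall>a\<in>box_points X A. \<forall>b\<in>box_points X A. I a b \<subseteq> A)"

lemma box_points_subset_topspace: "box_points X A \<subseteq> topspace X"
proof
  fix x assume "x \<in> box_points X A"
  then obtain t where "x = (SOME x. x \<in> rational_box X t)" "rational_box X t \<noteq> {}"
    unfolding box_points_def by blast
  then have "x \<in> rational_box X t"
    using some_in_eq by metis
  then show "x \<in> topspace X"
    unfolding rational_box_def by blast
qed

lemma box_points_meet_rational_box:
  assumes "finite t" "t \<subseteq> A \<times> UNIV" "rational_box X t \<noteq> {}"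
  obtains x where "x \<in> box_points X A" "x \<in> rational_box X t"
proof
  show "(SOME x. x \<in> rational_box X t) \<in> box_points X A"
    using assms unfolding box_points_def by blast
  show "(SOME x. x \<in> rational_box X t) \<in> rational_box X t"
    using assms(3) some_in_eq by blast
qed

lemma box_points_mono: "A \<subseteq> B \<Longrightarrow> box_points X A \<subseteq> box_points X B"
  unfolding box_points_def by blast

lemma box_stable_Inter:
  assumes "\<And>A. A \<in> \<A> \<Longrightarrow> box_stable X I A"
  shows "box_stable X I (\<Inter>\<A>)"
  unfolding box_stable_def
proof (intro ballI Inter_greatest)
  fix a b A assume "a \<in> box_points X (\<Inter>\<A>)" "b \<in> box_points X (\<Inter>\<A>)" "A \<in> \<A>"
  then show "I a b \<subseteq> A"
    using assms[OF \<open>A \<in> \<A>\<close>] box_points_mono[of "\<Inter>\<A>" A X] unfolding box_stable_def by blast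
qed

lemma box_stable_hull: "box_stable X I (box_stable X I hull A)"
  by (rule hull_in) (use box_stable_Inter in blast)

lemma box_points_chain_Union:
  assumes "\<C> \<noteq> {}" "subset.chain UNIV \<C>" "a \<in> box_points X (\<Union>\<C>)"
  obtains A where "A \<in> \<C>" "a \<in> box_points X A"
proof -
  obtain t where t: "a = (SOME x. x \<in> rational_box X t)" "finite t" "t \<subseteq> \<Union>\<C> \<times> UNIV"
    "rational_box X t \<noteq> {}"
    using assms(3) unfolding box_points_def by blast
  have "finite (fst ` t)" "fst ` t \<subseteq> \<Union>\<C>"
    using t by auto
  then obtain A where A: "A \<in> \<C>" "fst ` t \<subseteq> A"
    using finite_subset_Union_chain[OF _ _ assms(1,2)] by blast
  then have "t \<subseteq> A \<times> UNIV"
    by force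
  then show thesis
    using that A t unfolding box_points_def by blast
qed

lemma box_stable_chain_Union:
  assumes "\<C> \<noteq> {}" "subset.chain UNIV \<C>" "\<And>A. A \<in> \<C> \<Longrightarrow> \<exists>B\<in>\<C>. \<forall>a\<in>box_points X A. \<forall>b\<in>box_points X A. I a b \<subseteq> B"
  shows "box_stable X I (\<Union>\<C>)"
  unfolding box_stable_def
proof (intro ballI)
  fix a b assume "a \<in> box_points X (\<Union>\<C>)" "b \<in> box_points X (\<Union>\<C>)"
  then obtain A B where AB: "A \<in> \<C>" "a \<in> box_points X A" "B \<in> \<C>" "b \<in> box_points X B"
    using box_points_chain_Union[OF assms(1,2)] by metis
  then have "A \<subseteq> B \<or> B \<subseteq> A"
    using assms(2) unfolding subset_chain_def by blast
  then obtain C where "C \<in> \<C>" "a \<in> box_points X C" "b \<in> box_points X C"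
    using AB box_points_mono[of A B X] box_points_mono[of B A X] by blast
  then show "I a b \<subseteq> \<Union>\<C>"
    using assms(3)[of C] by blast
qed

text \<open>Only the upper bound for the hull that these stages provide is of interest: it is reached by
  countably many steps, each of which adds small sets indexed by finite subsets of the previous stage.\<close>

primrec closing_stage ::
    "'a topology \<Rightarrow> ('a \<Rightarrow> 'a \<Rightarrow> ('a \<Rightarrow> real) set) \<Rightarrow> ('a \<Rightarrow> real) set \<Rightarrow> nat \<Rightarrow> ('a \<Rightarrow> real) set" where
  "closing_stage X I A 0 = A"
| "closing_stage X I A (Suc n) = closing_stage X I A n \<union>
     (\<Union>a\<in>box_points X (closing_stage X I A n). \<Union>b\<in>box_points X (closing_stage X I A n). I a b)"

lemma hull_subset_closing_stages:
  "box_stable X I hull A \<subseteq> (\<Union>n. closing_stage X I A n)"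
proof (rule hull_minimal)
  have mono: "closing_stage X I A m \<subseteq> closing_stage X I A n" if "m \<le> n" for m n
    using that by (rule lift_Suc_mono_le[rotated]) auto
  show "A \<subseteq> (\<Union>n. closing_stage X I A n)"
    using closing_stage.simps(1)[of X I A] by blast
  show "box_stable X I (\<Union>n. closing_stage X I A n)"
  proof (rule box_stable_chain_Union)
    show "subset.chain UNIV (range (closing_stage X I A))"
      unfolding subset_chain_def using mono nat_le_linear by blast
    fix B assume "B \<in> range (closing_stage X I A)"
    then obtain n where n: "B = closing_stage X I A n"
      by blast
    show "\<exists>C\<in>range (closing_stage X I A). \<forall>a\<in>box_points X B. \<forall>b\<in>box_points X B. I a b \<subseteq> C"
    proof
      show "closing_stage X I A (Suc n) \<in> range (closing_stage X I A)"
        by blast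
      show "\<forall>a\<in>box_points X B. \<forall>b\<in>box_points X B. I a b \<subseteq> closing_stage X I A (Suc n)"
        unfolding n by auto
    qed
  qed auto
qed

context unbounded_directed
begin

lemma small_union_hull:
  assumes J: "squarable J" and A: "small_union TYPE('p) J A"
    and I: "\<And>a b. a \<in> topspace X \<Longrightarrow> b \<in> topspace X \<Longrightarrow> small_for TYPE('p) (I a b)"
  shows "small_union TYPE('p) J (box_stable X I hull A)"
proof -
  have stage: "small_union TYPE('p) J (closing_stage X I A n)" for n
  proof (induction n)
    case (Suc n)
    let ?B = "closing_stage X I A n"
    have "small_union TYPE('p) J ((\<lambda>t. SOME x. x \<in> rational_box X t) ` {t. finite t \<and> t \<subseteq> ?B \<times> UNIV})"
      using J Suc by (intro small_union_image small_union_finite_subsets small_union_Times_countable) simp_all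
    moreover have "box_points X ?B \<subseteq>
        (\<lambda>t. SOME x. x \<in> rational_box X t) ` {t. finite t \<and> t \<subseteq> ?B \<times> UNIV}"
      unfolding box_points_def by blast
    ultimately have "small_union TYPE('p) J (box_points X ?B)"
      by (rule small_union_subset)
    moreover obtain j where "j \<in> J"
      using J unfolding squarable_def by blast
    then have "small_union TYPE('p) J (I a b)"
      if "a \<in> box_points X ?B" "b \<in> box_points X ?B" for a b
      using that box_points_subset_topspace[of X ?B] by (intro small_imp_small_union[of _ j] I) auto
    ultimately show ?case
      using J Suc by (simp add: small_union_Un small_union_UNION)
  qed (use A in simp)
  have "small_union TYPE('p) J (\<Union>n. closing_stage X I A n)"
    using J stage by (intro small_union_UNION[OF J small_union_countable[OF _ J]]) auto
  then show ?thesis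
    using hull_subset_closing_stages by (rule small_union_subset)
qed

lemma small_hull:
  assumes "small_for TYPE('p) A"
    and I: "\<And>a b. a \<in> topspace X \<Longrightarrow> b \<in> topspace X \<Longrightarrow> small_for TYPE('p) (I a b)"
  shows "small_for TYPE('p) (box_stable X I hull A)"
  using small_union_hull[OF squarable_singleton[of "()"], of A X I] assms
  by (simp add: small_union_singleton_iff)

text \<open>If \<open>S\<close> is small then so is its hull, whereas \<open>A\<close> is not; otherwise the hull is a union of small sets
  indexed by \<open>S\<close>, so its cardinality does not exceed that of \<open>S\<close>.\<close>

lemma card_hull_ordLess:
  assumes A: "\<not> small_for TYPE('p) A" and S: "|S| <o |A|"
    and I: "\<And>a b. a \<in> topspace X \<Longrightarrow> b \<in> topspace X \<Longrightarrow> small_for TYPE('p) (I a b)"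
  shows "|box_stable X I hull S| <o |A|"
proof (cases "small_for TYPE('p) S")
  case True
  then have "small_for TYPE('p) (box_stable X I hull S)"
    using small_hull I by blast
  then have "\<not> |A| \<le>o |box_stable X I hull S|"
    using A small_ordLeq by blast
  then show ?thesis
    using not_ordLeq_iff_ordLess[OF card_of_Well_order card_of_Well_order] by blast
next
  case False
  then have "infinite S"
    using small_countable countable_finite by blast
  then have "small_union TYPE('p) S (box_stable X I hull S)"
    using small_union_hull squarable_infinite small_union_self I by blast
  then have "|box_stable X I hull S| \<le>o |S|"
    using small_union_ordLeq False by blast
  then show ?thesis
    using S ordLeq_ordLess_trans by blast
qed

end

section \<open>Separating pairs of points with few functions\<close>

lemma openin_real_preimage:
  assumes "continuous_map X euclideanreal g" "open T"
  shows "openin X {u \<in> topspace X. g u \<in> T}"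
  using openin_continuous_map_preimage[OF assms(1)] assms(2) by simp

lemma closedin_real_preimage:
  assumes "continuous_map X euclideanreal g" "closed T"
  shows "closedin X {u \<in> topspace X. g u \<in> T}"
  using closedin_continuous_map_preimage[OF assms(1)] assms(2) by simp

lemma openin_near:
  assumes "continuous_map X euclideanreal g"
  shows "openin X {u \<in> topspace X. \<bar>g u - c\<bar> < e}"
  using openin_real_preimage[OF assms open_ball, of c e]
  by (simp add: dist_real_def abs_minus_commute)

lemma openin_finitely_near:
  assumes "finite F" "\<And>g. g \<in> F \<Longrightarrow> continuous_map X euclideanreal g"
  shows "openin X {u \<in> topspace X. \<forall>g\<in>F. \<bar>g u - c g\<bar> < e}"
  using assms
proof (induction F)
  case (insert g F)
  have "{u \<in> topspace X. \<forall>h\<in>insert g F. \<bar>h u - c h\<bar> < e} =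
      {u \<in> topspace X. \<bar>g u - c g\<bar> < e} \<inter> {u \<in> topspace X. \<forall>h\<in>F. \<bar>h u - c h\<bar> < e}"
    by auto
  then show ?case
    using insert openin_near[of X g "c g" e] by auto
qed simp

lemma compactin_finite_cover:
  assumes "compactin X K" "\<And>x. x \<in> K \<Longrightarrow> openin X (G x)" "\<And>x. x \<in> K \<Longrightarrow> x \<in> G x"
  obtains F where "finite F" "F \<subseteq> K" "K \<subseteq> (\<Union>x\<in>F. G x)"
proof -
  have "\<exists>\<F>. finite \<F> \<and> \<F> \<subseteq> G ` K \<and> K \<subseteq> \<Union>\<F>"
    by (rule compactinD[OF assms(1)]) (use assms(2,3) in auto)
  then obtain \<F> where "finite \<F>" "\<F> \<subseteq> G ` K" "K \<subseteq> \<Union>\<F>"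
    by blast
  moreover from this obtain F where "F \<subseteq> K" "finite F" "\<F> = G ` F"
    by (meson finite_subset_image)
  ultimately show thesis
    using that by blast
qed

lemma completely_regular_separation:
  assumes "completely_regular_space X" "closedin X S" "x \<in> topspace X" "x \<notin> S"
  obtains f :: "'a \<Rightarrow> real" where "continuous_map X euclideanreal f" "f x = 0" "\<And>y. y \<in> S \<Longrightarrow> f y = 1"
proof -
  obtain f :: "'a \<Rightarrow> real" where "continuous_map X (top_of_set {0..1}) f" "f x = 0" "f ` S \<subseteq> {1}"
    using assms unfolding completely_regular_space_def by blast
  then show thesis
    using that continuous_map_into_fulltopology by (metis image_subset_iff singletonD)
qed

locale compact_point_network = unbounded_directed \<phi> for \<phi> :: "'p::order \<Rightarrow> nat" +
  fixes X :: "'a topology" and W :: "'p \<Rightarrow> 'a \<Rightarrow> 'a set set"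
  assumes compact: "compact_space X" and Hausdorff: "Hausdorff_space X"
    and mono_W: "x \<in> topspace X \<Longrightarrow> p \<le> q \<Longrightarrow> W p x \<subseteq> W q x"
    and no_bad_sequence_W: "x \<in> topspace X \<Longrightarrow> no_bad_sequence (W p x)"
    and network: "openin X U \<Longrightarrow> x \<in> U \<Longrightarrow>
      \<exists>V p. openin X V \<and> x \<in> V \<and> V \<subseteq> U \<and> (\<forall>y\<in>V. \<exists>A \<in> W p y. x \<in> A \<and> A \<subseteq> U)"
begin

lemma pair_network:
  assumes "openin X U" "x \<in> U" "openin X U'" "x' \<in> U'"
  obtains V V' p where "openin X V" "x \<in> V" "\<forall>y\<in>V. \<exists>A\<in>W p y. x \<in> A \<and> A \<subseteq> U"
    and "openin X V'" "x' \<in> V'" "\<forall>y\<in>V'. \<exists>A\<in>W p y. x' \<in> A \<and> A \<subseteq> U'"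
proof -
  obtain V q where V: "openin X V" "x \<in> V" "\<forall>y\<in>V. \<exists>A\<in>W q y. x \<in> A \<and> A \<subseteq> U"
    using network[OF assms(1,2)] by blast
  obtain V' q' where V': "openin X V'" "x' \<in> V'" "\<forall>y\<in>V'. \<exists>A\<in>W q' y. x' \<in> A \<and> A \<subseteq> U'"
    using network[OF assms(3,4)] by blast
  obtain p where p: "q \<le> p" "q' \<le> p"
    by (rule upper_bound2)
  have "\<exists>A\<in>W p y. x \<in> A \<and> A \<subseteq> U" if "y \<in> V" for y
  proof -
    have "W q y \<subseteq> W p y"
      using that openin_subset[OF V(1)] by (intro mono_W p) auto
    then show ?thesis
      using bspec[OF V(3) that] by blast
  qed
  moreover have "\<exists>A\<in>W p y. x' \<in> A \<and> A \<subseteq> U'" if "y \<in> V'" for y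
  proof -
    have "W q' y \<subseteq> W p y"
      using that openin_subset[OF V'(1)] by (intro mono_W p) auto
    then show ?thesis
      using bspec[OF V'(3) that] by blast
  qed
  ultimately show thesis
    by (intro that[OF V(1,2) _ V'(1,2)] ballI)
qed

lemma separating_function:
  assumes "x \<in> topspace X" "y \<in> topspace X" "x \<noteq> y"
  obtains g :: "'a \<Rightarrow> real" where "continuous_map X euclideanreal g" "g x < 0" "0 < g y"
proof -
  have "completely_regular_space X"
    using compact Hausdorff
    by (simp add: compact_Hausdorff_or_regular_imp_normal_space
        normal_imp_completely_regular_space_A Hausdorff_imp_t1_space)
  moreover have "closedin X {y}"
    using Hausdorff assms(2) by (simp add: closedin_Hausdorff_singleton)
  ultimately obtain f where f: "continuous_map X euclideanreal f" "f x = 0" "f y = 1"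
    using completely_regular_separation[of X "{y}" x] assms by blast
  then show thesis
    using that[of "\<lambda>z. f z - 1/2"] by (simp add: continuous_map_diff)
qed

text \<open>The network at \<open>(a, b)\<close>, with label \<open>p\<close>, contains a rectangle \<open>A \<times> B\<close> around some pair \<open>(x, y)\<close>, and
  \<open>g\<close> is the first function, with respect to the well-ordering \<open>R\<close>, that is negative at \<open>x\<close> and positive
  at \<open>y\<close>; moreover \<open>g\<close> keeps these signs on all of the rectangle.\<close>

definition witnessed_by :: "('a \<Rightarrow> real) rel \<Rightarrow> 'a \<Rightarrow> 'a \<Rightarrow> 'p \<Rightarrow> ('a \<Rightarrow> real) \<Rightarrow> bool" where
  "witnessed_by R a b p g \<longleftrightarrow> continuous_map X euclideanreal g \<and>
     (\<exists>x y A B. x \<in> A \<and> A \<in> W p a \<and> (\<forall>u\<in>A. g u < 0) \<and> y \<in> B \<and> B \<in> W p b \<and> (\<forall>u\<in>B. 0 < g u) \<and>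
        (\<forall>g'. (g', g) \<in> R \<longrightarrow> continuous_map X euclideanreal g' \<longrightarrow> \<not> (g' x < 0 \<and> 0 < g' y)))"

lemma witnessed_by_mono:
  assumes "witnessed_by R a b p g" "p \<le> q" "a \<in> topspace X" "b \<in> topspace X"
  shows "witnessed_by R a b q g"
proof -
  have "W p a \<subseteq> W q a" "W p b \<subseteq> W q b"
    using assms mono_W by simp_all
  then show ?thesis
    using assms(1) unfolding witnessed_by_def by (elim conjE exE) (intro conjI exI; blast)
qed

text \<open>Along an increasing sequence \<open>g\<close> of such functions there are no bad sequences of rectangles, so the
  pair of some \<open>j\<close> lies in the rectangle of some \<open>i < j\<close>. Then \<open>g i\<close> separates the pair of \<open>j\<close>, although
  it precedes the first function that does.\<close>

lemma finite_witnessed_by: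
  assumes R: "wf R" "total_on UNIV R" and ab: "a \<in> topspace X" "b \<in> topspace X"
  shows "finite {g. witnessed_by R a b p g}"
proof (rule ccontr)
  assume inf: "infinite {g. witnessed_by R a b p g}"
  obtain g :: "nat \<Rightarrow> 'a \<Rightarrow> real"
    where g: "\<And>n. g n \<in> {g. witnessed_by R a b p g}" "\<And>i j. i < j \<Longrightarrow> (g i, g j) \<in> R"
    using increasing_sequence_in_wellorder[OF R(1) inf] R(2) unfolding total_on_def by (metis UNIV_I)
  define Q where "Q n w = (case w of (x, y, A, B) \<Rightarrow>
     x \<in> A \<and> A \<in> W p a \<and> (\<forall>u\<in>A. g n u < 0) \<and> y \<in> B \<and> B \<in> W p b \<and> (\<forall>u\<in>B. 0 < g n u) \<and>
        (\<forall>g'. (g', g n) \<in> R \<longrightarrow> continuous_map X euclideanreal g' \<longrightarrow> \<not> (g' x < 0 \<and> 0 < g' y)))"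
    for n w
  have "\<forall>n. \<exists>w. Q n w"
  proof
    fix n
    have "witnessed_by R a b p (g n)"
      using g(1) by simp
    then show "\<exists>w. Q n w"
      unfolding witnessed_by_def Q_def by (elim conjE exE, intro exI) (simp; blast)
  qed
  from choice[OF this] obtain w where w: "\<forall>n. Q n (w n)" ..
  define x y A B where "x n = fst (w n)" and "y n = fst (snd (w n))"
    and "A n = fst (snd (snd (w n)))" and "B n = snd (snd (snd (w n)))" for n
  have Q: "x n \<in> A n" "A n \<in> W p a" "\<forall>u\<in>A n. g n u < 0" "y n \<in> B n" "B n \<in> W p b"
    "\<forall>u\<in>B n. 0 < g n u"
    "\<forall>g'. (g', g n) \<in> R \<longrightarrow> continuous_map X euclideanreal g' \<longrightarrow> \<not> (g' (x n) < 0 \<and> 0 < g' (y n))"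
    for n
    using w[rule_format, of n] unfolding Q_def x_def y_def A_def B_def
    by (simp_all add: case_prod_beta)
  obtain i j where ij: "i < j" "x j \<in> A i" "y j \<in> B i"
    using no_bad_sequence_product[of "W p a" "W p b" A x B y] no_bad_sequence_W[OF ab(1)]
      no_bad_sequence_W[OF ab(2)] Q by metis
  have "continuous_map X euclideanreal (g i)"
    using g(1)[of i] unfolding witnessed_by_def by simp
  moreover have "(g i, g j) \<in> R"
    using g(2) ij(1) .
  ultimately show False
    using Q(7)[of j] Q(3,6)[of i] ij by blast
qed

text \<open>These sets replace a point-countable open cover of the complement of the diagonal: every pair of
  distinct points has a neighbourhood from all of whose members one separating function is detected.\<close>

lemma small_separators:
  obtains I :: "'a \<Rightarrow> 'a \<Rightarrow> ('a \<Rightarrow> real) set"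
  where "\<And>a b g. g \<in> I a b \<Longrightarrow> continuous_map X euclideanreal g"
    and "\<And>a b. a \<in> topspace X \<Longrightarrow> b \<in> topspace X \<Longrightarrow> small_for TYPE('p) (I a b)"
    and "\<And>x y. x \<in> topspace X \<Longrightarrow> y \<in> topspace X \<Longrightarrow> x \<noteq> y \<Longrightarrow>
      \<exists>V V' g. openin X V \<and> x \<in> V \<and> openin X V' \<and> y \<in> V' \<and> g x \<noteq> g y \<and> (\<forall>a\<in>V. \<forall>b\<in>V'. g \<in> I a b)"
proof -
  obtain r :: "('a \<Rightarrow> real) rel" where r: "well_order_on UNIV r"
    using well_order_on by blast
  define R where "R = r - Id"
  have R: "wf R" "total_on UNIV R"
    using r unfolding R_def well_order_on_def linear_order_on_def by auto
  define I where "I a b = {g. \<exists>p. witnessed_by R a b p g}" for a b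
  show thesis
  proof (rule that[of I])
    show "continuous_map X euclideanreal g" if "g \<in> I a b" for a b g
      using that unfolding I_def witnessed_by_def by blast
  next
    fix a b assume ab: "a \<in> topspace X" "b \<in> topspace X"
    define h where "h g = (SOME p. witnessed_by R a b p g)" for g
    have h: "witnessed_by R a b (h g) g" if "g \<in> I a b" for g
      using that someI_ex[of "\<lambda>p. witnessed_by R a b p g"] unfolding I_def h_def by blast
    have "finite {g \<in> I a b. h g \<le> p}" for p
      by (rule finite_subset[OF _ finite_witnessed_by[OF R ab, of p]])
        (use h witnessed_by_mono[OF _ _ ab] in blast)
    then show "small_for TYPE('p) (I a b)"
      unfolding small_for_def by blast
  next
    fix x y assume xy: "x \<in> topspace X" "y \<in> topspace X" "x \<noteq> y"
    define D where "D = {g. continuous_map X euclideanreal g \<and> g x < 0 \<and> 0 < g y}"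
    have "D \<noteq> {}"
      using separating_function[OF xy] unfolding D_def by blast
    then obtain g where g: "g \<in> D" and min: "\<And>g'. (g', g) \<in> R \<Longrightarrow> g' \<notin> D"
      using wfE_min'[OF R(1)] by blast
    then have cont: "continuous_map X euclideanreal g" and sgn: "g x < 0" "0 < g y"
      unfolding D_def by auto
    have U: "openin X {u \<in> topspace X. g u < 0}" "x \<in> {u \<in> topspace X. g u < 0}"
      "openin X {u \<in> topspace X. 0 < g u}" "y \<in> {u \<in> topspace X. 0 < g u}"
      using openin_real_preimage[OF cont, of "{..<0}"] openin_real_preimage[OF cont, of "{0<..}"] xy sgn
      by simp_all
    obtain V V' p where V: "openin X V" "x \<in> V"
        "\<forall>a\<in>V. \<exists>A\<in>W p a. x \<in> A \<and> A \<subseteq> {u \<in> topspace X. g u < 0}"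
      and V': "openin X V'" "y \<in> V'"
        "\<forall>a\<in>V'. \<exists>A\<in>W p a. y \<in> A \<and> A \<subseteq> {u \<in> topspace X. 0 < g u}"
      by (rule pair_network[OF U])
    have "g \<in> I a b" if ab: "a \<in> V" "b \<in> V'" for a b
    proof -
      obtain A where A: "A \<in> W p a" "x \<in> A" "\<forall>u\<in>A. g u < 0"
        using bspec[OF V(3) ab(1)] by auto
      obtain B where B: "B \<in> W p b" "y \<in> B" "\<forall>u\<in>B. 0 < g u"
        using bspec[OF V'(3) ab(2)] by auto
      have "witnessed_by R a b p g"
        unfolding witnessed_by_def
        by (intro conjI cont exI[of _ x] exI[of _ y] exI[of _ A] exI[of _ B] A B)
          (use min in \<open>simp add: D_def\<close>)
      then show ?thesis
        unfolding I_def by blast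
    qed
    then show "\<exists>V V' g. openin X V \<and> x \<in> V \<and> openin X V' \<and> y \<in> V' \<and> g x \<noteq> g y \<and>
        (\<forall>a\<in>V. \<forall>b\<in>V'. g \<in> I a b)"
      using V(1,2) V'(1,2) sgn by (intro exI[of _ V] exI[of _ V'] exI[of _ g]) auto
  qed
qed

end

section \<open>Retractions given by closed sets of functions\<close>

text \<open>The sets \<open>I a b\<close> are fixed from here on, since the chains of stable sets refer to them.\<close>

locale small_separators = compact_point_network \<phi> X W
  for \<phi> :: "'p::order \<Rightarrow> nat" and X :: "'a topology" and W +
  fixes I :: "'a \<Rightarrow> 'a \<Rightarrow> ('a \<Rightarrow> real) set"
  assumes continuous_I: "g \<in> I a b \<Longrightarrow> continuous_map X euclideanreal g"
    and small_I: "a \<in> topspace X \<Longrightarrow> b \<in> topspace X \<Longrightarrow> small_for TYPE('p) (I a b)"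
    and separation_I: "x \<in> topspace X \<Longrightarrow> y \<in> topspace X \<Longrightarrow> x \<noteq> y \<Longrightarrow>
      \<exists>V V' g. openin X V \<and> x \<in> V \<and> openin X V' \<and> y \<in> V' \<and> g x \<noteq> g y \<and> (\<forall>a\<in>V. \<forall>b\<in>V'. g \<in> I a b)"
begin

text \<open>If \<open>A\<close> is stable, the closure of the box points is a copy inside the space of its quotient by the
  functions in \<open>A\<close>: every point has the same values under \<open>A\<close> as some point of the model
  (\<open>model_represents\<close>), and only one (\<open>model_separated\<close>).\<close>

definition model :: "('a \<Rightarrow> real) set \<Rightarrow> 'a set" where
  "model A = X closure_of box_points X A"

definition continuous_stable :: "('a \<Rightarrow> real) set \<Rightarrow> bool" where
  "continuous_stable A \<longleftrightarrow>
     (\<forall>g\<in>A. continuous_map X euclideanreal g) \<and> box_stable X I A"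

lemma continuous_stableD: "continuous_stable A \<Longrightarrow> g \<in> A \<Longrightarrow> continuous_map X euclideanreal g"
  unfolding continuous_stable_def by blast

lemma model_mono: "A \<subseteq> B \<Longrightarrow> model A \<subseteq> model B"
  unfolding model_def by (intro closure_of_mono box_points_mono)

lemma closedin_model: "closedin X (model A)"
  unfolding model_def by simp

lemma model_subset_topspace: "model A \<subseteq> topspace X"
  unfolding model_def by (rule closure_of_subset_topspace)

text \<open>Some function is detected from all pairs near \<open>(u, v)\<close>, hence from a pair of box points, and stability
  puts it into \<open>A\<close>.\<close>

lemma model_separated:
  assumes A: "continuous_stable A" and uv: "u \<in> model A" "v \<in> model A"
    and eq: "\<And>g. g \<in> A \<Longrightarrow> g u = g v"
  shows "u = v"
proof (rule ccontr)
  assume "u \<noteq> v"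
  then obtain V V' g where V: "openin X V" "u \<in> V" "openin X V'" "v \<in> V'" "g u \<noteq> g v"
    and g: "\<forall>a\<in>V. \<forall>b\<in>V'. g \<in> I a b"
    using separation_I[of u v] uv model_subset_topspace by blast
  obtain a b where ab: "a \<in> box_points X A" "a \<in> V" "b \<in> box_points X A" "b \<in> V'"
    using uv V unfolding model_def in_closure_of by blast
  then have "g \<in> A"
    using A g unfolding continuous_stable_def box_stable_def by blast
  then show False
    using eq V(5) by blast
qed

text \<open>The conditions on \<open>z\<close> are closed, and finitely many of them, weakened by some \<open>e > 0\<close>, are met by a
  box point; compactness does the rest.\<close>

lemma model_represents:
  assumes A: "continuous_stable A" and x: "x \<in> topspace X"
  obtains z where "z \<in> model A" "\<And>g. g \<in> A \<Longrightarrow> g z = g x"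
proof -
  define K :: "('a \<Rightarrow> real) \<times> real \<Rightarrow> 'a set" where "K = (\<lambda>(g, e). {z \<in> model A. \<bar>g z - g x\<bar> \<le> e})"
  \<comment> \<open>The model itself is included for the case that \<open>A\<close> is empty.\<close>
  define \<U> where "\<U> = insert (model A) (K ` (A \<times> {0<..}))"
  have "closedin X (K (g, e))" if "g \<in> A" for g e
  proof -
    have "closedin X {u \<in> topspace X. g u \<in> cball (g x) e}"
      by (intro closedin_real_preimage continuous_stableD[OF A that] closed_cball)
    then have "closedin X (model A \<inter> {u \<in> topspace X. g u \<in> cball (g x) e})"
      using closedin_model by blast
    moreover have "K (g, e) = model A \<inter> {u \<in> topspace X. g u \<in> cball (g x) e}"
      unfolding K_def using model_subset_topspace by (auto simp: dist_real_def)
    ultimately show ?thesis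
      by simp
  qed
  then have closed: "\<forall>C\<in>\<U>. closedin X C"
    unfolding \<U>_def using closedin_model by auto
  have fip: "\<Inter>\<F> \<noteq> {}" if "finite \<F>" "\<F> \<subseteq> \<U>" for \<F>
  proof -
    have "finite (\<F> - {model A})" "\<F> - {model A} \<subseteq> K ` (A \<times> {0<..})"
      using that unfolding \<U>_def by auto
    from finite_subset_image[OF this] obtain G
      where G: "finite G" "G \<subseteq> A \<times> {0<..}" "\<F> - {model A} = K ` G"
      by blast
    \<comment> \<open>Rational bounds around \<open>g x\<close>, at distance less than \<open>e\<close>: box points are available for these.\<close>
    define l where "l g e = (SOME r. g x - e < real_of_rat r \<and> real_of_rat r < g x)"
      for g :: "'a \<Rightarrow> real" and e
    define u where "u g e = (SOME r. g x < real_of_rat r \<and> real_of_rat r < g x + e)"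
      for g :: "'a \<Rightarrow> real" and e
    have lu: "g x - e < real_of_rat (l g e) \<and> real_of_rat (l g e) < g x \<and>
        g x < real_of_rat (u g e) \<and> real_of_rat (u g e) < g x + e" if "e > 0" for g e
      using someI_ex[OF of_rat_dense[of "g x - e" "g x"]] someI_ex[OF of_rat_dense[of "g x" "g x + e"]]
        that unfolding l_def u_def by simp
    define t where "t = (\<lambda>(g, e). (g, l g e, u g e)) ` G"
    have "x \<in> rational_box X t"
      unfolding rational_box_def t_def using lu G(2) x by auto
    moreover have "finite t" "t \<subseteq> A \<times> UNIV"
      unfolding t_def using G by auto
    ultimately obtain z where z: "z \<in> box_points X A" "z \<in> rational_box X t"
      using box_points_meet_rational_box[of t A X] by blast
    have zm: "z \<in> model A"
      using z(1) closure_of_subset[OF box_points_subset_topspace[of X A]] unfolding model_def by auto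
    have "z \<in> C" if "C \<in> \<F> - {model A}" for C
    proof -
      obtain g e where ge: "(g, e) \<in> G" "C = K (g, e)"
        using \<open>C \<in> \<F> - {model A}\<close> G(3) by auto
      then have "(g, l g e, u g e) \<in> t"
        unfolding t_def by force
      then have "of_rat (l g e) < g z" "g z < of_rat (u g e)"
        using z(2) unfolding rational_box_def by auto
      moreover have "e > 0"
        using ge G(2) by auto
      ultimately show ?thesis
        using lu[of e g] zm unfolding ge(2) K_def by (simp add: abs_le_iff)
    qed
    then show ?thesis
      using zm by blast
  qed
  have "\<Inter>\<U> \<noteq> {}"
    using compact[unfolded compact_space_fip, rule_format, of \<U>] closed fip by simp
  then obtain z where z: "z \<in> \<Inter>\<U>"
    by blast
  have "g z = g x" if "g \<in> A" for g
  proof -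
    have "z \<in> K (g, e)" if "e > 0" for e
      using z \<open>g \<in> A\<close> that unfolding \<U>_def by auto
    then have "\<bar>g z - g x\<bar> \<le> e" if "e > 0" for e
      using that unfolding K_def by simp
    then have "\<bar>g z - g x\<bar> \<le> 0"
      by (metis field_le_epsilon add_0)
    then show ?thesis
      by simp
  qed
  then show thesis
    using that z unfolding \<U>_def by blast
qed

definition retract :: "('a \<Rightarrow> real) set \<Rightarrow> 'a \<Rightarrow> 'a" where
  "retract A x = (SOME z. z \<in> model A \<and> (\<forall>g\<in>A. g z = g x))"

lemma
  assumes "continuous_stable A" "x \<in> topspace X"
  shows retract_in_model: "retract A x \<in> model A"
    and retract_eq: "g \<in> A \<Longrightarrow> g (retract A x) = g x"
proof -
  have "\<exists>z. z \<in> model A \<and> (\<forall>g\<in>A. g z = g x)"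
    using model_represents[OF assms] by metis
  then have "retract A x \<in> model A \<and> (\<forall>g\<in>A. g (retract A x) = g x)"
    unfolding retract_def by (rule someI_ex)
  then show "retract A x \<in> model A" "g \<in> A \<Longrightarrow> g (retract A x) = g x"
    by blast+
qed

lemma retract_in_topspace:
  "continuous_stable A \<Longrightarrow> x \<in> topspace X \<Longrightarrow> retract A x \<in> topspace X"
  using retract_in_model model_subset_topspace by blast

lemma retract_unique:
  assumes "continuous_stable A" "x \<in> topspace X" "z \<in> model A" "\<And>g. g \<in> A \<Longrightarrow> g z = g x"
  shows "retract A x = z"
proof (rule model_separated[OF assms(1) retract_in_model[OF assms(1,2)] assms(3)])
  show "g (retract A x) = g z" if "g \<in> A" for g
    using retract_eq[OF assms(1,2) that] assms(4)[OF that] by simp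
qed

lemma retract_cong:
  assumes "continuous_stable A" "x \<in> topspace X" "y \<in> topspace X" "\<And>g. g \<in> A \<Longrightarrow> g x = g y"
  shows "retract A x = retract A y"
proof (rule retract_unique[OF assms(1,2) retract_in_model[OF assms(1,3)]])
  show "g (retract A y) = g x" if "g \<in> A" for g
    using retract_eq[OF assms(1,3) that] assms(4)[OF that] by simp
qed

text \<open>The functions in \<open>A\<close> separate \<open>z0\<close> from each point of the compact set \<open>model A - V\<close>, so finitely many
  of them do so uniformly. In other words \<open>A\<close> induces the topology of the model.\<close>

lemma model_neighbourhood:
  assumes A: "continuous_stable A" and z0: "z0 \<in> model A" and V: "openin X V" "z0 \<in> V"
  obtains F e where "finite F" "F \<subseteq> A" "e > 0"
    and "\<And>z. z \<in> model A \<Longrightarrow> (\<And>g. g \<in> F \<Longrightarrow> \<bar>g z - g z0\<bar> < e) \<Longrightarrow> z \<in> V"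
proof -
  have "closedin X (model A - V)"
    using closedin_model V(1) by blast
  then have K: "compactin X (model A - V)"
    using compact closedin_compact_space by blast
  have "\<forall>z\<in>model A - V. \<exists>g. g \<in> A \<and> g z \<noteq> g z0"
    using model_separated[OF A _ z0] V(2) by blast
  from bchoice[OF this] obtain g where g: "\<forall>z\<in>model A - V. g z \<in> A \<and> g z z \<noteq> g z z0" ..
  define \<delta> where "\<delta> z = \<bar>g z z - g z z0\<bar> / 2" for z
  have \<delta>: "\<delta> z > 0" if "z \<in> model A - V" for z
    using g that unfolding \<delta>_def by simp
  define G where "G z = {u \<in> topspace X. \<bar>g z u - g z z\<bar> < \<delta> z}" for z
  have G: "openin X (G z)" "z \<in> G z" if "z \<in> model A - V" for z
    unfolding G_def using openin_near[OF continuous_stableD[OF A]] g that \<delta>[OF that]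
      subsetD[OF model_subset_topspace, of z A] by auto
  obtain Z where Z: "finite Z" "Z \<subseteq> model A - V" "model A - V \<subseteq> (\<Union>z\<in>Z. G z)"
    by (rule compactin_finite_cover[OF K G])
  define e where "e = Min (insert 1 (\<delta> ` Z))"
  show thesis
  proof (rule that[of "g ` Z" e])
    show "finite (g ` Z)" "g ` Z \<subseteq> A"
      using Z g by auto
    show "e > 0"
      unfolding e_def using Z \<delta> by (subst Min_gr_iff) auto
    fix z assume z: "z \<in> model A" "\<And>h. h \<in> g ` Z \<Longrightarrow> \<bar>h z - h z0\<bar> < e"
    show "z \<in> V"
    proof (rule ccontr)
      assume "z \<notin> V"
      then obtain y where y: "y \<in> Z" "z \<in> G y"
        using Z(3) z(1) by blast
      have "e \<le> \<delta> y"
        unfolding e_def using Z(1) y(1) by simp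
      then have "\<bar>g y z - g y z0\<bar> < \<delta> y"
        using z(2)[of "g y"] y(1) by auto
      then show False
        using y(2) unfolding G_def \<delta>_def by (auto simp: abs_if split: if_splits)
    qed
  qed
qed

lemma continuous_map_retract:
  assumes A: "continuous_stable A"
  shows "continuous_map X X (retract A)"
  unfolding continuous_map_def
proof (intro conjI allI impI)
  show "retract A \<in> topspace X \<rightarrow> topspace X"
    using retract_in_topspace[OF A] by blast
  fix V assume V: "openin X V"
  show "openin X {x \<in> topspace X. retract A x \<in> V}"
    unfolding openin_subopen[of X "{x \<in> topspace X. retract A x \<in> V}"]
  proof
    fix x assume "x \<in> {x \<in> topspace X. retract A x \<in> V}"
    then have x: "x \<in> topspace X" "retract A x \<in> V"
      by auto
    obtain F e where F: "finite F" "F \<subseteq> A" "(e::real) > 0"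
      and near: "\<And>z. z \<in> model A \<Longrightarrow> (\<And>g. g \<in> F \<Longrightarrow> \<bar>g z - g (retract A x)\<bar> < e) \<Longrightarrow> z \<in> V"
      using model_neighbourhood[OF A retract_in_model[OF A x(1)] V x(2)] by metis
    let ?T = "{u \<in> topspace X. \<forall>g\<in>F. \<bar>g u - g x\<bar> < e}"
    have "openin X ?T"
      using openin_finitely_near[OF F(1), of X "\<lambda>g. g x" e] continuous_stableD[OF A] F(2) by blast
    moreover have "x \<in> ?T"
      using x F(3) by simp
    moreover have "retract A u \<in> V" if "u \<in> ?T" for u
    proof (rule near)
      show "retract A u \<in> model A"
        using that retract_in_model[OF A] by simp
      fix g assume "g \<in> F"
      then have "g (retract A u) = g u" "g (retract A x) = g x"
        using retract_eq[OF A] F(2) that x(1) by auto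
      then show "\<bar>g (retract A u) - g (retract A x)\<bar> < e"
        using that \<open>g \<in> F\<close> by simp
    qed
    ultimately show "\<exists>T. openin X T \<and> x \<in> T \<and> T \<subseteq> {x \<in> topspace X. retract A x \<in> V}"
      by (intro exI[of _ ?T]) auto
  qed
qed

end

section \<open>Chains of retractions\<close>

text \<open>For a set of functions that is well-ordered in its cardinal type, \<open>S b\<close> and \<open>S' b\<close> will be the hulls
  of the functions before \<open>b\<close> and of those up to \<open>b\<close>, and \<open>S0\<close> the hull of the empty set. The last
  assumption expresses that the chain is continuous: \<open>S b\<close> is the union of \<open>S0\<close> and the earlier \<open>S' c\<close>.\<close>

locale retraction_chain = small_separators \<phi> X W I
  for \<phi> :: "'p::order \<Rightarrow> nat" and X :: "'a topology" and W I +
  fixes B :: "'i set" and R :: "'i rel" and S S' :: "'i \<Rightarrow> ('a \<Rightarrow> real) set"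
    and S0 :: "('a \<Rightarrow> real) set"
  assumes wf_R: "wf R" and trans_R: "trans R" and total_R: "total_on B R"
    and stable_S: "b \<in> B \<Longrightarrow> continuous_stable (S b)"
    and stable_S': "b \<in> B \<Longrightarrow> continuous_stable (S' b)"
    and stable_S0: "continuous_stable S0"
    and S_subset_S': "b \<in> B \<Longrightarrow> S b \<subseteq> S' b"
    and S'_subset_S: "c \<in> B \<Longrightarrow> b \<in> B \<Longrightarrow> (c, b) \<in> R \<Longrightarrow> S' c \<subseteq> S b"
    and S0_subset_S: "b \<in> B \<Longrightarrow> S0 \<subseteq> S b"
    and finite_subset_S: "b \<in> B \<Longrightarrow> finite F \<Longrightarrow> F \<subseteq> S b \<Longrightarrow>
      F \<subseteq> S0 \<or> (\<exists>c\<in>B. (c, b) \<in> R \<and> F \<subseteq> S' c)"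
begin

abbreviation lower :: "'i \<Rightarrow> 'a \<Rightarrow> 'a" where "lower b \<equiv> retract (S b)"

abbreviation upper :: "'i \<Rightarrow> 'a \<Rightarrow> 'a" where "upper b \<equiv> retract (S' b)"

text \<open>The value \<open>None\<close> stands for the bottom of the chain.\<close>

definition base_point :: "'i option \<Rightarrow> 'a \<Rightarrow> 'a" where
  "base_point s y = (case s of None \<Rightarrow> retract S0 y | Some c \<Rightarrow> upper c y)"

definition jumps :: "'i \<Rightarrow> 'a \<Rightarrow> bool" where
  "jumps b x \<longleftrightarrow> b \<in> B \<and> x \<in> topspace X \<and> lower b x \<noteq> upper b x"

lemma retract_enters_earlier:
  assumes b: "b \<in> B" and x: "x \<in> topspace X" and V: "openin X V" "lower b x \<in> V"
  shows "retract S0 x \<in> V \<or> (\<exists>c\<in>B. (c, b) \<in> R \<and> upper c x \<in> V)"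
proof -
  obtain F e where F: "finite F" "F \<subseteq> S b" "(e::real) > 0"
    and near: "\<And>z. z \<in> model (S b) \<Longrightarrow> (\<And>g. g \<in> F \<Longrightarrow> \<bar>g z - g (lower b x)\<bar> < e) \<Longrightarrow> z \<in> V"
    using model_neighbourhood[OF stable_S[OF b] retract_in_model[OF stable_S[OF b] x] V] by metis
  have in_V: "retract A x \<in> V" if A: "continuous_stable A" "A \<subseteq> S b" "F \<subseteq> A" for A
  proof (rule near)
    show "retract A x \<in> model (S b)"
      using retract_in_model[OF A(1) x] model_mono[OF A(2)] by blast
    fix g assume g: "g \<in> F"
    have "g (retract A x) = g x"
      using g A(3) by (intro retract_eq[OF A(1) x]) blast
    moreover have "g (lower b x) = g x"
      using g F(2) by (intro retract_eq[OF stable_S[OF b] x]) blast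
    ultimately show "\<bar>g (retract A x) - g (lower b x)\<bar> < e"
      using F(3) by simp
  qed
  from finite_subset_S[OF b F(1,2)] show ?thesis
  proof
    assume "F \<subseteq> S0"
    then show ?thesis
      using in_V[OF stable_S0 S0_subset_S[OF b]] by simp
  next
    assume "\<exists>c\<in>B. (c, b) \<in> R \<and> F \<subseteq> S' c"
    then obtain c where c: "c \<in> B" "(c, b) \<in> R" "F \<subseteq> S' c"
      by blast
    then have "upper c x \<in> V"
      using in_V[OF stable_S'[OF c(1)] S'_subset_S[OF c(1) b c(2)]] by simp
    then show ?thesis
      using c by blast
  qed
qed

text \<open>A neighbourhood of \<open>lower b x\<close> depends on finitely many functions in \<open>S b\<close>, so the retracts of \<open>x\<close>
  enter it before \<open>b\<close>. Unless they start inside it, the first \<open>c\<close> at which \<open>upper c x\<close> is inside must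
  move \<open>x\<close>: if \<open>lower c x = upper c x\<close> then the same argument at \<open>c\<close> gives an earlier place.\<close>

lemma retract_enters_at_jump:
  assumes b: "b \<in> B" and x: "x \<in> topspace X" and V: "openin X V" "lower b x \<in> V"
  obtains "base_point None x \<in> V"
    | c where "(c, b) \<in> R" "jumps c x" "base_point (Some c) x \<in> V"
proof (cases "retract S0 x \<in> V")
  case False
  define Q where "Q = {c \<in> B. (c, b) \<in> R \<and> upper c x \<in> V}"
  have "Q \<noteq> {}"
    using retract_enters_earlier[OF b x V] False unfolding Q_def by blast
  then obtain c where "c \<in> Q" and min: "\<And>d. (d, c) \<in> R \<Longrightarrow> d \<notin> Q"
    using wfE_min'[OF wf_R] by blast
  then have c: "c \<in> B" "(c, b) \<in> R" "upper c x \<in> V"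
    unfolding Q_def by auto
  have "lower c x \<noteq> upper c x"
  proof
    assume "lower c x = upper c x"
    then obtain d where d: "d \<in> B" "(d, c) \<in> R" "upper d x \<in> V"
      using retract_enters_earlier[OF c(1) x V(1)] c(3) False by auto
    then have "d \<in> Q"
      using transD[OF trans_R d(2) c(2)] unfolding Q_def by simp
    then show False
      using min d(2) by blast
  qed
  then show thesis
    using that(2)[of c] c x unfolding jumps_def base_point_def by simp
qed (use that(1) in \<open>simp add: base_point_def\<close>)

text \<open>The network sets \<open>A\<close> at the base point and \<open>A'\<close> at \<open>y\<close> surround the pair \<open>(lower b x, x)\<close>, and a
  function \<open>g\<close> from stage \<open>b\<close> varies on them by less than half of the distance of its values at the pair.
  The point \<open>x\<close> and the function \<open>g\<close> depend on \<open>b\<close>, but all \<open>b\<close> that are linked at \<open>y\<close> to the same place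
  share the two collections \<open>W p (base_point s y)\<close> and \<open>W p y\<close>.\<close>

definition link :: "'p \<Rightarrow> 'i option \<Rightarrow> 'i \<Rightarrow> 'a \<Rightarrow> bool" where
  "link p s b y \<longleftrightarrow> (\<exists>x g \<delta> A A'. x \<in> topspace X \<and> g \<in> S' b \<and> 2 * \<delta> \<le> \<bar>g (lower b x) - g x\<bar> \<and>
     A \<in> W p (base_point s y) \<and> lower b x \<in> A \<and> (\<forall>u\<in>A. \<bar>g u - g (lower b x)\<bar> < \<delta>) \<and>
     A' \<in> W p y \<and> x \<in> A' \<and> (\<forall>u\<in>A'. \<bar>g u - g x\<bar> < \<delta>))"

lemma base_point_in_topspace:
  assumes "y \<in> topspace X" "\<And>c. s = Some c \<Longrightarrow> c \<in> B"
  shows "base_point s y \<in> topspace X"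
  using assms stable_S0 stable_S' by (cases s) (auto simp: base_point_def intro: retract_in_topspace)

text \<open>For an increasing sequence of \<open>b\<close> the pairs \<open>(lower (b n) (x n), x n)\<close> and the surrounding rectangles
  contain no bad sequence, as they come from \<open>W p (base_point s y)\<close> and \<open>W p y\<close>. So for some \<open>i < j\<close>
  both coordinates of the pair of \<open>j\<close> lie in the rectangle of \<open>i\<close>, where \<open>g i\<close> separates the sides. But
  \<open>g i\<close> belongs to \<open>S' (b i)\<close>, hence to \<open>S (b j)\<close>, and so takes equal values at the two coordinates.\<close>

lemma finite_link:
  assumes y: "y \<in> topspace X" and s: "\<And>c. s = Some c \<Longrightarrow> c \<in> B"
  shows "finite {b \<in> B. link p s b y}"
proof (rule ccontr)
  assume inf: "infinite {b \<in> B. link p s b y}"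
  obtain b :: "nat \<Rightarrow> 'i"
    where b: "\<And>n. b n \<in> {b \<in> B. link p s b y}" "\<And>i j. i < j \<Longrightarrow> (b i, b j) \<in> R"
    using increasing_sequence_in_wellorder[OF wf_R inf] total_R unfolding total_on_def by blast
  define Q where "Q n w = (case w of (x, g, \<delta>, A, A') \<Rightarrow>
     x \<in> topspace X \<and> g \<in> S' (b n) \<and> 2 * \<delta> \<le> \<bar>g (lower (b n) x) - g x\<bar> \<and>
     A \<in> W p (base_point s y) \<and> lower (b n) x \<in> A \<and> (\<forall>u\<in>A. \<bar>g u - g (lower (b n) x)\<bar> < \<delta>) \<and>
     A' \<in> W p y \<and> x \<in> A' \<and> (\<forall>u\<in>A'. \<bar>g u - g x\<bar> < \<delta>))" for n w
  have "\<forall>n. \<exists>w. Q n w"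
  proof
    fix n
    have "link p s (b n) y"
      using b(1) by simp
    then show "\<exists>w. Q n w"
      unfolding link_def Q_def by (elim conjE exE, intro exI) (simp; blast)
  qed
  from choice[OF this] obtain w where w: "\<forall>n. Q n (w n)" ..
  define x g \<delta> A A' where "x n = fst (w n)" and "g n = fst (snd (w n))"
    and "\<delta> n = fst (snd (snd (w n)))" and "A n = fst (snd (snd (snd (w n))))"
    and "A' n = snd (snd (snd (snd (w n))))" for n
  have Q: "x n \<in> topspace X" "g n \<in> S' (b n)" "2 * \<delta> n \<le> \<bar>g n (lower (b n) (x n)) - g n (x n)\<bar>"
    "A n \<in> W p (base_point s y)" "lower (b n) (x n) \<in> A n"
    "\<forall>u\<in>A n. \<bar>g n u - g n (lower (b n) (x n))\<bar> < \<delta> n"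
    "A' n \<in> W p y" "x n \<in> A' n" "\<forall>u\<in>A' n. \<bar>g n u - g n (x n)\<bar> < \<delta> n" for n
    using w[rule_format, of n] unfolding Q_def x_def g_def \<delta>_def A_def A'_def
    by (simp_all add: case_prod_beta)
  obtain i j where ij: "i < j" "lower (b j) (x j) \<in> A i" "x j \<in> A' i"
    using no_bad_sequence_product[of "W p (base_point s y)" "W p y" A "\<lambda>n. lower (b n) (x n)" A' x]
      no_bad_sequence_W[OF base_point_in_topspace[OF y s]] no_bad_sequence_W[OF y] Q by metis
  have "b i \<in> B" "b j \<in> B"
    using b(1) by blast+
  then have "g i \<in> S (b j)"
    using Q(2)[of i] S'_subset_S b(2)[OF ij(1)] by blast
  then have "g i (lower (b j) (x j)) = g i (x j)"
    using retract_eq[OF stable_S[OF \<open>b j \<in> B\<close>] Q(1)] by blast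
  moreover have "\<bar>g i (lower (b j) (x j)) - g i (lower (b i) (x i))\<bar> < \<delta> i"
    using Q(6)[of i] ij(2) by blast
  moreover have "\<bar>g i (x j) - g i (x i)\<bar> < \<delta> i"
    using Q(9)[of i] ij(3) by blast
  ultimately show False
    using Q(3)[of i] by linarith
qed

lemma link_mono:
  assumes "link p s b y" "p \<le> q" and y: "y \<in> topspace X" and s: "\<And>c. s = Some c \<Longrightarrow> c \<in> B"
  shows "link q s b y"
proof -
  have "W p y \<subseteq> W q y" "W p (base_point s y) \<subseteq> W q (base_point s y)"
    using assms(2) mono_W[OF y] mono_W[OF base_point_in_topspace[OF y s]] by simp_all
  moreover obtain x g \<delta> A A' where *: "x \<in> topspace X" "g \<in> S' b" "2 * \<delta> \<le> \<bar>g (lower b x) - g x\<bar>"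
    "A \<in> W p (base_point s y)" "lower b x \<in> A" "\<forall>u\<in>A. \<bar>g u - g (lower b x)\<bar> < \<delta>"
    "A' \<in> W p y" "x \<in> A'" "\<forall>u\<in>A'. \<bar>g u - g x\<bar> < \<delta>"
    using assms(1) unfolding link_def by (elim exE conjE)
  ultimately have "A \<in> W q (base_point s y)" "A' \<in> W q y"
    by (simp_all add: subset_iff)
  then show ?thesis
    unfolding link_def
    by (intro exI[of _ x] exI[of _ g] exI[of _ \<delta>] exI[of _ A] exI[of _ A'] conjI *)
qed

text \<open>Apply the network at the pair \<open>(lower b x, x)\<close>. The neighbourhood of its first coordinate contains
  \<open>lower b y\<close> for \<open>y\<close> near \<open>x\<close>, but also \<open>base_point s y\<close> for a place \<open>s\<close> before \<open>b\<close>, by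
  \<open>retract_enters_at_jump\<close>.\<close>

lemma link_near_jump:
  assumes "jumps b x"
  obtains s p G where "openin X G" "x \<in> G" "\<And>y. y \<in> G \<Longrightarrow> link p s b y"
    and "\<And>c. s = Some c \<Longrightarrow> (c, b) \<in> R \<and> jumps c x"
proof -
  have b: "b \<in> B" and x: "x \<in> topspace X" and ne: "lower b x \<noteq> upper b x"
    using assms unfolding jumps_def by auto
  have lower: "lower b x \<in> model (S' b)"
    using retract_in_model[OF stable_S[OF b] x] model_mono[OF S_subset_S'[OF b]] by blast
  have "\<exists>g\<in>S' b. g (lower b x) \<noteq> g x"
    using ne retract_unique[OF stable_S'[OF b] x lower] by metis
  then obtain g where g: "g \<in> S' b" "g (lower b x) \<noteq> g x"
    by blast
  \<comment> \<open>Half of the distance is the radius for which the two \<open>g\<close>-neighbourhoods are disjoint.\<close>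
  define \<delta> where "\<delta> = \<bar>g (lower b x) - g x\<bar> / 2"
  have "\<delta> > 0"
    using g(2) unfolding \<delta>_def by simp
  have cont: "continuous_map X euclideanreal g"
    by (rule continuous_stableD[OF stable_S'[OF b] g(1)])
  define U where "U z = {u \<in> topspace X. \<bar>g u - g z\<bar> < \<delta>}" for z
  have U: "openin X (U (lower b x))" "lower b x \<in> U (lower b x)" "openin X (U x)" "x \<in> U x"
    unfolding U_def using \<open>\<delta> > 0\<close> x retract_in_topspace[OF stable_S[OF b] x] openin_near[OF cont]
    by auto
  obtain V V' p where V: "openin X V" "lower b x \<in> V"
      "\<forall>y\<in>V. \<exists>A\<in>W p y. lower b x \<in> A \<and> A \<subseteq> U (lower b x)"
    and V': "openin X V'" "x \<in> V'" "\<forall>y\<in>V'. \<exists>A\<in>W p y. x \<in> A \<and> A \<subseteq> U x"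
    by (rule pair_network[OF U])
  have "\<exists>s. base_point s x \<in> V \<and> (\<forall>c. s = Some c \<longrightarrow> (c, b) \<in> R \<and> jumps c x)"
    by (rule retract_enters_at_jump[OF b x V(1,2)]) auto
  then obtain s where s: "base_point s x \<in> V" "\<And>c. s = Some c \<Longrightarrow> (c, b) \<in> R \<and> jumps c x"
    by blast
  define G where "G = {y \<in> topspace X. base_point s y \<in> V} \<inter> V'"
  have "continuous_map X X (base_point s)"
  proof (cases s)
    case None
    then show ?thesis
      using continuous_map_retract[OF stable_S0] unfolding base_point_def by simp
  next
    case (Some c)
    then have "c \<in> B"
      using s(2) unfolding jumps_def by blast
    then show ?thesis
      using Some continuous_map_retract[OF stable_S'] unfolding base_point_def by simp
  qed
  then have "openin X G"
    unfolding G_def using V(1) V'(1) openin_continuous_map_preimage by blast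
  moreover have "x \<in> G"
    unfolding G_def using x s(1) V'(2) by blast
  moreover have "link p s b y" if "y \<in> G" for y
  proof -
    have y: "base_point s y \<in> V" "y \<in> V'"
      using that unfolding G_def by simp_all
    from bspec[OF V(3) y(1)] obtain A
      where A: "A \<in> W p (base_point s y)" "lower b x \<in> A" "A \<subseteq> U (lower b x)"
      by (elim bexE conjE)
    from bspec[OF V'(3) y(2)] obtain A' where A': "A' \<in> W p y" "x \<in> A'" "A' \<subseteq> U x"
      by (elim bexE conjE)
    have "\<forall>u\<in>A. \<bar>g u - g (lower b x)\<bar> < \<delta>" "\<forall>u\<in>A'. \<bar>g u - g x\<bar> < \<delta>"
      using A(3) A'(3) unfolding U_def by auto
    moreover have "2 * \<delta> \<le> \<bar>g (lower b x) - g x\<bar>"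
      unfolding \<delta>_def by simp
    ultimately show ?thesis
      unfolding link_def
      by (intro exI[of _ x] exI[of _ g] exI[of _ \<delta>] exI[of _ A] exI[of _ A'] conjI x g(1) A(1,2) A'(1,2))
  qed
  ultimately show thesis
    using that s(2) by metis
qed

text \<open>From \<open>b\<close> one arrives at the bottom of the chain through at most \<open>n\<close> links at \<open>y\<close> with label \<open>p\<close>.\<close>

primrec reach :: "nat \<Rightarrow> 'p \<Rightarrow> 'i \<Rightarrow> 'a \<Rightarrow> bool" where
  "reach 0 p b y \<longleftrightarrow> False"
| "reach (Suc n) p b y \<longleftrightarrow>
     link p None b y \<or> (\<exists>c\<in>B. link p (Some c) b y \<and> reach n p c y)"

text \<open>By induction the places one link closer to the bottom are finite in number, and each of them is linked
  to finitely many \<open>b\<close>.\<close>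

lemma finite_reach:
  assumes "y \<in> topspace X"
  shows "finite {b \<in> B. reach n p b y}"
proof (induction n)
  case (Suc n)
  have "{b \<in> B. reach (Suc n) p b y} \<subseteq> {b \<in> B. link p None b y} \<union>
      (\<Union>c\<in>{c \<in> B. reach n p c y}. {b \<in> B. link p (Some c) b y})"
    by auto
  moreover have "finite {b \<in> B. link p None b y}"
    using finite_link[OF assms, of None p] by simp
  moreover have "finite (\<Union>c\<in>{c \<in> B. reach n p c y}. {b \<in> B. link p (Some c) b y})"
    using Suc.IH finite_link[OF assms] by auto
  ultimately show ?case
    by (meson finite_UnI finite_subset)
qed simp

lemma reach_mono:
  assumes "reach m p b y" "m \<le> n" "p \<le> q" "y \<in> topspace X"
  shows "reach n q b y"
  using assms(1,2)
proof (induction m arbitrary: n b)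
  case (Suc m)
  then obtain k where k: "n = Suc k" "m \<le> k"
    by (metis Suc_le_D Suc_le_mono)
  from Suc.prems(1) show ?case
    using Suc.IH[OF _ k(2)] link_mono[OF _ assms(3,4)] unfolding k by auto
qed simp

text \<open>Links lead to earlier places that move \<open>x\<close> as well, so well-foundedness yields a finite chain, valid
  in the intersection of the finitely many neighbourhoods involved.\<close>

lemma reach_near_jump:
  assumes "jumps b x"
  shows "\<exists>n p G. openin X G \<and> x \<in> G \<and> (\<forall>y\<in>G. reach n p b y)"
  using wf_R assms
proof (induction b rule: wf_induct_rule)
  case (less b)
  obtain s p G where G: "openin X G" "x \<in> G" "\<And>y. y \<in> G \<Longrightarrow> link p s b y"
    and s: "\<And>c. s = Some c \<Longrightarrow> (c, b) \<in> R \<and> jumps c x"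
    using link_near_jump[OF less.prems] by metis
  show ?case
  proof (cases s)
    case None
    then show ?thesis
      using G by (intro exI[of _ "Suc 0"] exI[of _ p] exI[of _ G]) auto
  next
    case (Some c)
    have c: "(c, b) \<in> R" "jumps c x"
      using s[OF Some] by simp_all
    from less.IH[OF c] obtain m q H where H: "openin X H" "x \<in> H" "\<forall>y\<in>H. reach m q c y"
      by (elim exE conjE)
    obtain r where r: "p \<le> r" "q \<le> r"
      by (rule upper_bound2)
    have cB: "c \<in> B"
      using c(2) unfolding jumps_def by simp
    have "reach (Suc m) r b y" if "y \<in> G \<inter> H" for y
    proof -
      have y: "y \<in> topspace X"
        using that openin_subset[OF G(1)] by blast
      have "link r (Some c) b y"
        using link_mono[OF _ r(1) y, of "Some c" b] G(3)[of y] that cB unfolding Some by simp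
      moreover have "reach m r c y"
        using H(3) that reach_mono[OF _ order_refl r(2) y] by simp
      ultimately show ?thesis
        using cB by auto
    qed
    then show ?thesis
      using G(1,2) H(1,2)
      by (intro exI[of _ "Suc m"] exI[of _ r] exI[of _ "G \<inter> H"]) auto
  qed
qed

text \<open>Compactness replaces the pairs \<open>(n, p)\<close> that depend on a point by one \<open>p\<close>. A single label is essential
  here: an open set that was cut into pieces according to the labels could contribute infinitely many
  pieces below one \<open>p\<close>.\<close>

lemma reach_on_compact:
  assumes K: "compactin X K" and jump: "\<And>x. x \<in> K \<Longrightarrow> jumps b x"
  shows "\<exists>p. \<forall>y\<in>K. reach (\<phi> p) p b y"
proof -
  have "\<forall>x\<in>K. \<exists>G. openin X G \<and> x \<in> G \<and> (\<exists>n p. \<forall>y\<in>G. reach n p b y)"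
    using reach_near_jump jump by meson
  from bchoice[OF this] obtain G
    where G: "\<forall>x\<in>K. openin X (G x) \<and> x \<in> G x \<and> (\<exists>n p. \<forall>y\<in>G x. reach n p b y)" ..
  then have "\<forall>x\<in>K. \<exists>n. \<exists>p. \<forall>y\<in>G x. reach n p b y"
    by blast
  from bchoice[OF this] obtain n where "\<forall>x\<in>K. \<exists>p. \<forall>y\<in>G x. reach (n x) p b y" ..
  from bchoice[OF this] obtain p where np: "\<forall>x\<in>K. \<forall>y\<in>G x. reach (n x) (p x) b y" ..
  have "openin X (G x)" "x \<in> G x" if "x \<in> K" for x
    using G that by simp_all
  then obtain F where F: "finite F" "F \<subseteq> K" "K \<subseteq> (\<Union>x\<in>F. G x)"
    by (rule compactin_finite_cover[OF K])
  obtain q where q: "\<And>r. r \<in> p ` F \<Longrightarrow> r \<le> q"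
    using finite_upper_bound[of "p ` F"] F(1) by blast
  obtain r where r: "q \<le> r" "Max (insert 0 (n ` F)) \<le> \<phi> r"
    using upper_bound2_index[of q q "Max (insert 0 (n ` F))"] by blast
  have "reach (\<phi> r) r b y" if y: "y \<in> K" for y
  proof -
    obtain x where x: "x \<in> F" "y \<in> G x"
      using F(3) y by blast
    have "p x \<le> r"
      using q[of "p x"] r(1) x(1) order_trans by blast
    moreover have "n x \<le> Max (insert 0 (n ` F))"
      using F(1) x(1) by (intro Max_ge) auto
    moreover have "y \<in> topspace X"
      using K y compactin_subset_topspace by blast
    moreover have "reach (n x) (p x) b y"
      using np x F(2) by blast
    ultimately show ?thesis
      using reach_mono r(2) order_trans by meson
  qed
  then show ?thesis
    by blast
qed

end

section \<open>Separating families of functions\<close>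

text \<open>The functions need not be determined by \<open>A\<close>; they separate at least those points that \<open>A\<close> separates.\<close>

definition separating_family ::
    "'a topology \<Rightarrow> ('p::order \<Rightarrow> ('a \<Rightarrow> real) set) \<Rightarrow> ('a \<Rightarrow> real) set \<Rightarrow> bool" where
  "separating_family X L A \<longleftrightarrow> mono L \<and>
     (\<forall>p. \<forall>f\<in>L p. continuous_map X euclideanreal f \<and> (\<forall>x\<in>topspace X. 0 \<le> f x)) \<and>
     (\<forall>p. \<forall>x\<in>topspace X. finite {f \<in> L p. f x \<noteq> 0}) \<and>
     (\<forall>x\<in>topspace X. \<forall>y\<in>topspace X. (\<forall>p. \<forall>f\<in>L p. f x = f y) \<longrightarrow> (\<forall>g\<in>A. g x = g y))"

lemma
  assumes "separating_family X L A"
  shows separating_family_mono: "p \<le> q \<Longrightarrow> L p \<subseteq> L q"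
    and separating_family_continuous: "f \<in> L p \<Longrightarrow> continuous_map X euclideanreal f"
    and separating_family_nonneg: "f \<in> L p \<Longrightarrow> x \<in> topspace X \<Longrightarrow> 0 \<le> f x"
    and separating_family_finite: "x \<in> topspace X \<Longrightarrow> finite {f \<in> L p. f x \<noteq> 0}"
    and separating_family_separates: "x \<in> topspace X \<Longrightarrow> y \<in> topspace X \<Longrightarrow>
      (\<And>p f. f \<in> L p \<Longrightarrow> f x = f y) \<Longrightarrow> g \<in> A \<Longrightarrow> g x = g y"
  using assms unfolding separating_family_def by (simp_all add: monoD)

lemma truncations_determine_positive_part:
  fixes a b :: real
  assumes "\<And>k. max 0 (a - 1 / real (Suc k)) = max 0 (b - 1 / real (Suc k))"
  shows "max 0 a = max 0 b"
proof -
  have "max 0 b \<le> max 0 a" if eq: "\<And>k. max 0 (a - 1 / real (Suc k)) = max 0 (b - 1 / real (Suc k))"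
    for a b :: real
  proof (rule ccontr)
    assume "\<not> max 0 b \<le> max 0 a"
    then obtain k where k: "inverse (real (Suc k)) < b - max 0 a"
      using reals_Archimedean[of "b - max 0 a"] by (auto simp: max_def split: if_splits)
    define c where "c = 1 / real (Suc k)"
    have "0 < c" "c < b - max 0 a" "max 0 (a - c) = max 0 (b - c)"
      using k eq[of k] unfolding c_def inverse_eq_divide by auto
    then show False
      by (auto simp: max_def split: if_splits)
  qed
  from this[of a b] this[of b a] assms show ?thesis
    by (metis order_antisym)
qed

context retraction_chain
begin

text \<open>Subtracting \<open>1 / (k + 1)\<close> confines the support to a closed set of points moved at \<open>b\<close>, so that
  \<open>reach_on_compact\<close> applies to it.\<close>

definition bump :: "'i \<Rightarrow> real \<Rightarrow> nat \<Rightarrow> ('a \<Rightarrow> real) \<Rightarrow> 'a \<Rightarrow> real" where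
  "bump b t k f y = max 0 (t * (f (upper b y) - f (lower b y)) - 1 / real (Suc k))"

lemma continuous_map_bump:
  assumes b: "b \<in> B" and f: "continuous_map X euclideanreal f"
  shows "continuous_map X euclideanreal (bump b t k f)"
proof -
  have "continuous_map X euclideanreal (f \<circ> upper b)" "continuous_map X euclideanreal (f \<circ> lower b)"
    using continuous_map_retract[OF stable_S[OF b]] continuous_map_retract[OF stable_S'[OF b]] f
    by (auto intro: continuous_map_compose)
  then show ?thesis
    unfolding bump_def[abs_def]
    by (intro continuous_map_real_max continuous_map_diff continuous_map_real_mult
        continuous_map_canonical_const) (simp_all add: comp_def)
qed

lemma compactin_bump_support:
  assumes b: "b \<in> B" and f: "continuous_map X euclideanreal f"
  shows "compactin X {y \<in> topspace X. 1 / real (Suc k) \<le> t * (f (upper b y) - f (lower b y))}"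
proof -
  have "continuous_map X euclideanreal (f \<circ> upper b)" "continuous_map X euclideanreal (f \<circ> lower b)"
    using continuous_map_retract[OF stable_S[OF b]] continuous_map_retract[OF stable_S'[OF b]] f
    by (auto intro: continuous_map_compose)
  then have "continuous_map X euclideanreal (\<lambda>y. t * (f (upper b y) - f (lower b y)))"
    by (intro continuous_map_diff continuous_map_real_mult continuous_map_canonical_const)
      (simp_all add: comp_def)
  from closedin_real_preimage[OF this closed_atLeast, of "1 / real (Suc k)"] show ?thesis
    using compact closedin_compact_space by simp
qed

text \<open>A function \<open>bump b t k f\<close> is admitted at level \<open>p\<close> only if \<open>p\<close> bounds a label that lets all points of
  its support reach the bottom from \<open>b\<close>. A point \<open>y\<close> of the support therefore restricts \<open>b\<close> to a finite
  set, by \<open>finite_reach\<close>, and for each \<open>b\<close> the given family restricts \<open>f\<close>. The points are separated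
  because \<open>upper b x = upper b y\<close> follows successively for all \<open>b\<close>: \<open>lower b x = lower b y\<close> by induction,
  and the bumps recover the differences \<open>f (upper b x) - f (lower b x)\<close>.\<close>

lemma chain_separating_family:
  assumes L0: "separating_family X (L0 :: 'p \<Rightarrow> _) S0"
    and Lb: "\<And>b. b \<in> B \<Longrightarrow> separating_family X (Lb b :: 'p \<Rightarrow> _) (S' b)"
  shows "\<exists>L :: 'p \<Rightarrow> _. separating_family X L (\<Union>b\<in>B. S' b)"
proof -
  define K where "K b t k f = {y \<in> topspace X. 1 / real (Suc k) \<le> t * (f (upper b y) - f (lower b y))}"
    for b t k and f :: "'a \<Rightarrow> real"
  define lbl where "lbl b t k f = (SOME p. \<forall>y\<in>K b t k f. reach (\<phi> p) p b y)" for b t k f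
  have lbl: "reach (\<phi> (lbl b t k f)) (lbl b t k f) b y"
    if b: "b \<in> B" and f: "continuous_map X euclideanreal f" and y: "y \<in> K b t k f" for b t k f y
  proof -
    have "\<exists>p. \<forall>y\<in>K b t k f. reach (\<phi> p) p b y"
    proof (rule reach_on_compact)
      show "compactin X (K b t k f)"
        unfolding K_def by (rule compactin_bump_support[OF b f])
      fix x assume x: "x \<in> K b t k f"
      have "0 < 1 / real (Suc k)"
        by simp
      then have "f (upper b x) \<noteq> f (lower b x)"
        using x unfolding K_def by fastforce
      then show "jumps b x"
        using b x unfolding jumps_def K_def by auto
    qed
    then have "\<forall>y\<in>K b t k f. reach (\<phi> (lbl b t k f)) (lbl b t k f) b y"
      unfolding lbl_def by (rule someI_ex)
    then show ?thesis
      using y by blast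
  qed
  define M where "M p = {bump b t k f |b t k f. b \<in> B \<and> t \<in> {1, -1} \<and> k \<le> \<phi> p \<and> f \<in> Lb b p \<and>
     lbl b t k f \<le> p}" for p
  define L where "L p = L0 p \<union> M p" for p
  have "separating_family X L (\<Union>b\<in>B. S' b)"
    unfolding separating_family_def
  proof (intro conjI allI ballI impI)
    show "mono L"
    proof (rule monoI)
      fix p q :: 'p assume pq: "p \<le> q"
      have "M p \<subseteq> M q"
      proof
        fix m assume "m \<in> M p"
        then obtain b t k f where *: "m = bump b t k f" "b \<in> B" "t \<in> {1, -1}" "k \<le> \<phi> p" "f \<in> Lb b p"
          "lbl b t k f \<le> p"
          unfolding M_def by blast
        have "k \<le> \<phi> q"
          using *(4) monoD[OF mono_\<phi> pq] by (rule order_trans)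
        moreover have "f \<in> Lb b q"
          using *(5) separating_family_mono[OF Lb[OF *(2)] pq] by blast
        moreover have "lbl b t k f \<le> q"
          using *(6) pq by (rule order_trans)
        ultimately show "m \<in> M q"
          unfolding M_def using *(1-3) by blast
      qed
      then show "L p \<subseteq> L q"
        unfolding L_def using separating_family_mono[OF L0 pq] by blast
    qed
    fix p
    show "continuous_map X euclideanreal f" if "f \<in> L p" for f
    proof (cases "f \<in> L0 p")
      case True
      then show ?thesis
        by (rule separating_family_continuous[OF L0])
    next
      case False
      then have "f \<in> M p"
        using that unfolding L_def by blast
      then obtain b t k f' where *: "f = bump b t k f'" "b \<in> B" "f' \<in> Lb b p"
        unfolding M_def by blast
      show ?thesis
        unfolding *(1) using separating_family_continuous[OF Lb[OF *(2)] *(3)]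
        by (rule continuous_map_bump[OF *(2)])
    qed
    show "0 \<le> f x" if "f \<in> L p" "x \<in> topspace X" for f x
    proof (cases "f \<in> L0 p")
      case True
      then show ?thesis
        using separating_family_nonneg[OF L0 _ that(2)] by blast
    next
      case False
      then have "f \<in> M p"
        using that unfolding L_def by blast
      then show ?thesis
        unfolding M_def bump_def[abs_def] by auto
    qed
    show "finite {f \<in> L p. f y \<noteq> 0}" if y: "y \<in> topspace X" for y
    proof -
      define N where "N b = {f \<in> Lb b p. f (upper b y) \<noteq> 0} \<union> {f \<in> Lb b p. f (lower b y) \<noteq> 0}" for b
      have N: "finite (N b)" if "b \<in> B" for b
        unfolding N_def
        using separating_family_finite[OF Lb[OF that] retract_in_topspace[OF stable_S'[OF that] y]]
          separating_family_finite[OF Lb[OF that] retract_in_topspace[OF stable_S[OF that] y]]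
        by (rule finite_UnI)
      have "{f \<in> M p. f y \<noteq> 0} \<subseteq> (\<Union>b\<in>{b \<in> B. reach (\<phi> p) p b y}. \<Union>t\<in>{1, -1}. \<Union>k\<in>{..\<phi> p}.
          bump b t k ` N b)"
      proof
        fix m assume "m \<in> {f \<in> M p. f y \<noteq> 0}"
        then obtain b t k f where *: "m = bump b t k f" "b \<in> B" "t \<in> {1, -1}" "k \<le> \<phi> p" "f \<in> Lb b p"
          "lbl b t k f \<le> p" and ne: "bump b t k f y \<noteq> 0"
          unfolding M_def by blast
        have pos: "1 / real (Suc k) < t * (f (upper b y) - f (lower b y))"
          using ne unfolding bump_def by (simp add: max_def split: if_splits)
        then have "y \<in> K b t k f"
          unfolding K_def using y by simp
        then have "reach (\<phi> (lbl b t k f)) (lbl b t k f) b y"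
          by (rule lbl[OF *(2) separating_family_continuous[OF Lb[OF *(2)] *(5)]])
        then have "reach (\<phi> p) p b y"
          using reach_mono[OF _ monoD[OF mono_\<phi> *(6)] *(6) y] by blast
        moreover have "f \<in> N b"
        proof -
          have "0 < 1 / real (Suc k)"
            by simp
          then have "f (upper b y) \<noteq> 0 \<or> f (lower b y) \<noteq> 0"
            using pos by fastforce
          then show ?thesis
            unfolding N_def using *(5) by blast
        qed
        ultimately show "m \<in> (\<Union>b\<in>{b \<in> B. reach (\<phi> p) p b y}. \<Union>t\<in>{1, -1}. \<Union>k\<in>{..\<phi> p}.
            bump b t k ` N b)"
          using * by blast
      qed
      moreover have "finite (\<Union>b\<in>{b \<in> B. reach (\<phi> p) p b y}. \<Union>t\<in>{1, -1::real}. \<Union>k\<in>{..\<phi> p}.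
          bump b t k ` N b)"
        using finite_reach[OF y] N by auto
      ultimately have "finite {f \<in> M p. f y \<noteq> 0}"
        by (rule finite_subset)
      moreover have "{f \<in> L p. f y \<noteq> 0} = {f \<in> L0 p. f y \<noteq> 0} \<union> {f \<in> M p. f y \<noteq> 0}"
        unfolding L_def by blast
      ultimately show ?thesis
        using separating_family_finite[OF L0 y] by simp
    qed
  next
    fix x y g assume x: "x \<in> topspace X" and y: "y \<in> topspace X"
      and eq: "\<forall>p. \<forall>f\<in>L p. f x = f y" and g: "g \<in> (\<Union>b\<in>B. S' b)"
    have eq0: "h x = h y" if "h \<in> S0" for h
      using separating_family_separates[OF L0 x y _ that] eq unfolding L_def by blast
    have "\<forall>h\<in>S' b. h x = h y" if "b \<in> B" for b
      using wf_R that
    proof (induction b rule: wf_induct_rule)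
      case (less b)
      have b: "b \<in> B"
        by (rule less.prems)
      have "h x = h y" if "h \<in> S b" for h
        using finite_subset_S[OF b, of "{h}"] that eq0 less.IH by auto
      then have lower: "lower b x = lower b y"
        by (rule retract_cong[OF stable_S[OF b] x y])
      have upper: "f (upper b x) = f (upper b y)" if f: "f \<in> Lb b p" for f p
      proof -
        have bumps: "bump b t k f x = bump b t k f y" if "t \<in> {1, -1}" for t k
        proof -
          obtain q where q: "p \<le> q" "lbl b t k f \<le> q" "k \<le> \<phi> q"
            by (rule upper_bound2_index)
          have "f \<in> Lb b q"
            using f separating_family_mono[OF Lb[OF b] q(1)] by blast
          then have "bump b t k f \<in> L q"
            unfolding L_def M_def using b that q(2,3) by blast
          then show ?thesis
            using eq by blast
        qed
        define d where "d z = f (upper b z) - f (lower b z)" for z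
        have "max 0 (d x) = max 0 (d y)"
          using truncations_determine_positive_part[of "d x" "d y"] bumps[of 1]
          unfolding bump_def d_def by simp
        moreover have "max 0 (- d x) = max 0 (- d y)"
          using truncations_determine_positive_part[of "- d x" "- d y"] bumps[of "-1"]
          unfolding bump_def d_def by simp
        ultimately have "d x = d y"
          by (auto simp: max_def split: if_splits)
        then show ?thesis
          unfolding d_def lower by simp
      qed
      show ?case
      proof
        fix h assume h: "h \<in> S' b"
        have "h (upper b x) = h (upper b y)"
          using separating_family_separates[OF Lb[OF b] retract_in_topspace[OF stable_S'[OF b] x]
              retract_in_topspace[OF stable_S'[OF b] y] upper h] .
        then show "h x = h y"
          using retract_eq[OF stable_S'[OF b] x h] retract_eq[OF stable_S'[OF b] y h] by simp
      qed
    qed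
    then show "g x = g y"
      using g by blast
  qed
  then show ?thesis
    by blast
qed

end

context small_separators
begin

lemma small_separating_family:
  assumes "small_for TYPE('p) A" and cont: "\<And>g. g \<in> A \<Longrightarrow> continuous_map X euclideanreal g"
  shows "\<exists>L :: 'p \<Rightarrow> _. separating_family X L A"
proof -
  obtain h where h: "\<And>p. finite {g \<in> A. h g \<le> (p::'p)}"
    using assms(1) unfolding small_for_def by blast
  \<comment> \<open>The functions are cut off at rational levels in order to make them nonnegative; the levels cost
    countably many indices.\<close>
  define e :: "('a \<Rightarrow> real) \<times> rat \<Rightarrow> 'a \<Rightarrow> real" where "e = (\<lambda>(g, q) x. max 0 (g x - of_rat q))"
  define Q where "Q p = {g \<in> A. h g \<le> p} \<times> {q::rat. to_nat q \<le> \<phi> p}" for p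
  have "finite {q::rat. to_nat q \<le> n}" for n
    using finite_vimageI[OF finite_atMost[of n] inj_to_nat] by (simp add: vimage_def)
  then have fin: "finite (Q p)" for p
    unfolding Q_def using h by blast
  have "separating_family X (\<lambda>p. e ` Q p) A"
    unfolding separating_family_def
  proof (intro conjI allI ballI impI)
    show "mono (\<lambda>p. e ` Q p)"
    proof (intro monoI image_mono)
      fix p q :: 'p assume "p \<le> q"
      then show "Q p \<subseteq> Q q"
        unfolding Q_def using monoD[OF mono_\<phi>, of p q] by auto
    qed
    show "continuous_map X euclideanreal f" if "f \<in> e ` Q p" for p f
      using that cont unfolding Q_def e_def
      by (auto intro!: continuous_map_real_max continuous_map_diff)
    show "0 \<le> f x" if "f \<in> e ` Q p" for p f x
      using that unfolding Q_def e_def by auto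
    show "finite {f \<in> e ` Q p. f x \<noteq> 0}" for p x
      using fin by simp
    fix x y g assume eq: "\<forall>p. \<forall>f\<in>e ` Q p. f x = f y" and g: "g \<in> A"
    have no_less: "\<not> g u < g v" if "{u, v} = {x, y}" for u v
    proof
      assume "g u < g v"
      then obtain q where q: "g u < of_rat q" "of_rat q < g v"
        using of_rat_dense by blast
      obtain p where "h g \<le> p" "to_nat q \<le> \<phi> p"
        using upper_bound2_index by blast
      then have "(g, q) \<in> Q p"
        unfolding Q_def using g by blast
      then have "e (g, q) x = e (g, q) y"
        using eq by blast
      then have "e (g, q) u = e (g, q) v"
        using that by (auto simp: doubleton_eq_iff)
      then show False
        unfolding e_def using q by simp
    qed
    have "\<not> g x < g y"
      by (rule no_less) simp
    moreover have "\<not> g y < g x"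
      by (rule no_less) blast
    ultimately show "g x = g y"
      by simp
  qed
  then show ?thesis
    by blast
qed

text \<open>Induction on the cardinality of \<open>A\<close>. If \<open>A\<close> is not small, it is the union of a chain of stable sets of
  smaller cardinality, and the families for the members of the chain combine.\<close>

lemma stable_separating_family:
  assumes "continuous_stable A"
  shows "\<exists>L :: 'p \<Rightarrow> _. separating_family X L A"
  using assms
proof (induction "|A|" arbitrary: A rule: wf_induct_rule[OF wf_ordLess])
  case 1
  show ?case
  proof (cases "small_for TYPE('p) A")
    case True
    then show ?thesis
      using small_separating_family continuous_stableD[OF "1.prems"] by blast
  next
    case False
    then have inf: "infinite A"
      using small_countable countable_finite by blast
    have stable_A: "box_stable X I A"
      using "1.prems" unfolding continuous_stable_def by simp
    define r where "r = |A|"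
    have r: "Card_order r" "Field r = A" "well_order_on A r"
      unfolding r_def by (rule card_of_Card_order Field_card_of card_of_well_order_on)+
    then have lin: "refl_on A r" "trans r" "antisym r" "total_on A r" "wf (r - Id)"
      unfolding well_order_on_def linear_order_on_def partial_order_on_def preorder_on_def by auto
    have under_sub: "underS r b \<subseteq> A" "under r b \<subseteq> A" for b
      using r(2) unfolding underS_def under_def Field_def by auto
    define S S' where "S b = box_stable X I hull underS r b" and "S' b = box_stable X I hull under r b" for b
    define S0 where "S0 = box_stable X I hull {}"
    have hull_A: "box_stable X I hull T \<subseteq> A" if "T \<subseteq> A" for T
      using that stable_A by (rule hull_minimal)
    have cs: "continuous_stable (box_stable X I hull T)" if "T \<subseteq> A" for T
      unfolding continuous_stable_def
      using hull_A[OF that] continuous_stableD[OF "1.prems"] box_stable_hull by blast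
    have finite_sub: "F \<subseteq> S0 \<or> (\<exists>c\<in>A. (c, b) \<in> r - Id \<and> F \<subseteq> S' c)"
      if b: "b \<in> A" and F: "finite F" "F \<subseteq> S b" for b F
    proof (cases "underS r b = {}")
      case True
      then show ?thesis
        using F unfolding S_def S0_def by simp
    next
      case False
      let ?C = "S' ` underS r b"
      have chain: "subset.chain UNIV ?C"
        unfolding subset_chain_def
      proof (intro conjI ballI)
        fix U V assume "U \<in> ?C" "V \<in> ?C"
        then obtain c d where cd: "c \<in> A" "d \<in> A" "U = S' c" "V = S' d"
          using under_sub by blast
        have "under r c \<subseteq> under r d \<or> under r d \<subseteq> under r c"
        proof (cases "c = d")
          case False
          then have "(c, d) \<in> r \<or> (d, c) \<in> r"
            using lin(4) cd unfolding total_on_def by blast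
          then show ?thesis
            using transD[OF lin(2)] unfolding under_def by blast
        qed simp
        then show "U \<subseteq> V \<or> V \<subseteq> U"
          unfolding cd S'_def using hull_mono by blast
      qed simp
      have "box_stable X I (\<Union>?C)"
      proof (rule box_stable_chain_Union[OF _ chain])
        fix U assume U: "U \<in> ?C"
        then have "box_stable X I U"
          unfolding S'_def using box_stable_hull by blast
        then show "\<exists>V\<in>?C. \<forall>a\<in>box_points X U. \<forall>b\<in>box_points X U. I a b \<subseteq> V"
          using U unfolding box_stable_def by blast
      qed (use False in simp)
      moreover have "underS r b \<subseteq> \<Union>?C"
      proof
        fix c assume c: "c \<in> underS r b"
        then have "c \<in> under r c"
          using lin(1) under_sub(1) unfolding refl_on_def under_def by blast
        then have "c \<in> S' c"
          unfolding S'_def by (rule hull_inc)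
        then show "c \<in> \<Union>?C"
          using c by blast
      qed
      ultimately have "S b \<subseteq> \<Union>?C"
        unfolding S_def by (intro hull_minimal)
      then have "F \<subseteq> \<Union>?C"
        using F(2) by blast
      then obtain U where U: "U \<in> ?C" "F \<subseteq> U"
        using finite_subset_Union_chain[OF F(1) _ _ chain] False by blast
      then obtain c where "c \<in> underS r b" "F \<subseteq> S' c"
        by blast
      then show ?thesis
        using under_sub(1) unfolding underS_def by blast
    qed
    interpret retraction_chain \<phi> X W I A "r - Id" S S' S0
    proof
      show "wf (r - Id)"
        by (rule lin(5))
      show "trans (r - Id)"
        using lin(2,3) by (rule trans_diff_Id)
      show "total_on A (r - Id)"
        using lin(4) by simp
      fix b assume b: "b \<in> A"
      show "continuous_stable (S b)" "continuous_stable (S' b)"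
        unfolding S_def S'_def by (rule cs[OF under_sub(1)], rule cs[OF under_sub(2)])
      show "S b \<subseteq> S' b"
        unfolding S_def S'_def by (rule hull_mono) (auto simp: underS_def under_def)
      show "S0 \<subseteq> S b"
        unfolding S_def S0_def by (rule hull_mono) simp
      show "F \<subseteq> S0 \<or> (\<exists>c\<in>A. (c, b) \<in> r - Id \<and> F \<subseteq> S' c)" if "finite F" "F \<subseteq> S b" for F
        using finite_sub[OF b that] .
      fix c assume "c \<in> A" "(c, b) \<in> r - Id"
      then have "under r c \<subseteq> underS r b"
        using transD[OF lin(2)] antisymD[OF lin(3)] unfolding under_def underS_def by blast
      then show "S' c \<subseteq> S b"
        unfolding S_def S'_def by (rule hull_mono)
    next
      show "continuous_stable S0"
        unfolding S0_def by (rule cs) simp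
    qed
    have "\<exists>L0 :: 'p \<Rightarrow> _. separating_family X L0 S0"
    proof (rule small_separating_family)
      show "small_for TYPE('p) S0"
        unfolding S0_def using small_countable[of "{}"] small_I by (intro small_hull) auto
      show "continuous_map X euclideanreal g" if "g \<in> S0" for g
        using that stable_S0 continuous_stableD by blast
    qed
    then obtain L0 :: "'p \<Rightarrow> _" where L0: "separating_family X L0 S0"
      by blast
    have "\<exists>Lb :: 'p \<Rightarrow> _. separating_family X Lb (S' b)" if b: "b \<in> A" for b
    proof (rule "1.hyps")
      have "|underS r b| <o |A|"
        using card_of_underS[OF r(1)] r(2) b unfolding r_def by blast
      moreover have "|{b}| <o |A|"
        unfolding card_of_ordLess[symmetric]
        using inf inj_on_finite[of _ A "{b}"] by (meson finite.emptyI finite.insertI)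
      ultimately have "|underS r b \<union> {b}| <o |A|"
        using inf by (intro card_of_Un_ordLess_infinite)
      moreover have "under r b \<subseteq> underS r b \<union> {b}"
        unfolding under_def underS_def by blast
      ultimately have "|under r b| <o |A|"
        using card_of_mono1 ordLeq_ordLess_trans by blast
      then show "( |S' b|, |A| ) \<in> ordLess"
        unfolding S'_def using small_I by (intro card_hull_ordLess[OF False]) auto
      show "continuous_stable (S' b)"
        by (rule stable_S'[OF b])
    qed
    then obtain Lb :: "('a \<Rightarrow> real) \<Rightarrow> 'p \<Rightarrow> _" where Lb: "\<And>b. b \<in> A \<Longrightarrow> separating_family X (Lb b) (S' b)"
      by metis
    have "\<exists>L :: 'p \<Rightarrow> _. separating_family X L (\<Union>b\<in>A. S' b)"
      by (rule chain_separating_family[OF L0 Lb])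
    moreover have "(\<Union>b\<in>A. S' b) = A"
    proof
      show "(\<Union>b\<in>A. S' b) \<subseteq> A"
        unfolding S'_def using hull_A[OF under_sub(2)] by blast
      show "A \<subseteq> (\<Union>b\<in>A. S' b)"
      proof
        fix b assume b: "b \<in> A"
        then have "b \<in> under r b"
          using lin(1) unfolding refl_on_def under_def by blast
        then show "b \<in> (\<Union>b\<in>A. S' b)"
          unfolding S'_def using b hull_inc by fast
      qed
    qed
    ultimately show ?thesis
      by simp
  qed
qed

end

theorem (in compact_point_network) ex_separating_family:
  "\<exists>L :: 'p \<Rightarrow> _. separating_family X L {g. continuous_map X euclideanreal g}"
proof -
  obtain I :: "'a \<Rightarrow> 'a \<Rightarrow> ('a \<Rightarrow> real) set"
    where I: "\<And>a b g. g \<in> I a b \<Longrightarrow> continuous_map X euclideanreal g"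
      "\<And>a b. a \<in> topspace X \<Longrightarrow> b \<in> topspace X \<Longrightarrow> small_for TYPE('p) (I a b)"
      "\<And>x y. x \<in> topspace X \<Longrightarrow> y \<in> topspace X \<Longrightarrow> x \<noteq> y \<Longrightarrow>
        \<exists>V V' g. openin X V \<and> x \<in> V \<and> openin X V' \<and> y \<in> V' \<and> g x \<noteq> g y \<and> (\<forall>a\<in>V. \<forall>b\<in>V'. g \<in> I a b)"
    by (rule small_separators) blast
  interpret small_separators \<phi> X W I
    using I by unfold_locales
  show ?thesis
  proof (rule stable_separating_family)
    show "continuous_stable {g. continuous_map X euclideanreal g}"
      unfolding continuous_stable_def box_stable_def using I(1) by blast
  qed
qed

section \<open>Almost subbases from separating families\<close>

lemma base_of_iff:
  "base_of X \<B> \<longleftrightarrow> (\<forall>B\<in>\<B>. openin X B) \<and>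
     (\<forall>U x. openin X U \<and> x \<in> U \<longrightarrow> (\<exists>B\<in>\<B>. x \<in> B \<and> B \<subseteq> U))"
  unfolding base_of_def openin_topology_base_unique by blast

lemma subbase_of_iff:
  "subbase_of X \<S> \<longleftrightarrow> (\<forall>S\<in>\<S>. openin X S) \<and>
     (\<forall>U x. openin X U \<and> x \<in> U \<longrightarrow>
        (\<exists>\<T>. finite \<T> \<and> \<T> \<subseteq> \<S> \<and> x \<in> \<Inter>\<T> \<and> topspace X \<inter> \<Inter>\<T> \<subseteq> U))"
  (is "_ \<longleftrightarrow> ?open \<and> ?basic")
proof -
  have rel: "(finite intersection_of (\<lambda>U. U \<in> \<S>) relative_to topspace X) V \<longleftrightarrow>
      (\<exists>\<T>. finite \<T> \<and> \<T> \<subseteq> \<S> \<and> V = topspace X \<inter> \<Inter>\<T>)" for V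
    unfolding relative_to_def intersection_of_def by auto
  have fin: "openin X (topspace X \<inter> \<Inter>\<T>)" if "finite \<T>" "\<T> \<subseteq> \<S>" "?open" for \<T>
    using that by (induction \<T>) (auto simp: Int_left_commute)
  show ?thesis
  proof
    assume *: "subbase_of X \<S>"
    then have sub: "\<forall>S\<in>\<S>. S \<subseteq> topspace X"
      and gen: "openin X = arbitrary union_of (finite intersection_of (\<lambda>U. U \<in> \<S>) relative_to topspace X)"
      unfolding subbase_of_def by blast+
    from gen have 1: "openin X V" if "finite \<T>" "\<T> \<subseteq> \<S>" "V = topspace X \<inter> \<Inter>\<T>" for V \<T>
      using that unfolding openin_topology_base_unique rel by blast
    have ?open
    proof
      fix S assume "S \<in> \<S>"
      then show "openin X S"
        using 1[of "{S}" S] sub by auto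
    qed
    moreover have ?basic
    proof (intro allI impI)
      fix U x assume "openin X U \<and> x \<in> U"
      then have "\<exists>V. (\<exists>\<T>. finite \<T> \<and> \<T> \<subseteq> \<S> \<and> V = topspace X \<inter> \<Inter>\<T>) \<and> x \<in> V \<and> V \<subseteq> U"
        using gen[unfolded openin_topology_base_unique rel] by simp
      then obtain V \<T> where "finite \<T>" "\<T> \<subseteq> \<S>" "V = topspace X \<inter> \<Inter>\<T>" "x \<in> V" "V \<subseteq> U"
        by (elim exE conjE)
      then show "\<exists>\<T>. finite \<T> \<and> \<T> \<subseteq> \<S> \<and> x \<in> \<Inter>\<T> \<and> topspace X \<inter> \<Inter>\<T> \<subseteq> U"
        by (intro exI[of _ \<T>]) simp
    qed
    ultimately show "?open \<and> ?basic"
      by (rule conjI)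
  next
    assume *: "?open \<and> ?basic"
    have "openin X = arbitrary union_of (finite intersection_of (\<lambda>U. U \<in> \<S>) relative_to topspace X)"
      unfolding openin_topology_base_unique rel
    proof (intro conjI allI impI)
      fix V assume "\<exists>\<T>. finite \<T> \<and> \<T> \<subseteq> \<S> \<and> V = topspace X \<inter> \<Inter>\<T>"
      then obtain \<T> where "finite \<T>" "\<T> \<subseteq> \<S>" "V = topspace X \<inter> \<Inter>\<T>"
        by (elim exE conjE)
      then show "openin X V"
        using fin[of \<T>] conjunct1[OF *] by simp
    next
      fix U x assume U: "openin X U \<and> x \<in> U"
      from *[THEN conjunct2, rule_format, OF U] obtain \<T>
        where \<T>: "finite \<T>" "\<T> \<subseteq> \<S>" "x \<in> \<Inter>\<T>" "topspace X \<inter> \<Inter>\<T> \<subseteq> U"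
        by (elim exE conjE)
      moreover have "x \<in> topspace X"
        using U openin_subset by blast
      ultimately show "\<exists>V. (\<exists>\<T>. finite \<T> \<and> \<T> \<subseteq> \<S> \<and> V = topspace X \<inter> \<Inter>\<T>) \<and> x \<in> V \<and> V \<subseteq> U"
        by (intro exI[of _ "topspace X \<inter> \<Inter>\<T>"]) auto
    qed
    moreover have "\<forall>S\<in>\<S>. S \<subseteq> topspace X"
      using openin_subset conjunct1[OF *] by blast
    ultimately show "subbase_of X \<S>"
      unfolding subbase_of_def by (intro conjI)
  qed
qed

text \<open>Finitely many members separate \<open>x\<close> from the compact complement of a neighbourhood of \<open>x\<close>.\<close>

lemma compact_subbaseI:
  assumes X: "compact_space X" and op: "\<And>S. S \<in> \<S> \<Longrightarrow> openin X S"
    and sep: "\<And>x y. x \<in> topspace X \<Longrightarrow> y \<in> topspace X \<Longrightarrow> x \<noteq> y \<Longrightarrow>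
      \<exists>S\<in>\<S>. \<exists>T\<in>\<S>. x \<in> S \<and> y \<in> T \<and> S \<inter> T = {}"
  shows "subbase_of X \<S>"
  unfolding subbase_of_iff
proof (intro conjI ballI allI impI)
  fix U x assume U: "openin X U \<and> x \<in> U"
  have x: "x \<in> topspace X"
    using U openin_subset by blast
  have K: "compactin X (topspace X - U)"
    using X U closedin_compact_space by blast
  have "\<forall>y\<in>topspace X - U. \<exists>S. S \<in> \<S> \<and> x \<in> S \<and> (\<exists>T. T \<in> \<S> \<and> y \<in> T \<and> S \<inter> T = {})"
  proof
    fix y assume "y \<in> topspace X - U"
    then show "\<exists>S. S \<in> \<S> \<and> x \<in> S \<and> (\<exists>T. T \<in> \<S> \<and> y \<in> T \<and> S \<inter> T = {})"
      using sep[OF x, of y] U by blast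
  qed
  from bchoice[OF this] obtain S
    where S: "\<forall>y\<in>topspace X - U. S y \<in> \<S> \<and> x \<in> S y \<and> (\<exists>T. T \<in> \<S> \<and> y \<in> T \<and> S y \<inter> T = {})" ..
  then have "\<forall>y\<in>topspace X - U. \<exists>T. T \<in> \<S> \<and> y \<in> T \<and> S y \<inter> T = {}"
    by blast
  from bchoice[OF this] obtain T
    where T: "\<forall>y\<in>topspace X - U. T y \<in> \<S> \<and> y \<in> T y \<and> S y \<inter> T y = {}" ..
  have "openin X (T y)" "y \<in> T y" if "y \<in> topspace X - U" for y
    using T op that by simp_all
  then obtain F where F: "finite F" "F \<subseteq> topspace X - U" "topspace X - U \<subseteq> (\<Union>y\<in>F. T y)"
    by (rule compactin_finite_cover[OF K])
  have "topspace X \<inter> \<Inter>(S ` F) \<subseteq> U"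
  proof
    fix z assume z: "z \<in> topspace X \<inter> \<Inter>(S ` F)"
    show "z \<in> U"
    proof (rule ccontr)
      assume "z \<notin> U"
      then obtain y where "y \<in> F" "z \<in> T y"
        using z F(3) by blast
      then show False
        using z T F(2) by blast
    qed
  qed
  moreover have "S ` F \<subseteq> \<S>" "x \<in> \<Inter>(S ` F)"
    using S F(2) by auto
  ultimately show "\<exists>\<T>. finite \<T> \<and> \<T> \<subseteq> \<S> \<and> x \<in> \<Inter>\<T> \<and> topspace X \<inter> \<Inter>\<T> \<subseteq> U"
    using F(1) by (intro exI[of _ "S ` F"]) simp
qed (rule op)

lemma
  assumes g: "continuous_map X euclideanreal g"
  shows zeroset_in_nonpositive: "zeroset_in X {x \<in> topspace X. g x \<le> 0}"
    and cozeroset_in_positive: "cozeroset_in X {x \<in> topspace X. 0 < g x}"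
proof -
  have cont: "continuous_map X (top_of_set {0..1}) (\<lambda>x. min 1 (max 0 (g x)))"
    unfolding continuous_map_in_subtopology
    using g by (auto intro!: continuous_map_real_min continuous_map_real_max)
  show "zeroset_in X {x \<in> topspace X. g x \<le> 0}"
    unfolding zeroset_in_def using cont
    by (intro exI[of _ "\<lambda>x. min 1 (max 0 (g x))"]) (auto simp: min_def max_def)
  show "cozeroset_in X {x \<in> topspace X. 0 < g x}"
    unfolding cozeroset_in_def using cont
    by (intro exI[of _ "\<lambda>x. min 1 (max 0 (g x))"]) (auto simp: min_def max_def)
qed

lemma zeroset_in_closedin:
  assumes "zeroset_in X Z"
  shows "closedin X Z"
proof -
  obtain f :: "'a \<Rightarrow> real"
    where f: "continuous_map X (top_of_set {0..1}) f" "Z = {x \<in> topspace X. f x = 0}"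
    using assms unfolding zeroset_in_def by blast
  have "closedin X {x \<in> topspace X. f x \<in> {0}}"
    using f(1) by (intro closedin_real_preimage) (auto dest: continuous_map_into_fulltopology)
  then show ?thesis
    unfolding f(2) by simp
qed

text \<open>The set at index \<open>2n - 1\<close> is the zero set \<open>F \<ge> 1/n\<close> and the one at \<open>2n\<close> is the cozero set
  \<open>F > 1/(n + 1)\<close>, for a function whose cozero set is represented.\<close>

definition level_representation :: "'a topology \<Rightarrow> ('a \<Rightarrow> real) \<Rightarrow> nat \<Rightarrow> 'a set" where
  "level_representation X F m =
     (if odd m then {x \<in> topspace X. 1 / real (m div 2 + 1) \<le> F x}
      else {x \<in> topspace X. 1 / real (m div 2 + 1) < F x})"

lemma U_representation_level_representation:
  assumes F: "continuous_map X euclideanreal F"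
  shows "U_representation X {x \<in> topspace X. 0 < F x} (level_representation X F)"
  unfolding U_representation_def
proof (intro conjI allI impI)
  show "{x \<in> topspace X. 0 < F x} = (\<Union>n\<in>{1..}. level_representation X F n)"
  proof (intro equalityI subsetI)
    fix x assume x: "x \<in> {x \<in> topspace X. 0 < F x}"
    then obtain n where "inverse (real (Suc n)) < F x"
      using reals_Archimedean by blast
    then have "x \<in> level_representation X F (2 * n + 1)"
      using x unfolding level_representation_def by (simp add: inverse_eq_divide)
    then show "x \<in> (\<Union>n\<in>{1..}. level_representation X F n)"
      by force
  next
    fix x assume "x \<in> (\<Union>n\<in>{1..}. level_representation X F n)"
    then obtain m where m: "x \<in> level_representation X F m"
      by blast
    define c where "c = 1 / real (m div 2 + 1)"
    have "0 < c"
      unfolding c_def by simp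
    then show "x \<in> {x \<in> topspace X. 0 < F x}"
      using m unfolding level_representation_def c_def[symmetric] by (auto split: if_splits)
  qed
  fix m :: nat
  show "level_representation X F m \<subseteq> level_representation X F (m + 1)"
  proof (cases "odd m")
    case True
    then obtain n where "m = 2 * n + 1"
      by (rule oddE)
    moreover have "1 / (2 + real n) < 1 / (1 + real n)"
      by (simp add: field_simps)
    ultimately show ?thesis
      unfolding level_representation_def by auto
  next
    case False
    then obtain n where "m = 2 * n"
      by blast
    then show ?thesis
      unfolding level_representation_def by auto
  qed
next
  fix n :: nat assume "n \<ge> 1"
  then obtain k where k: "n = Suc k"
    by (metis Suc_le_D One_nat_def)
  have "zeroset_in X {x \<in> topspace X. 1 / real (k + 1) - F x \<le> 0}"
    using F by (intro zeroset_in_nonpositive continuous_map_diff) auto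
  then show "zeroset_in X (level_representation X F (2 * n - 1))"
    unfolding level_representation_def k by simp
  have "cozeroset_in X {x \<in> topspace X. 0 < F x - 1 / real (n + 1)}"
    using F by (intro cozeroset_in_positive continuous_map_diff) auto
  then show "cozeroset_in X (level_representation X F (2 * n))"
    unfolding level_representation_def by simp
qed

lemma compact_subset_level:
  assumes X: "compact_space X" and F: "continuous_map X euclideanreal F"
    and K: "closedin X K" "\<And>x. x \<in> K \<Longrightarrow> 0 < F x"
  shows "\<exists>n\<ge>1. K \<subseteq> level_representation X F (2 * n - 1)"
proof -
  have "openin X {y \<in> topspace X. F x / 2 < F y}" "x \<in> {y \<in> topspace X. F x / 2 < F y}"
    if "x \<in> K" for x
    using openin_real_preimage[OF F open_greaterThan, of "F x / 2"] K(2)[OF that] that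
      subsetD[OF closedin_subset[OF K(1)], of x] by auto
  then obtain Z where Z: "finite Z" "Z \<subseteq> K" "K \<subseteq> (\<Union>x\<in>Z. {y \<in> topspace X. F x / 2 < F y})"
    by (rule compactin_finite_cover[OF closedin_compact_space[OF X K(1)]])
  have "\<forall>x\<in>Z. \<exists>n. inverse (real (Suc n)) < F x / 2"
  proof
    fix x assume "x \<in> Z"
    then have "0 < F x / 2"
      using K(2) Z(2) by auto
    then show "\<exists>n. inverse (real (Suc n)) < F x / 2"
      by (rule reals_Archimedean)
  qed
  from bchoice[OF this] obtain n where n: "\<forall>x\<in>Z. inverse (real (Suc (n x))) < F x / 2" ..
  define N where "N = Max (insert 0 (n ` Z))"
  have "K \<subseteq> level_representation X F (2 * Suc N - 1)"
  proof
    fix y assume "y \<in> K"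
    then obtain x where x: "x \<in> Z" "y \<in> topspace X" "F x / 2 < F y"
      using Z(3) by blast
    have "n x \<le> N"
      unfolding N_def using Z(1) x(1) by (intro Max_ge) auto
    then have "inverse (real (Suc N)) \<le> inverse (real (Suc (n x)))"
      by (intro le_imp_inverse_le) auto
    also have "\<dots> < F x / 2"
      using n x(1) by blast
    also have "\<dots> < F y"
      by (rule x(3))
    finally show "y \<in> level_representation X F (2 * Suc N - 1)"
      unfolding level_representation_def using x(2) by (simp add: inverse_eq_divide)
  qed
  then show ?thesis
    by (intro exI[of _ "Suc N"]) simp
qed

context unbounded_directed
begin

text \<open>The almost subbase consists of the sets \<open>f > q\<close> for rational \<open>q \<ge> 0\<close>. Several levels are taken for the
  sake of separation: if \<open>f b < q' < q < f a\<close>, then the closed set \<open>f \<ge> q\<close> lies in some \<open>U\<^sub>2\<^sub>n\<^sub>-\<^sub>1\<close> of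
  \<open>f > q'\<close>, so the complement of the latter is a neighbourhood of \<open>b\<close> disjoint from \<open>f > q\<close>.\<close>

lemma separating_family_imp_almost_subbase:
  assumes X: "compact_space X" "Hausdorff_space X"
    and L: "separating_family X (L :: 'p \<Rightarrow> _) {g. continuous_map X euclideanreal g}"
  shows "has_point_finite_almost_subbase TYPE('p) X"
proof -
  define v where "v = (\<lambda>(f :: 'a \<Rightarrow> real, q :: rat). {x \<in> topspace X. of_rat q < f x})"
  define D where "D p = L p \<times> {q::rat. 0 \<le> q \<and> to_nat q \<le> \<phi> p}" for p
  define \<alpha> where "\<alpha> = (\<Union>p. v ` D p)"
  have "mono D"
  proof (rule monoI)
    fix p q :: 'p assume "p \<le> q"
    then show "D p \<subseteq> D q"
      unfolding D_def using separating_family_mono[OF L, of p q] monoD[OF mono_\<phi>, of p q] by auto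
  qed
  then have mono: "mono (\<lambda>p. v ` D p)"
    by (simp add: mono_def image_mono)
  have fin: "finite {q::rat. 0 \<le> q \<and> to_nat q \<le> n}" for n
    by (rule finite_subset[OF _ finite_vimageI[OF finite_atMost[of n] inj_to_nat]]) auto
  have "point_finite X (v ` D p)" for p
    unfolding point_finite_def
  proof
    fix x assume x: "x \<in> topspace X"
    have "{C \<in> v ` D p. x \<in> C} \<subseteq> v ` ({f \<in> L p. f x \<noteq> 0} \<times> {q. 0 \<le> q \<and> to_nat q \<le> \<phi> p})"
    proof
      fix C assume "C \<in> {C \<in> v ` D p. x \<in> C}"
      then obtain f q where C: "C = v (f, q)" "f \<in> L p" "0 \<le> q" "to_nat q \<le> \<phi> p" "of_rat q < f x"
        unfolding D_def v_def by auto
      have "(0::real) \<le> of_rat q"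
        using C(3) by simp
      then have "0 < f x"
        using C(5) by (rule le_less_trans)
      then have "f x \<noteq> 0"
        by simp
      then show "C \<in> v ` ({f \<in> L p. f x \<noteq> 0} \<times> {q. 0 \<le> q \<and> to_nat q \<le> \<phi> p})"
        using C by blast
    qed
    then show "finite {C \<in> v ` D p. x \<in> C}"
      by (rule finite_subset)
        (intro finite_imageI finite_cartesian_product separating_family_finite[OF L x] fin)
  qed
  then have ordered: "ordered_property TYPE('p) (point_finite X) \<alpha>"
    unfolding ordered_property_def \<alpha>_def using mono by blast
  have "\<forall>V\<in>\<alpha>. \<exists>F. continuous_map X euclideanreal F \<and> V = {x \<in> topspace X. 0 < F x}"
  proof
    fix V assume "V \<in> \<alpha>"
    then obtain p f q where V: "f \<in> L p" "V = {x \<in> topspace X. of_rat q < f x}"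
      unfolding \<alpha>_def v_def D_def by auto
    have "continuous_map X euclideanreal (\<lambda>x. f x - of_rat q)"
      using separating_family_continuous[OF L V(1)] by (intro continuous_map_diff) auto
    then show "\<exists>F. continuous_map X euclideanreal F \<and> V = {x \<in> topspace X. 0 < F x}"
      unfolding V(2) by (intro exI[of _ "\<lambda>x. f x - of_rat q"]) simp
  qed
  from bchoice[OF this] obtain F
    where F: "\<forall>V\<in>\<alpha>. continuous_map X euclideanreal (F V) \<and> V = {x \<in> topspace X. 0 < F V x}" ..
  define U where "U V = level_representation X (F V)" for V
  have rep: "U_representation X V (U V)" if "V \<in> \<alpha>" for V
    using U_representation_level_representation[of X "F V"] F that unfolding U_def by metis
  have "subbase_of X (\<alpha> \<union> {topspace X - U V (2 * n - 1) |V n. V \<in> \<alpha> \<and> n \<ge> 1})"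
  proof (rule compact_subbaseI[OF X(1)])
    fix S assume "S \<in> \<alpha> \<union> {topspace X - U V (2 * n - 1) |V n. V \<in> \<alpha> \<and> n \<ge> 1}"
    then show "openin X S"
    proof
      assume S: "S \<in> \<alpha>"
      have "openin X {x \<in> topspace X. 0 < F S x}"
        using openin_real_preimage[of X "F S" "{0<..}"] F S by simp
      then show ?thesis
        using F S by simp
    next
      assume "S \<in> {topspace X - U V (2 * n - 1) |V n. V \<in> \<alpha> \<and> n \<ge> 1}"
      then show ?thesis
        using rep zeroset_in_closedin unfolding U_representation_def by blast
    qed
  next
    fix x y assume x: "x \<in> topspace X" and y: "y \<in> topspace X" and "x \<noteq> y"
    have "\<exists>p. \<exists>f\<in>L p. f x \<noteq> f y"
    proof (rule ccontr)
      assume "\<not> ?thesis"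
      then have eq: "g x = g y" if "continuous_map X euclideanreal g" for g
        using separating_family_separates[OF L x y, of g] that by blast
      have "completely_regular_space X"
        using X by (simp add: compact_Hausdorff_or_regular_imp_normal_space
            normal_imp_completely_regular_space_A Hausdorff_imp_t1_space)
      moreover have "closedin X {y}"
        using X(2) y by (simp add: closedin_Hausdorff_singleton)
      ultimately obtain g where g: "continuous_map X euclideanreal g" "g x = 0" "g y = 1"
        using completely_regular_separation[of X "{y}" x] x \<open>x \<noteq> y\<close> by blast
      then show False
        using eq[OF g(1)] by simp
    qed
    then obtain p f where f: "f \<in> L p" "f x \<noteq> f y"
      by blast
    let ?S = "\<alpha> \<union> {topspace X - U V (2 * n - 1) |V n. V \<in> \<alpha> \<and> n \<ge> 1}"
    have sep: "\<exists>S\<in>?S. \<exists>T\<in>?S. a \<in> S \<and> b \<in> T \<and> S \<inter> T = {}"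
      if a: "a \<in> topspace X" and b: "b \<in> topspace X" and less: "f b < f a" for a b
    proof -
      have b0: "0 \<le> f b"
        by (rule separating_family_nonneg[OF L f(1) b])
      obtain q where q: "f b < of_rat q" "of_rat q < f a"
        using of_rat_dense[OF less] by blast
      obtain q' where q': "f b < of_rat q'" "of_rat q' < (of_rat q :: real)"
        using of_rat_dense[OF q(1)] by blast
      have pos: "0 \<le> q" "0 \<le> q'"
        using b0 q q' by (metis less_eq_real_def of_rat_less_eq of_rat_0 order_trans)+
      have mem: "v (f, r) \<in> \<alpha>" if "0 \<le> r" for r
      proof -
        obtain p' where "p \<le> p'" "to_nat r \<le> \<phi> p'"
          using upper_bound2_index by blast
        then have "(f, r) \<in> D p'"
          unfolding D_def using f(1) that separating_family_mono[OF L] by blast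
        then show ?thesis
          unfolding \<alpha>_def by blast
      qed
      have "closedin X {x \<in> topspace X. of_rat q \<le> f x}"
        using closedin_real_preimage[OF separating_family_continuous[OF L f(1)] closed_atLeast] by simp
      moreover have "0 < F (v (f, q')) x" if "x \<in> {x \<in> topspace X. of_rat q \<le> f x}" for x
      proof -
        have "x \<in> v (f, q')"
          using that q'(2) unfolding v_def by auto
        then show ?thesis
          using F mem[OF pos(2)] by blast
      qed
      ultimately obtain n where n: "n \<ge> 1" "{x \<in> topspace X. of_rat q \<le> f x} \<subseteq> U (v (f, q')) (2 * n - 1)"
        using compact_subset_level[OF X(1), of "F (v (f, q'))" "{x \<in> topspace X. of_rat q \<le> f x}"]
          F mem[OF pos(2)] unfolding U_def by blast
      have sub: "U (v (f, q')) (2 * n - 1) \<subseteq> v (f, q')"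
        using rep[OF mem[OF pos(2)]] n(1) unfolding U_representation_def by force
      have "v (f, q) \<in> ?S"
        using mem[OF pos(1)] by (rule UnI1)
      moreover have "topspace X - U (v (f, q')) (2 * n - 1) \<in> ?S"
        using mem[OF pos(2)] n(1) by blast
      moreover have "a \<in> v (f, q)"
        unfolding v_def using a q(2) by simp
      moreover have "b \<notin> v (f, q')"
        unfolding v_def using q'(1) by simp
      then have "b \<in> topspace X - U (v (f, q')) (2 * n - 1)"
        using b sub by blast
      moreover have "v (f, q) \<inter> (topspace X - U (v (f, q')) (2 * n - 1)) = {}"
        using n(2) unfolding v_def by auto
      ultimately show ?thesis
        by (intro bexI[of _ "v (f, q)"] bexI[of _ "topspace X - U (v (f, q')) (2 * n - 1)"] conjI)
    qed
    show "\<exists>S\<in>?S. \<exists>T\<in>?S. x \<in> S \<and> y \<in> T \<and> S \<inter> T = {}"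
    proof (cases "f y < f x")
      case True
      then show ?thesis
        using sep[OF x y] by blast
    next
      case False
      then have "f x < f y"
        using f(2) by simp
      from sep[OF y x this] obtain S T where "S \<in> ?S" "T \<in> ?S" "y \<in> S" "x \<in> T" "S \<inter> T = {}"
        by (elim bexE conjE)
      then show ?thesis
        by (intro bexI[of _ T] bexI[of _ S] conjI) (simp_all add: Int_commute)
    qed
  qed
  then have "almost_subbase X \<alpha>"
    unfolding almost_subbase_def using rep by (intro exI[of _ U]) blast
  then show ?thesis
    using ordered unfolding has_point_finite_almost_subbase_def by blast
qed

end

section \<open>Bases from almost subbases\<close>

definition bounded_intersections :: "'a topology \<Rightarrow> 'a set set \<Rightarrow> nat \<Rightarrow> 'a set set" where
  "bounded_intersections X \<S> n =
     {topspace X \<inter> \<Inter>\<T> |\<T>. finite \<T> \<and> \<T> \<subseteq> \<S> \<and> card \<T> \<le> n}"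

lemma bounded_intersectionsI:
  "finite \<T> \<Longrightarrow> \<T> \<subseteq> \<S> \<Longrightarrow> card \<T> \<le> n \<Longrightarrow> topspace X \<inter> \<Inter>\<T> \<in> bounded_intersections X \<S> n"
  unfolding bounded_intersections_def by blast

lemma bounded_intersections_mono:
  assumes "\<S> \<subseteq> \<S>'" "m \<le> n"
  shows "bounded_intersections X \<S> m \<subseteq> bounded_intersections X \<S>' n"
proof
  fix B assume "B \<in> bounded_intersections X \<S> m"
  then obtain \<T> where "B = topspace X \<inter> \<Inter>\<T>" "finite \<T>" "\<T> \<subseteq> \<S>" "card \<T> \<le> m"
    unfolding bounded_intersections_def by blast
  then show "B \<in> bounded_intersections X \<S>' n"
    using assms by (auto intro!: bounded_intersectionsI)
qed

lemma no_bad_sequence_bounded_intersections: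
  assumes "no_bad_sequence \<S>"
  shows "no_bad_sequence (bounded_intersections X \<S> n)"
proof (induction n)
  case 0
  have "bounded_intersections X \<S> 0 \<subseteq> {topspace X}"
    unfolding bounded_intersections_def by auto
  then show ?case
    by (intro no_bad_sequence_finite) (simp add: finite_subset)
next
  case (Suc n)
  let ?I = "bounded_intersections X \<S>"
  have "?I (Suc n) \<subseteq> ?I n \<union> {A \<inter> B |A B. A \<in> \<S> \<and> B \<in> ?I n}"
  proof
    fix C assume "C \<in> ?I (Suc n)"
    then obtain \<T> where \<T>: "C = topspace X \<inter> \<Inter>\<T>" "finite \<T>" "\<T> \<subseteq> \<S>" "card \<T> \<le> Suc n"
      unfolding bounded_intersections_def by blast
    show "C \<in> ?I n \<union> {A \<inter> B |A B. A \<in> \<S> \<and> B \<in> ?I n}"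
    proof (cases "\<T> = {}")
      case True
      then have "C \<in> ?I n"
        unfolding \<T>(1) by (intro bounded_intersectionsI) auto
      then show ?thesis
        by (rule UnI1)
    next
      case False
      then obtain A where A: "A \<in> \<T>"
        by blast
      have "card (\<T> - {A}) \<le> n"
        using \<T>(2,4) A by simp
      then have "topspace X \<inter> \<Inter>(\<T> - {A}) \<in> ?I n"
        using \<T>(2,3) by (intro bounded_intersectionsI) auto
      moreover have "C = A \<inter> (topspace X \<inter> \<Inter>(\<T> - {A}))"
        unfolding \<T>(1) using A by blast
      moreover have "A \<in> \<S>"
        using A \<T>(3) by blast
      ultimately show ?thesis
        by (intro UnI2) blast
    qed
  qed
  then show ?case
    by (rule no_bad_sequence_subset[OF no_bad_sequence_Un[OF Suc no_bad_sequence_Int[OF assms Suc]]])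
qed

text \<open>A bad sequence would provide sets \<open>Z (V 0)\<close>, \<open>Z (V 1)\<close>, \<dots> with the finite intersection property,
  and a point common to all of them would lie in infinitely many members of a point finite family.\<close>

lemma no_bad_sequence_cozero_complements:
  assumes X: "compact_space X" and fin: "point_finite X \<C>"
    and closed: "\<And>V. V \<in> \<C> \<Longrightarrow> closedin X (Z V)" and sub: "\<And>V. V \<in> \<C> \<Longrightarrow> Z V \<subseteq> V"
  shows "no_bad_sequence {topspace X - Z V |V. V \<in> \<C>}"
  unfolding no_bad_sequence_def
proof (intro allI impI)
  fix A x assume *: "\<forall>n::nat. A n \<in> {topspace X - Z V |V. V \<in> \<C>} \<and> x n \<in> A n"
  then have "\<forall>n. \<exists>V. V \<in> \<C> \<and> A n = topspace X - Z V"
    by blast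
  from choice[OF this] obtain V where "\<forall>n. V n \<in> \<C> \<and> A n = topspace X - Z (V n)" ..
  then have V: "V n \<in> \<C>" "A n = topspace X - Z (V n)" "x n \<in> topspace X" "x n \<notin> Z (V n)" for n
    using * by auto
  show "\<exists>i j. i < j \<and> x j \<in> A i"
  proof (rule ccontr)
    assume "\<not> ?thesis"
    then have in_Z: "x j \<in> Z (V i)" if "i < j" for i j
      using that V(2,3) by blast
    have "\<Inter>(range (\<lambda>n. Z (V n))) \<noteq> {}"
    proof (rule compact_space_fip[THEN iffD1, rule_format, OF X], intro conjI allI impI ballI)
      show "closedin X C" if "C \<in> range (\<lambda>n. Z (V n))" for C
        using that closed V(1) by auto
      fix \<F> assume \<F>: "finite \<F> \<and> \<F> \<subseteq> range (\<lambda>n. Z (V n))"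
      then obtain N where N: "finite N" "\<F> = (\<lambda>n. Z (V n)) ` N"
        by (meson finite_subset_image)
      have "x (Suc (Max (insert 0 N))) \<in> Z (V n)" if "n \<in> N" for n
        using N(1) that by (intro in_Z) (simp add: le_imp_less_Suc)
      then show "\<Inter>\<F> \<noteq> {}"
        unfolding N(2) by blast
    qed
    then obtain y where y: "\<And>n. y \<in> Z (V n)"
      by blast
    have "inj V"
    proof (rule linorder_injI)
      fix i j :: nat assume "i < j"
      show "V i \<noteq> V j"
        using in_Z[OF \<open>i < j\<close>] V(4)[of j] by metis
    qed
    then have "infinite (range V)"
      by (rule range_inj_infinite)
    moreover have "range V \<subseteq> {C \<in> \<C>. y \<in> C}"
      using V(1) y sub by blast
    moreover have "y \<in> topspace X"
      using y closed[OF V(1)] closedin_subset by blast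
    then have "finite {C \<in> \<C>. y \<in> C}"
      using fin unfolding point_finite_def by simp
    ultimately show False
      using finite_subset by metis
  qed
qed

context unbounded_directed
begin

text \<open>The complements of the zero sets are not point finite, but those that come from one level \<open>C p\<close> and
  finitely many \<open>n\<close> have no bad sequence. Intersections of a bounded number of sets preserve this, and
  \<open>\<phi> p\<close> bounds both \<open>n\<close> and the number of sets.\<close>

lemma almost_subbase_imp_base:
  assumes X: "compact_space X" and ex: "has_point_finite_almost_subbase TYPE('p) X"
  shows "has_point_additively_Noetherian_base TYPE('p) X"
proof -
  obtain \<alpha> where \<alpha>: "almost_subbase X \<alpha>" "ordered_property TYPE('p) (point_finite X) \<alpha>"
    using ex unfolding has_point_finite_almost_subbase_def by blast
  from \<alpha>(1) obtain U where "\<forall>V\<in>\<alpha>. U_representation X V (U V)"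
    and sub: "subbase_of X (\<alpha> \<union> {topspace X - U V (2 * n - 1) |V n. V \<in> \<alpha> \<and> n \<ge> 1})"
    unfolding almost_subbase_def by (elim exE conjE)
  then have U: "U_representation X V (U V)" if "V \<in> \<alpha>" for V
    using that by simp
  from \<alpha>(2) obtain C where C: "mono (C :: 'p \<Rightarrow> _)" "\<alpha> = (\<Union>p. C p)" "\<forall>p. point_finite X (C p)"
    unfolding ordered_property_def by (elim exE conjE)
  define N where "N p n = {topspace X - U V (2 * n - 1) |V. V \<in> C p}" for p n
  define \<sigma> where "\<sigma> p = C p \<union> (\<Union>n\<in>{1..\<phi> p}. N p n)" for p
  define \<B> where "\<B> p = bounded_intersections X (\<sigma> p) (\<phi> p)" for p
  have C_sub: "C p \<subseteq> \<alpha>" for p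
    unfolding C(2) by blast
  have mono_C: "C p \<subseteq> C q" if "p \<le> q" for p q
    using monoD[OF C(1) that] .
  have mono_\<sigma>: "\<sigma> p \<subseteq> \<sigma> q" if "p \<le> q" for p q
  proof -
    have "N p n \<subseteq> N q n" for n
      unfolding N_def using mono_C[OF that] by blast
    moreover have "{1..\<phi> p} \<subseteq> {1..\<phi> q}"
      using monoD[OF mono_\<phi> that] by auto
    ultimately have "(\<Union>n\<in>{1..\<phi> p}. N p n) \<subseteq> (\<Union>n\<in>{1..\<phi> q}. N q n)"
      by (intro UN_mono)
    then show ?thesis
      unfolding \<sigma>_def using mono_C[OF that] by blast
  qed
  have mono_\<B>: "mono \<B>"
  proof (rule monoI)
    fix p q :: 'p assume "p \<le> q"
    then show "\<B> p \<subseteq> \<B> q"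
      unfolding \<B>_def using monoD[OF mono_\<phi>] by (intro bounded_intersections_mono mono_\<sigma>)
  qed
  have good_\<sigma>: "no_bad_sequence {S \<in> \<sigma> p. x \<in> S}" if x: "x \<in> topspace X" for p x
  proof -
    have "no_bad_sequence (N p n)" if "n \<in> {1..\<phi> p}" for n
      unfolding N_def
    proof (rule no_bad_sequence_cozero_complements[OF X C(3)[rule_format]])
      fix V assume "V \<in> C p"
      then have rep: "U_representation X V (U V)"
        using C_sub U by blast
      then show "closedin X (U V (2 * n - 1))"
        using that unfolding U_representation_def by (intro zeroset_in_closedin) simp
      have "2 * n - 1 \<in> {1..}"
        using that by auto
      moreover have "V = (\<Union>m\<in>{1..}. U V m)"
        using rep unfolding U_representation_def by (rule conjunct1)
      ultimately show "U V (2 * n - 1) \<subseteq> V"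
        by blast
    qed
    then have "no_bad_sequence (\<Union>n\<in>{1..\<phi> p}. N p n)"
      by (intro no_bad_sequence_UN) auto
    moreover have "no_bad_sequence {S \<in> C p. x \<in> S}"
      using C(3)[rule_format, of p] x unfolding point_finite_def by (intro no_bad_sequence_finite) simp
    ultimately have "no_bad_sequence ({S \<in> C p. x \<in> S} \<union> (\<Union>n\<in>{1..\<phi> p}. N p n))"
      by (intro no_bad_sequence_Un)
    then show ?thesis
      by (rule no_bad_sequence_subset) (auto simp: \<sigma>_def)
  qed
  have "point_additively_Noetherian X (\<B> p)" for p
    unfolding point_additively_Noetherian_def additively_Noetherian_iff_no_bad_sequence
  proof
    fix x assume x: "x \<in> topspace X"
    have "{B \<in> \<B> p. x \<in> B} \<subseteq> bounded_intersections X {S \<in> \<sigma> p. x \<in> S} (\<phi> p)"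
    proof
      fix B assume B: "B \<in> {B \<in> \<B> p. x \<in> B}"
      then obtain \<T> where "B = topspace X \<inter> \<Inter>\<T>" "finite \<T>" "\<T> \<subseteq> \<sigma> p" "card \<T> \<le> \<phi> p"
        unfolding \<B>_def bounded_intersections_def by blast
      then show "B \<in> bounded_intersections X {S \<in> \<sigma> p. x \<in> S} (\<phi> p)"
        using B by (auto intro!: bounded_intersectionsI)
    qed
    then show "no_bad_sequence {B \<in> \<B> p. x \<in> B}"
      using no_bad_sequence_bounded_intersections[OF good_\<sigma>[OF x]]
      by (rule no_bad_sequence_subset[rotated])
  qed
  moreover have "base_of X (\<Union>p. \<B> p)"
    unfolding base_of_iff
  proof (intro conjI ballI allI impI)
    let ?S = "\<alpha> \<union> {topspace X - U V (2 * n - 1) |V n. V \<in> \<alpha> \<and> n \<ge> 1}"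
    have \<sigma>_sub: "\<sigma> p \<subseteq> ?S" for p
    proof
      fix S assume "S \<in> \<sigma> p"
      then show "S \<in> ?S"
        unfolding \<sigma>_def N_def using C_sub[of p] by auto
    qed
    have op: "openin X S" if "S \<in> ?S" for S
      using sub that unfolding subbase_of_iff by simp
    fix B assume "B \<in> (\<Union>p. \<B> p)"
    then obtain p \<T> where \<T>: "B = topspace X \<inter> \<Inter>\<T>" "finite \<T>" "\<T> \<subseteq> \<sigma> p"
      unfolding \<B>_def bounded_intersections_def by blast
    have "openin X (topspace X \<inter> \<Inter>\<T>)"
    proof (cases "\<T> = {}")
      case False
      have "openin X (\<Inter>\<T>)"
        using \<T>(2) False
      proof (rule openin_Inter)
        fix S assume "S \<in> \<T>"
        then show "openin X S"
          using \<T>(3) \<sigma>_sub by (intro op) blast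
      qed
      then show ?thesis
        by blast
    qed simp
    then show "openin X B"
      unfolding \<T>(1) .
  next
    let ?S = "\<alpha> \<union> {topspace X - U V (2 * n - 1) |V n. V \<in> \<alpha> \<and> n \<ge> 1}"
    fix O' x assume O': "openin X O' \<and> x \<in> O'"
    then obtain \<T> where \<T>: "finite \<T>" "\<T> \<subseteq> ?S" "x \<in> \<Inter>\<T>" "topspace X \<inter> \<Inter>\<T> \<subseteq> O'"
      using conjunct2[OF sub[unfolded subbase_of_iff], rule_format, OF O'] by (elim exE conjE)
    have in_\<sigma>: "\<exists>p. S \<in> \<sigma> p" if "S \<in> ?S" for S
      using that
    proof
      assume "S \<in> \<alpha>"
      then show ?thesis
        unfolding C(2) \<sigma>_def by blast
    next
      assume "S \<in> {topspace X - U V (2 * n - 1) |V n. V \<in> \<alpha> \<and> n \<ge> 1}"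
      then obtain V n p where S: "S = topspace X - U V (2 * n - 1)" "V \<in> C p" "n \<ge> 1"
        unfolding C(2) by blast
      obtain q where q: "p \<le> q" "n \<le> \<phi> q"
        using upper_bound2_index by blast
      have "S \<in> N q n"
        unfolding N_def using S(1,2) mono_C[OF q(1)] by blast
      moreover have "n \<in> {1..\<phi> q}"
        using S(3) q(2) by simp
      ultimately show ?thesis
        unfolding \<sigma>_def by blast
    qed
    have "\<forall>S\<in>\<T>. \<exists>p. S \<in> \<sigma> p"
      by (intro ballI in_\<sigma> subsetD[OF \<T>(2)])
    from bchoice[OF this] obtain P where P: "\<forall>S\<in>\<T>. S \<in> \<sigma> (P S)" ..
    obtain q where q: "\<And>p. p \<in> P ` \<T> \<Longrightarrow> p \<le> q"
      using finite_upper_bound[of "P ` \<T>"] \<T>(1) by blast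
    obtain r where r: "q \<le> r" "card \<T> \<le> \<phi> r"
      using upper_bound2_index by blast
    have "\<T> \<subseteq> \<sigma> r"
    proof
      fix S assume S: "S \<in> \<T>"
      have "P S \<le> r"
        using q[of "P S"] S r(1) order_trans by blast
      then show "S \<in> \<sigma> r"
        using P S mono_\<sigma> by blast
    qed
    then have "topspace X \<inter> \<Inter>\<T> \<in> \<B> r"
      unfolding \<B>_def using \<T>(1) r(2) by (intro bounded_intersectionsI)
    moreover have "x \<in> topspace X \<inter> \<Inter>\<T>"
      using O' \<T>(3) openin_subset by blast
    ultimately show "\<exists>B\<in>(\<Union>p. \<B> p). x \<in> B \<and> B \<subseteq> O'"
      using \<T>(4) by blast
  qed
  ultimately show ?thesis
    unfolding has_point_additively_Noetherian_base_def ordered_property_def using mono_\<B>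
    by (intro exI[of _ "\<Union>p. \<B> p"] conjI exI[of _ \<B>]) simp_all
qed

end

section \<open>Networks and their continuous images\<close>

lemma base_imp_expandable_network:
  assumes "has_point_additively_Noetherian_base TYPE('p::order) X"
  shows "has_point_additively_Noetherian_expandable_network TYPE('p) X"
proof -
  obtain \<B> and C :: "'p \<Rightarrow> _" where base: "base_of X \<B>" and C: "mono C" "\<B> = (\<Union>p. C p)"
    and good: "\<And>p. point_additively_Noetherian X (C p)"
    using assms unfolding has_point_additively_Noetherian_base_def ordered_property_def by blast
  define D where "D p = (\<lambda>B. (B, B)) ` C p" for p
  have "fst ` {(N, V) \<in> D p. x \<in> V} = {B \<in> C p. x \<in> B}" for p x
    unfolding D_def by force
  then have "point_additively_Noetherian_pairs X (D p)" for p
    using good[of p] unfolding point_additively_Noetherian_pairs_def point_additively_Noetherian_def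
    by simp
  moreover have "mono D"
    unfolding D_def using C(1) by (simp add: mono_def image_mono)
  ultimately have "ordered_property TYPE('p) (point_additively_Noetherian_pairs X) (\<Union>p. D p)"
    unfolding ordered_property_def by blast
  moreover have "expandable_network X (\<Union>p. D p)"
    using base unfolding base_of_iff expandable_network_def D_def C(2) by auto
  ultimately show ?thesis
    unfolding has_point_additively_Noetherian_expandable_network_def by blast
qed

lemma base_imp_strong_point_network:
  assumes "has_point_additively_Noetherian_base TYPE('p::order) X"
  shows "has_strong_point_network TYPE('p) additively_Noetherian X"
proof -
  obtain \<B> and C :: "'p \<Rightarrow> _" where base: "base_of X \<B>" and C: "mono C" "\<B> = (\<Union>p. C p)"
    and good: "\<And>p. point_additively_Noetherian X (C p)"
    using assms unfolding has_point_additively_Noetherian_base_def ordered_property_def by blast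
  have op: "openin X B" if "B \<in> C p" for B p
    using base that unfolding base_of_iff C(2) by blast
  have "ordered_point_collections additively_Noetherian X (\<lambda>p x. {B \<in> C p. x \<in> B})"
    unfolding ordered_point_collections_def
  proof (intro ballI conjI allI)
    fix x assume x: "x \<in> topspace X"
    show "mono (\<lambda>p. {B \<in> C p. x \<in> B})"
    proof (rule monoI)
      fix p q :: 'p assume "p \<le> q"
      then show "{B \<in> C p. x \<in> B} \<subseteq> {B \<in> C q. x \<in> B}"
        using monoD[OF C(1)] by blast
    qed
    show "additively_Noetherian {B \<in> C p. x \<in> B}" for p
      using good[of p] x unfolding point_additively_Noetherian_def by blast
    show "x \<in> A" "A \<subseteq> topspace X" if "A \<in> {B \<in> C p. x \<in> B}" for p A
      using that openin_subset[OF op] by blast+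
  qed
  moreover have "\<exists>V p. openin X V \<and> x \<in> V \<and> V \<subseteq> U \<and>
      (\<forall>y\<in>V. \<exists>A\<in>{B \<in> C p. y \<in> B}. x \<in> A \<and> A \<subseteq> V)" if U: "openin X U \<and> x \<in> U" for U x
  proof -
    obtain B where B: "B \<in> \<B>" "x \<in> B" "B \<subseteq> U"
      using conjunct2[OF base[unfolded base_of_iff], rule_format, OF U] by blast
    then obtain p where "B \<in> C p"
      unfolding C(2) by blast
    then show ?thesis
      using B op by (intro exI[of _ B] exI[of _ p]) blast
  qed
  ultimately show ?thesis
    unfolding has_strong_point_network_def
    by (intro exI[of _ "\<lambda>p x. {B \<in> C p. x \<in> B}"]) simp
qed

lemma strong_point_network_imp_point_network:
  assumes "has_strong_point_network TYPE('p::order) Q X"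
  shows "has_point_network TYPE('p) Q X"
proof -
  obtain W :: "'p \<Rightarrow> 'a \<Rightarrow> 'a set set" where W: "ordered_point_collections Q X W"
    and net: "\<forall>x U. openin X U \<and> x \<in> U \<longrightarrow>
      (\<exists>V p. openin X V \<and> x \<in> V \<and> V \<subseteq> U \<and> (\<forall>y\<in>V. \<exists>A \<in> W p y. x \<in> A \<and> A \<subseteq> V))"
    using assms unfolding has_strong_point_network_def by blast
  have "\<exists>V p. openin X V \<and> x \<in> V \<and> V \<subseteq> U \<and> (\<forall>y\<in>V. \<exists>A \<in> W p y. x \<in> A \<and> A \<subseteq> U)"
    if U: "openin X U \<and> x \<in> U" for x U
  proof -
    from net[rule_format, OF U] obtain V p
      where V: "openin X V" "x \<in> V" "V \<subseteq> U" "\<forall>y\<in>V. \<exists>A \<in> W p y. x \<in> A \<and> A \<subseteq> V"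
      by (elim exE conjE)
    then have "\<forall>y\<in>V. \<exists>A \<in> W p y. x \<in> A \<and> A \<subseteq> U"
      by (meson order_trans)
    then show ?thesis
      using V by (intro exI[of _ V] exI[of _ p]) simp
  qed
  then show ?thesis
    unfolding has_point_network_def using W by (intro exI[of _ W]) simp
qed

text \<open>At \<open>y\<close> take the sets \<open>N\<close> of the pairs \<open>(N, V)\<close> with \<open>y \<in> V\<close>, with \<open>y\<close> added: the role of \<open>V\<close> is exactly
  to offer \<open>N\<close> to all points near \<open>x\<close>.\<close>

lemma expandable_network_imp_point_network:
  assumes "has_point_additively_Noetherian_expandable_network TYPE('p::order) X"
  shows "has_point_network TYPE('p) additively_Noetherian X"
proof -
  obtain \<N> and C :: "'p \<Rightarrow> _" where net: "expandable_network X \<N>" and C: "mono C" "\<N> = (\<Union>p. C p)"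
    and good: "\<And>p. point_additively_Noetherian_pairs X (C p)"
    using assms unfolding has_point_additively_Noetherian_expandable_network_def ordered_property_def
    by blast
  define W where "W p x = insert x ` fst ` {(N, V) \<in> C p. x \<in> V}" for p x
  have op: "N \<subseteq> V" "openin X V" if "(N, V) \<in> C p" for N V p
    using net that unfolding expandable_network_def C(2) by blast+
  have "ordered_point_collections additively_Noetherian X W"
    unfolding ordered_point_collections_def
  proof (intro ballI conjI allI)
    fix x assume x: "x \<in> topspace X"
    show "mono (\<lambda>p. W p x)"
    proof (rule monoI)
      fix p q :: 'p assume "p \<le> q"
      then have "{(N, V) \<in> C p. x \<in> V} \<subseteq> {(N, V) \<in> C q. x \<in> V}"
        using monoD[OF C(1)] by blast
      then show "W p x \<subseteq> W q x"
        unfolding W_def by (intro image_mono)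
    qed
    show "additively_Noetherian (W p x)" for p
      using good[of p] x
      unfolding W_def point_additively_Noetherian_pairs_def additively_Noetherian_iff_no_bad_sequence
      by (intro no_bad_sequence_insert_point) blast
    fix p A assume "A \<in> W p x"
    then obtain N V where NV: "(N, V) \<in> C p" "x \<in> V" "A = insert x N"
      unfolding W_def by auto
    show "x \<in> A" "A \<subseteq> topspace X"
      unfolding NV(3) using x op(1)[OF NV(1)] openin_subset[OF op(2)[OF NV(1)]] by auto
  qed
  moreover have "\<exists>V p. openin X V \<and> x \<in> V \<and> V \<subseteq> U \<and> (\<forall>y\<in>V. \<exists>A \<in> W p y. x \<in> A \<and> A \<subseteq> U)"
    if U: "openin X U \<and> x \<in> U" for x U
  proof -
    have "\<exists>(N, V)\<in>\<N>. x \<in> N \<and> N \<subseteq> U"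
      using net U unfolding expandable_network_def by blast
    then obtain N V p where NV: "(N, V) \<in> C p" "x \<in> N" "N \<subseteq> U"
      unfolding C(2) by blast
    have "\<exists>A \<in> W p y. x \<in> A \<and> A \<subseteq> U" if "y \<in> V \<inter> U" for y
    proof
      have "N \<in> fst ` {(N, V) \<in> C p. y \<in> V}"
        using NV(1) that by force
      then show "insert y N \<in> W p y"
        unfolding W_def by blast
      show "x \<in> insert y N \<and> insert y N \<subseteq> U"
        using NV that by blast
    qed
    moreover have "openin X (V \<inter> U)" "x \<in> V \<inter> U"
      using op[OF NV(1)] U NV(2) by auto
    ultimately show ?thesis
      by (intro exI[of _ "V \<inter> U"] exI[of _ p]) simp
  qed
  ultimately show ?thesis
    unfolding has_point_network_def by (intro exI[of _ W]) simp
qed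

context unbounded_directed
begin

lemma point_network_imp_separating_family:
  assumes "compact_space X" "Hausdorff_space X"
    and "has_point_network TYPE('p) additively_Noetherian X"
  shows "\<exists>L :: 'p \<Rightarrow> _. separating_family X L {g. continuous_map X euclideanreal g}"
proof -
  obtain W :: "'p \<Rightarrow> 'a \<Rightarrow> 'a set set" where W: "ordered_point_collections additively_Noetherian X W"
    and net: "\<forall>x U. openin X U \<and> x \<in> U \<longrightarrow>
      (\<exists>V p. openin X V \<and> x \<in> V \<and> V \<subseteq> U \<and> (\<forall>y\<in>V. \<exists>A \<in> W p y. x \<in> A \<and> A \<subseteq> U))"
    using assms(3) unfolding has_point_network_def by blast
  interpret compact_point_network \<phi> X W
  proof
    show "W p x \<subseteq> W q x" if "x \<in> topspace X" "p \<le> q" for x p q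
      using W that unfolding ordered_point_collections_def mono_def by blast
    show "no_bad_sequence (W p x)" if "x \<in> topspace X" for x p
      using W that unfolding ordered_point_collections_def additively_Noetherian_iff_no_bad_sequence
      by blast
    show "\<exists>V p. openin X V \<and> x \<in> V \<and> V \<subseteq> U \<and> (\<forall>y\<in>V. \<exists>A \<in> W p y. x \<in> A \<and> A \<subseteq> U)"
      if "openin X U" "x \<in> U" for x U
      using net that by simp
  qed (rule assms(1,2))+
  show ?thesis
    by (rule ex_separating_family)
qed

text \<open>The fibre of \<open>z\<close> is compact, so finitely many neighbourhoods \<open>V x\<close> provided by the network cover it,
  with a common label. Their union contains the fibres of all points near \<open>z\<close>, because \<open>f\<close> is closed. For
  such a point the chosen representative lies in one of the \<open>V x\<close>, and the network set there contains
  \<open>x\<close>, a point of the fibre of \<open>z\<close>.\<close>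

lemma continuous_image_point_network:
  assumes X: "compact_space X" and Y: "Hausdorff_space Y"
    and f: "continuous_map X Y f" "f ` topspace X = topspace Y"
    and ex: "has_point_network TYPE('p) additively_Noetherian X"
  shows "has_point_network TYPE('p) additively_Noetherian Y"
proof -
  obtain W :: "'p \<Rightarrow> 'a \<Rightarrow> 'a set set" where W: "ordered_point_collections additively_Noetherian X W"
    and net: "\<forall>x U. openin X U \<and> x \<in> U \<longrightarrow>
      (\<exists>V p. openin X V \<and> x \<in> V \<and> V \<subseteq> U \<and> (\<forall>y\<in>V. \<exists>A \<in> W p y. x \<in> A \<and> A \<subseteq> U))"
    using ex unfolding has_point_network_def by blast
  have mono_W: "W p x \<subseteq> W q x" if "x \<in> topspace X" "p \<le> q" for x p q
    using W that unfolding ordered_point_collections_def mono_def by blast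
  have good_W: "no_bad_sequence (W p x)" if "x \<in> topspace X" for x p
    using W that unfolding ordered_point_collections_def additively_Noetherian_iff_no_bad_sequence
    by blast
  have in_W: "x \<in> A" "A \<subseteq> topspace X" if "x \<in> topspace X" "A \<in> W p x" for x p A
    using W that unfolding ordered_point_collections_def by blast+
  have closed_f: "closed_map X Y f"
    using X Hausdorff_imp_kc_space[OF Y] f(1) by (rule continuous_imp_closed_map_gen)
  have "\<forall>z\<in>topspace Y. \<exists>x. x \<in> topspace X \<and> f x = z"
    using f(2) by (metis imageE)
  from bchoice[OF this] obtain s where s: "\<forall>z\<in>topspace Y. s z \<in> topspace X \<and> f (s z) = z" ..
  define W' where "W' p z = (`) f ` W p (s z)" for p z
  have "ordered_point_collections additively_Noetherian Y W'"
    unfolding ordered_point_collections_def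
  proof (intro ballI conjI allI)
    fix z assume z: "z \<in> topspace Y"
    then have sz: "s z \<in> topspace X" "f (s z) = z"
      using s by simp_all
    show "mono (\<lambda>p. W' p z)"
      unfolding W'_def using mono_W[OF sz(1)] by (intro monoI image_mono)
    show "additively_Noetherian (W' p z)" for p
      unfolding W'_def additively_Noetherian_iff_no_bad_sequence
      by (intro no_bad_sequence_image good_W sz)
    fix p A assume "A \<in> W' p z"
    then obtain A' where A': "A' \<in> W p (s z)" "A = f ` A'"
      unfolding W'_def by blast
    note sA = in_W[OF sz(1) A'(1)]
    show "z \<in> A"
      unfolding A'(2) using imageI[OF sA(1), of f] sz(2) by simp
    show "A \<subseteq> topspace Y"
      unfolding A'(2) f(2)[symmetric] using sA(2) by (rule image_mono)
  qed
  moreover have "\<exists>V p. openin Y V \<and> z \<in> V \<and> V \<subseteq> U \<and> (\<forall>y\<in>V. \<exists>A \<in> W' p y. z \<in> A \<and> A \<subseteq> U)"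
    if U: "openin Y U \<and> z \<in> U" for z U
  proof -
    let ?P = "{x \<in> topspace X. f x \<in> U}" and ?F = "{x \<in> topspace X. f x \<in> {z}}"
    have z: "z \<in> topspace Y"
      using U openin_subset by blast
    have P: "openin X ?P"
      using openin_continuous_map_preimage[OF f(1)] U by blast
    have "closedin X ?F"
      using f(1) closedin_Hausdorff_singleton[OF Y z] by (rule closedin_continuous_map_preimage)
    then have F: "compactin X ?F"
      using X closedin_compact_space by blast
    have "\<forall>x\<in>?F. \<exists>V. openin X V \<and> x \<in> V \<and> V \<subseteq> ?P \<and> (\<exists>p. \<forall>y\<in>V. \<exists>A \<in> W p y. x \<in> A \<and> A \<subseteq> ?P)"
    proof
      fix x assume "x \<in> ?F"
      then have "openin X ?P \<and> x \<in> ?P"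
        using P U by auto
      from net[rule_format, OF this]
      show "\<exists>V. openin X V \<and> x \<in> V \<and> V \<subseteq> ?P \<and> (\<exists>p. \<forall>y\<in>V. \<exists>A \<in> W p y. x \<in> A \<and> A \<subseteq> ?P)"
        by (elim exE conjE) (intro exI conjI)
    qed
    from bchoice[OF this] obtain V where V: "\<forall>x\<in>?F. openin X (V x) \<and> x \<in> V x \<and> V x \<subseteq> ?P \<and>
        (\<exists>p. \<forall>y\<in>V x. \<exists>A \<in> W p y. x \<in> A \<and> A \<subseteq> ?P)" ..
    then have "\<forall>x\<in>?F. \<exists>p. \<forall>y\<in>V x. \<exists>A \<in> W p y. x \<in> A \<and> A \<subseteq> ?P"
      by simp
    from bchoice[OF this] obtain p where p: "\<forall>x\<in>?F. \<forall>y\<in>V x. \<exists>A \<in> W (p x) y. x \<in> A \<and> A \<subseteq> ?P" ..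
    have "openin X (V x)" "x \<in> V x" if "x \<in> ?F" for x
      using V that by simp_all
    then obtain E where E: "finite E" "E \<subseteq> ?F" "?F \<subseteq> (\<Union>x\<in>E. V x)"
      by (rule compactin_finite_cover[OF F])
    obtain q where q: "\<And>r. r \<in> p ` E \<Longrightarrow> r \<le> q"
      using finite_upper_bound[of "p ` E"] E(1) by blast
    let ?G = "\<Union>x\<in>E. V x"
    define V' where "V' = topspace Y - f ` (topspace X - ?G)"
    have "openin X ?G"
      using V E(2) by blast
    then have "closedin Y (f ` (topspace X - ?G))"
      using closed_f unfolding closed_map_def by blast
    then have "openin Y V'"
      unfolding V'_def by blast
    have "z \<in> V'"
      unfolding V'_def using z E(3) by blast
    have V'_fibre: "y \<in> topspace Y \<and> s y \<in> ?G" if y: "y \<in> V'" for y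
    proof
      show yY: "y \<in> topspace Y"
        using y unfolding V'_def by (rule DiffD1)
      show "s y \<in> ?G"
      proof (rule ccontr)
        assume "s y \<notin> ?G"
        then have "f (s y) \<in> f ` (topspace X - ?G)"
          using s yY by (intro imageI) simp
        then show False
          using s yY y unfolding V'_def by simp
      qed
    qed
    have "V' \<subseteq> U"
    proof
      fix y assume "y \<in> V'"
      then obtain x where x: "y \<in> topspace Y" "x \<in> E" "s y \<in> V x"
        using V'_fibre by blast
      then have "V x \<subseteq> ?P"
        using V subsetD[OF E(2) x(2)] by simp
      then have "f (s y) \<in> U"
        using x(3) by blast
      then show "y \<in> U"
        using s x(1) by simp
    qed
    moreover have "\<exists>A \<in> W' q y. z \<in> A \<and> A \<subseteq> U" if y: "y \<in> V'" for y
    proof -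
      obtain x where x: "x \<in> E" "s y \<in> V x" and yY: "y \<in> topspace Y"
        using V'_fibre[OF y] by blast
      have xF: "x \<in> ?F"
        using x(1) E(2) by blast
      from bspec[OF bspec[OF p xF] x(2)] obtain A where A: "A \<in> W (p x) (s y)" "x \<in> A" "A \<subseteq> ?P"
        by (elim bexE conjE)
      have "W (p x) (s y) \<subseteq> W q (s y)"
        using s yY q x(1) by (intro mono_W) auto
      then have "f ` A \<in> W' q y"
        unfolding W'_def using A(1) by blast
      moreover have "z \<in> f ` A"
        using A(2) xF by (metis (mono_tags, lifting) image_eqI mem_Collect_eq singletonD)
      moreover have "f ` A \<subseteq> U"
        using A(3) by blast
      ultimately show ?thesis
        by blast
    qed
    moreover note \<open>openin Y V'\<close> \<open>z \<in> V'\<close>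
    ultimately show ?thesis
      by (intro exI[of _ V'] exI[of _ q]) simp
  qed
  ultimately show ?thesis
    unfolding has_point_network_def by (intro exI[of _ W']) simp
qed

end

section \<open>Embeddings in function spaces\<close>

lemma continuous_map_Cp_iff:
  "continuous_map X (Cp Z) e \<longleftrightarrow>
     (\<forall>x\<in>topspace X. e x \<in> extensional (topspace Z) \<and> continuous_map Z euclideanreal (e x)) \<and>
     (\<forall>z\<in>topspace Z. continuous_map X euclideanreal (\<lambda>x. e x z))"
  unfolding Cp_def continuous_map_in_subtopology continuous_map_componentwise by auto

lemma Hausdorff_Cp: "Hausdorff_space (Cp Z)"
  unfolding Cp_def by (intro Hausdorff_space_subtopology) (simp add: Hausdorff_space_product_topology)

text \<open>A compact set is covered by a neighbourhood of \<open>\<ast>\<close> on which \<open>h\<close> is nearly constant and finitely many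
  isolated points.\<close>

lemma finite_far_from_None:
  assumes F: "F \<le> principal S" and h: "continuous_map (filter_space S F) euclideanreal h"
    and K: "compactin (filter_space S F) K" and \<epsilon>: "0 < (\<epsilon>::real)"
  shows "finite {s. Some s \<in> K \<and> \<epsilon> \<le> \<bar>h (Some s) - h None\<bar>}"
proof -
  let ?Z = "filter_space S F"
  define U where "U = {w \<in> topspace ?Z. \<bar>h w - h None\<bar> < \<epsilon>}"
  define \<U> where "\<U> = insert U ((\<lambda>s. {Some s}) ` S)"
  have "\<exists>\<F>. finite \<F> \<and> \<F> \<subseteq> \<U> \<and> K \<subseteq> \<Union>\<F>"
  proof (rule compactinD[OF K])
    fix V assume "V \<in> \<U>"
    then show "openin ?Z V"
      unfolding \<U>_def using openin_near[OF h] by (auto simp: U_def openin_filter_space)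
  next
    have "K \<subseteq> insert None (Some ` S)"
      using compactin_subset_topspace[OF K] topspace_filter_space[OF F] by simp
    moreover have "None \<in> U"
      unfolding U_def using \<epsilon> by (simp add: topspace_filter_space[OF F])
    ultimately show "K \<subseteq> \<Union>\<U>"
      unfolding \<U>_def by auto
  qed
  then obtain \<F> where \<F>: "finite \<F>" "\<F> \<subseteq> \<U>" "K \<subseteq> \<Union>\<F>"
    by blast
  have "{s. Some s \<in> K \<and> \<epsilon> \<le> \<bar>h (Some s) - h None\<bar>} \<subseteq> {s. {Some s} \<in> \<F>}"
  proof
    fix s assume s: "s \<in> {s. Some s \<in> K \<and> \<epsilon> \<le> \<bar>h (Some s) - h None\<bar>}"
    then obtain V where V: "V \<in> \<F>" "Some s \<in> V"
      using \<F>(3) by blast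
    have "Some s \<notin> U"
      using s unfolding U_def by simp
    then have "V \<noteq> U"
      using V(2) by blast
    then obtain s' where "V = {Some s'}"
      using V(1) \<F>(2) unfolding \<U>_def by blast
    then show "s \<in> {s. {Some s} \<in> \<F>}"
      using V by simp
  qed
  moreover have "finite ((\<lambda>s. {Some s}) -` \<F>)"
    by (rule finite_vimageI[OF \<F>(1)]) (simp add: inj_def)
  ultimately show ?thesis
    by (simp add: vimage_def finite_subset)
qed

context unbounded_directed
begin

text \<open>The coordinates of the embedding, normalised to vanish at \<open>\<ast>\<close> and truncated, are the functions of the
  family. Those in one compact set of the cover are point finite after truncation.\<close>

lemma Cp_embedding_imp_separating_family:
  assumes "embeds_in_Cp_filter_space TYPE('s) TYPE('p) X"
  shows "\<exists>L :: 'p \<Rightarrow> _. separating_family X L {g. continuous_map X euclideanreal g}"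
proof -
  obtain S :: "'s set" and F where free: "free_filter_on S F"
    and cover: "has_ordered_compact_cover TYPE('p) (filter_space S F)"
    and emb: "embeds_in X (Cp (filter_space S F))"
    using assms unfolding embeds_in_Cp_filter_space_def by blast
  let ?Z = "filter_space S F"
  have F: "F \<le> principal S"
    using free unfolding free_filter_on_def by simp
  note top = topspace_filter_space[OF F]
  obtain C :: "'p \<Rightarrow> _" where C: "mono C" "\<And>p. compactin ?Z (C p)" "(\<Union>p. C p) = topspace ?Z"
    using cover unfolding has_ordered_compact_cover_def by blast
  obtain e where e: "embedding_map X (Cp ?Z) e"
    using emb unfolding embeds_in_def by blast
  then have homeo: "homeomorphic_map X (subtopology (Cp ?Z) (e ` topspace X)) e"
    unfolding embedding_map_def .
  have inj: "inj_on e (topspace X)"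
    by (rule homeomorphic_imp_injective_map[OF homeo])
  have "continuous_map X (Cp ?Z) e"
    using homeomorphic_imp_continuous_map[OF homeo] continuous_map_into_fulltopology by blast
  then have ext: "\<And>x. x \<in> topspace X \<Longrightarrow> e x \<in> extensional (topspace ?Z)"
    and cont_Z: "\<And>x. x \<in> topspace X \<Longrightarrow> continuous_map ?Z euclideanreal (e x)"
    and cont_X: "\<And>z. z \<in> topspace ?Z \<Longrightarrow> continuous_map X euclideanreal (\<lambda>x. e x z)"
    unfolding continuous_map_Cp_iff by blast+
  define a where "a s t k x = max 0 (t * (e x (Some s) - e x None) - 1 / real (Suc k))"
    for s t k x
  define b where "b t x = max 0 (t * e x None)" for t :: real and x
  define M where "M p = {a s t k |s t k. Some s \<in> C p \<and> t \<in> {1, -1} \<and> k \<le> \<phi> p}" for p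
  define L where "L p = M p \<union> b ` {1, -1}" for p
  have in_S: "Some s \<in> topspace ?Z" if "Some s \<in> C p" for s p
    using that C(3) by blast
  have "separating_family X L {g. continuous_map X euclideanreal g}"
    unfolding separating_family_def
  proof (intro conjI allI ballI impI)
    show "mono L"
    proof (rule monoI)
      fix p q :: 'p assume pq: "p \<le> q"
      have "M p \<subseteq> M q"
        unfolding M_def using monoD[OF C(1) pq] monoD[OF mono_\<phi> pq] order_trans by blast
      then show "L p \<subseteq> L q"
        unfolding L_def by blast
    qed
    fix p
    show "continuous_map X euclideanreal f" if "f \<in> L p" for f
    proof -
      have "continuous_map X euclideanreal (a s t k)" if "Some s \<in> C p" for s t k
        unfolding a_def[abs_def] using cont_X in_S[OF that] top
        by (intro continuous_map_real_max continuous_map_diff continuous_map_real_mult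
            continuous_map_canonical_const) auto
      moreover have "continuous_map X euclideanreal (b t)" for t
        unfolding b_def[abs_def] using cont_X top
        by (intro continuous_map_real_max continuous_map_real_mult continuous_map_canonical_const) auto
      ultimately show ?thesis
        using that unfolding L_def M_def by auto
    qed
    show "0 \<le> f x" if "f \<in> L p" for f x
      using that unfolding L_def M_def a_def[abs_def] b_def[abs_def] by auto
    show "finite {f \<in> L p. f x \<noteq> 0}" if x: "x \<in> topspace X" for x
    proof -
      let ?far = "\<lambda>k. {s. Some s \<in> C p \<and> 1 / real (Suc k) \<le> \<bar>e x (Some s) - e x None\<bar>}"
      have "finite (?far k)" for k
        by (rule finite_far_from_None[OF F cont_Z[OF x] C(2)]) simp
      then have "finite (\<Union>t\<in>{1, -1::real}. \<Union>k\<in>{..\<phi> p}. (\<lambda>s. a s t k) ` ?far k)"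
        by blast
      moreover have "{f \<in> M p. f x \<noteq> 0} \<subseteq> (\<Union>t\<in>{1, -1}. \<Union>k\<in>{..\<phi> p}. (\<lambda>s. a s t k) ` ?far k)"
      proof
        fix f assume "f \<in> {f \<in> M p. f x \<noteq> 0}"
        then obtain s t k where *: "f = a s t k" "Some s \<in> C p" "t \<in> {1, -1}" "k \<le> \<phi> p"
          and ne: "a s t k x \<noteq> 0"
          unfolding M_def by blast
        have "1 / real (Suc k) < t * (e x (Some s) - e x None)"
          using ne unfolding a_def by (simp add: max_def split: if_splits)
        also have "\<dots> \<le> \<bar>e x (Some s) - e x None\<bar>"
          using *(3) by auto
        finally have "s \<in> ?far k"
          using *(2) by simp
        then show "f \<in> (\<Union>t\<in>{1, -1}. \<Union>k\<in>{..\<phi> p}. (\<lambda>s. a s t k) ` ?far k)"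
          using * by blast
      qed
      ultimately have "finite {f \<in> M p. f x \<noteq> 0}"
        by (rule rev_finite_subset)
      then have "finite ({f \<in> M p. f x \<noteq> 0} \<union> b ` {1, -1})"
        by simp
      then show ?thesis
        by (rule rev_finite_subset) (auto simp: L_def)
    qed
  next
    fix x y g assume x: "x \<in> topspace X" and y: "y \<in> topspace X"
      and eq: "\<forall>p. \<forall>f\<in>L p. f x = f y"
    have None: "e x None = e y None"
    proof -
      have "b 1 x = b 1 y" "b (-1) x = b (-1) y"
        using eq unfolding L_def by blast+
      then show ?thesis
        unfolding b_def by (auto simp: max_def split: if_splits)
    qed
    have Some: "e x (Some s) = e y (Some s)" if s: "s \<in> S" for s
    proof -
      have a_eq: "a s t k x = a s t k y" if t: "t \<in> {1, -1}" for t k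
      proof -
        have "Some s \<in> (\<Union>p. C p)"
          unfolding C(3) top using s by blast
        then obtain p where p: "Some s \<in> C p"
          by blast
        obtain q where q: "p \<le> q" "k \<le> \<phi> q"
          using upper_bound2_index by blast
        have "a s t k \<in> L q"
          unfolding L_def M_def using p monoD[OF C(1) q(1)] q(2) t by blast
        then show ?thesis
          using eq by blast
      qed
      define d where "d z = e z (Some s) - e z None" for z
      have "max 0 (d x) = max 0 (d y)"
        using truncations_determine_positive_part[of "d x" "d y"] a_eq[of 1]
        unfolding a_def d_def by simp
      moreover have "max 0 (- d x) = max 0 (- d y)"
        using truncations_determine_positive_part[of "- d x" "- d y"] a_eq[of "-1"]
        unfolding a_def d_def by simp
      ultimately have "d x = d y"
        by (auto simp: max_def split: if_splits)
      then show ?thesis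
        unfolding d_def None by simp
    qed
    have "e x = e y"
    proof (rule extensionalityI[OF ext[OF x] ext[OF y]])
      show "e x z = e y z" if "z \<in> topspace ?Z" for z
        using that None Some unfolding top by auto
    qed
    then show "g x = g y"
      using inj_onD[OF inj _ x y] by simp
  qed
  then show ?thesis
    by blast
qed

end

text \<open>Extended by \<open>0\<close> at \<open>\<ast>\<close>, the values of the functions at a point depend continuously on the index.\<close>

lemma embeds_in_Cp_filter_spaceI:
  fixes f :: "'s \<Rightarrow> 'a \<Rightarrow> real"
  assumes X: "compact_space X" and F: "F \<le> principal S"
    and cont: "\<And>s. s \<in> S \<Longrightarrow> continuous_map X euclideanreal (f s)"
    and null: "\<And>x \<epsilon>. x \<in> topspace X \<Longrightarrow> 0 < \<epsilon> \<Longrightarrow> \<forall>\<^sub>F s in F. \<bar>f s x\<bar> < \<epsilon>"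
    and sep: "\<And>x y. x \<in> topspace X \<Longrightarrow> y \<in> topspace X \<Longrightarrow> x \<noteq> y \<Longrightarrow> \<exists>s\<in>S. f s x \<noteq> f s y"
  shows "embeds_in X (Cp (filter_space S F))"
proof -
  let ?Z = "filter_space S F"
  note top = topspace_filter_space[OF F]
  define c where "c x z = (case z of None \<Rightarrow> 0 | Some s \<Rightarrow> f s x)" for x z
  define e where "e x = restrict (c x) (topspace ?Z)" for x
  have cont_c: "continuous_map ?Z euclideanreal (c x)" if x: "x \<in> topspace X" for x
    unfolding continuous_map_def
  proof (intro conjI allI impI)
    fix T :: "real set" assume T: "openin euclideanreal T"
    show "openin ?Z {z \<in> topspace ?Z. c x z \<in> T}"
      unfolding openin_filter_space
    proof (intro conjI impI)
      assume "None \<in> {z \<in> topspace ?Z. c x z \<in> T}"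
      then have "0 \<in> T"
        unfolding c_def by simp
      then obtain \<epsilon> where \<epsilon>: "\<epsilon> > 0" "ball 0 \<epsilon> \<subseteq> T"
        using T openE by auto
      have "\<forall>\<^sub>F s in F. s \<in> S"
        using F by (simp add: le_principal)
      with null[OF x \<epsilon>(1)] have "\<forall>\<^sub>F s in F. \<bar>f s x\<bar> < \<epsilon> \<and> s \<in> S"
        by (rule eventually_conj)
      then show "\<forall>\<^sub>F s in F. Some s \<in> {z \<in> topspace ?Z. c x z \<in> T}"
      proof (rule eventually_mono)
        fix s assume s: "\<bar>f s x\<bar> < \<epsilon> \<and> s \<in> S"
        then have "f s x \<in> ball 0 \<epsilon>"
          by (simp add: dist_real_def)
        then show "Some s \<in> {z \<in> topspace ?Z. c x z \<in> T}"
          using \<epsilon>(2) s unfolding c_def top by auto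
      qed
    qed (auto simp: top)
  qed auto
  have "continuous_map X (Cp ?Z) e"
    unfolding continuous_map_Cp_iff
  proof (intro conjI ballI)
    fix x assume x: "x \<in> topspace X"
    show "e x \<in> extensional (topspace ?Z)"
      unfolding e_def by simp
    show "continuous_map ?Z euclideanreal (e x)"
      by (rule continuous_map_eq[OF cont_c[OF x]]) (simp add: e_def)
  next
    fix z assume z: "z \<in> topspace ?Z"
    show "continuous_map X euclideanreal (\<lambda>x. e x z)"
    proof (cases z)
      case None
      then show ?thesis
        unfolding e_def c_def using z by simp
    next
      case (Some s)
      then have "s \<in> S"
        using z unfolding top by auto
      then show ?thesis
        unfolding e_def c_def Some using cont z Some by simp
    qed
  qed
  moreover have "inj_on e (topspace X)"
  proof (rule inj_onI, rule ccontr)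
    fix x y assume xy: "x \<in> topspace X" "y \<in> topspace X" "e x = e y" "x \<noteq> y"
    then obtain s where s: "s \<in> S" "f s x \<noteq> f s y"
      using sep by blast
    have "e x (Some s) = e y (Some s)"
      using xy(3) by simp
    then show False
      using s unfolding e_def c_def top by simp
  qed
  ultimately have "embedding_map X (Cp ?Z) e"
    using X Hausdorff_Cp by (intro continuous_imp_embedding_map)
  then show ?thesis
    unfolding embeds_in_def by blast
qed

text \<open>Take \<open>h / (g + h)\<close>, where \<open>g\<close> vanishes exactly on \<open>Z\<close> and \<open>h\<close> exactly off \<open>V\<close>.\<close>

lemma zero_cozero_function:
  assumes "zeroset_in X Z" "cozeroset_in X V" "Z \<subseteq> V"
  obtains f :: "'a \<Rightarrow> real" where "continuous_map X euclideanreal f"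
    and "\<And>x. x \<in> topspace X \<Longrightarrow> 0 \<le> f x \<and> f x \<le> 1"
    and "\<And>x. x \<in> topspace X \<Longrightarrow> f x = 1 \<longleftrightarrow> x \<in> Z"
    and "\<And>x. x \<in> topspace X \<Longrightarrow> f x = 0 \<longleftrightarrow> x \<notin> V"
proof -
  obtain g :: "'a \<Rightarrow> real"
    where g: "continuous_map X (top_of_set {0..1}) g" "Z = {x \<in> topspace X. g x = 0}"
    using assms(1) unfolding zeroset_in_def by blast
  obtain h :: "'a \<Rightarrow> real"
    where h: "continuous_map X (top_of_set {0..1}) h" "V = {x \<in> topspace X. h x \<noteq> 0}"
    using assms(2) unfolding cozeroset_in_def by blast
  have gh: "continuous_map X euclideanreal g" "continuous_map X euclideanreal h"
    and range: "\<And>x. x \<in> topspace X \<Longrightarrow> 0 \<le> g x \<and> 0 \<le> h x"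
    using g(1) h(1) unfolding continuous_map_in_subtopology by fastforce+
  have pos: "0 < g x + h x" if "x \<in> topspace X" for x
  proof (cases "g x = 0")
    case True
    then have "h x \<noteq> 0"
      using that assms(3) unfolding g(2) h(2) by blast
    then show ?thesis
      using range[OF that] by auto
  next
    case False
    then show ?thesis
      using range[OF that] by auto
  qed
  show thesis
  proof (rule that[of "\<lambda>x. h x / (g x + h x)"])
    show "continuous_map X euclideanreal (\<lambda>x. h x / (g x + h x))"
    proof (intro continuous_map_real_divide continuous_map_add gh)
      show "g x + h x \<noteq> 0" if "x \<in> topspace X" for x
        using pos[OF that] by simp
    qed
    fix x assume x: "x \<in> topspace X"
    show "0 \<le> h x / (g x + h x) \<and> h x / (g x + h x) \<le> 1"
      using range[OF x] pos[OF x] by (simp add: divide_simps)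
    show "h x / (g x + h x) = 1 \<longleftrightarrow> x \<in> Z"
      unfolding g(2) using x pos[OF x] by (auto simp: divide_simps)
    show "h x / (g x + h x) = 0 \<longleftrightarrow> x \<notin> V"
      unfolding h(2) using x pos[OF x] by auto
  qed
qed

text \<open>For \<open>V \<in> \<alpha>\<close> and \<open>n \<ge> 1\<close> the function equals \<open>1\<close> exactly on \<open>U\<^sub>2\<^sub>n\<^sub>-\<^sub>1(V)\<close> and \<open>0\<close> exactly off
  \<open>U\<^sub>2\<^sub>n(V)\<close>, so it distinguishes points that a member of the subbase distinguishes. At all other
  indices it is \<open>0\<close>; this keeps the index set infinite even if \<open>\<alpha>\<close> is empty.\<close>

lemma small_separating_functions:
  fixes X :: "'a topology"
  assumes X: "Hausdorff_space X" and \<alpha>: "almost_subbase X \<alpha>"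
  obtains f :: "'a set \<times> nat \<Rightarrow> 'a \<Rightarrow> real"
  where "\<And>s. continuous_map X euclideanreal (f s)"
    and "\<And>s x. x \<in> topspace X \<Longrightarrow> \<bar>f s x\<bar> \<le> 1"
    and "\<And>V n x. x \<in> topspace X \<Longrightarrow> f (V, n) x \<noteq> 0 \<Longrightarrow> V \<in> \<alpha> \<and> x \<in> V"
    and "\<And>x y. x \<in> topspace X \<Longrightarrow> y \<in> topspace X \<Longrightarrow> x \<noteq> y \<Longrightarrow> \<exists>s. f s x \<noteq> f s y"
proof -
  from \<alpha> obtain U where "\<forall>V\<in>\<alpha>. U_representation X V (U V)"
    and sub: "subbase_of X (\<alpha> \<union> {topspace X - U V (2 * n - 1) |V n. V \<in> \<alpha> \<and> n \<ge> 1})"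
    unfolding almost_subbase_def by (elim exE conjE)
  then have U: "V = (\<Union>n\<in>{1..}. U V n)" "\<And>n. n \<ge> 1 \<Longrightarrow> U V n \<subseteq> U V (n + 1)"
    "\<And>n. n \<ge> 1 \<Longrightarrow> zeroset_in X (U V (2 * n - 1))" "\<And>n. n \<ge> 1 \<Longrightarrow> cozeroset_in X (U V (2 * n))"
    if "V \<in> \<alpha>" for V
    using that unfolding U_representation_def by blast+
  define Q where "Q s g \<longleftrightarrow> continuous_map X euclideanreal g \<and>
      (\<forall>x\<in>topspace X. 0 \<le> g x \<and> g x \<le> 1 \<and> (g x = 1 \<longleftrightarrow> x \<in> U (fst s) (2 * snd s - 1)) \<and>
         (g x = 0 \<longleftrightarrow> x \<notin> U (fst s) (2 * snd s)))" for s :: "'a set \<times> nat" and g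
  have Q_ex: "\<exists>g. Q s g" if s: "fst s \<in> \<alpha>" "snd s \<ge> 1" for s
  proof -
    have "U (fst s) (2 * snd s - 1) \<subseteq> U (fst s) (2 * snd s - 1 + 1)"
      using s by (intro U(2)) auto
    moreover have "2 * snd s - 1 + 1 = 2 * snd s"
      using s(2) by simp
    ultimately have "U (fst s) (2 * snd s - 1) \<subseteq> U (fst s) (2 * snd s)"
      by simp
    then obtain g :: "'a \<Rightarrow> real" where "continuous_map X euclideanreal g"
      "\<And>x. x \<in> topspace X \<Longrightarrow> 0 \<le> g x \<and> g x \<le> 1"
      "\<And>x. x \<in> topspace X \<Longrightarrow> g x = 1 \<longleftrightarrow> x \<in> U (fst s) (2 * snd s - 1)"
      "\<And>x. x \<in> topspace X \<Longrightarrow> g x = 0 \<longleftrightarrow> x \<notin> U (fst s) (2 * snd s)"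
      by (rule zero_cozero_function[OF U(3)[OF s] U(4)[OF s]]) blast
    then show ?thesis
      unfolding Q_def by blast
  qed
  define f where "f s = (if fst s \<in> \<alpha> \<and> snd s \<ge> 1 then SOME g. Q s g else (\<lambda>_. 0))" for s
  have f: "Q s (f s)" if "fst s \<in> \<alpha>" "snd s \<ge> 1" for s
    using someI_ex[OF Q_ex[OF that]] that unfolding f_def by simp
  have f0: "f s = (\<lambda>_. 0)" if "\<not> (fst s \<in> \<alpha> \<and> snd s \<ge> 1)" for s
    using that unfolding f_def by auto
  show thesis
  proof (rule that[of f])
    show "continuous_map X euclideanreal (f s)" for s
      using f[of s] f0[of s] unfolding Q_def by (cases "fst s \<in> \<alpha> \<and> snd s \<ge> 1") auto
    show "\<bar>f s x\<bar> \<le> 1" if "x \<in> topspace X" for s x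
      using f[of s] f0[of s] that unfolding Q_def by (cases "fst s \<in> \<alpha> \<and> snd s \<ge> 1") auto
    show "V \<in> \<alpha> \<and> x \<in> V" if "x \<in> topspace X" "f (V, n) x \<noteq> 0" for V n x
    proof -
      have V: "V \<in> \<alpha>" and n: "n \<ge> 1"
        using that(2) unfolding f_def by (auto split: if_splits)
      then have "x \<in> U V (2 * n)"
        using f[of "(V, n)"] that unfolding Q_def by auto
      moreover have "2 * n \<in> {1..}"
        using n by simp
      ultimately show ?thesis
        using V U(1)[OF V] by blast
    qed
    fix x y assume x: "x \<in> topspace X" and y: "y \<in> topspace X" and "x \<noteq> y"
    then obtain O' where O': "openin X O' \<and> x \<in> O'" "y \<notin> O'"
      using X unfolding Hausdorff_space_def disjnt_iff by metis
    obtain \<T> where \<T>: "finite \<T>" "\<T> \<subseteq> \<alpha> \<union> {topspace X - U V (2 * n - 1) |V n. V \<in> \<alpha> \<and> n \<ge> 1}"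
      "x \<in> \<Inter>\<T>" "topspace X \<inter> \<Inter>\<T> \<subseteq> O'"
      using conjunct2[OF sub[unfolded subbase_of_iff], rule_format, OF O'(1)] by (elim exE conjE)
    have "y \<notin> \<Inter>\<T>"
      using \<T>(4) O'(2) y by auto
    then obtain T where T: "T \<in> \<T>" "x \<in> T" "y \<notin> T"
      using \<T>(3) by auto
    have "T \<in> \<alpha> \<or> T \<in> {topspace X - U V (2 * n - 1) |V n. V \<in> \<alpha> \<and> n \<ge> 1}"
      using subsetD[OF \<T>(2) T(1)] by (rule UnE) (erule disjI1, erule disjI2)
    then have "\<exists>V n. V \<in> \<alpha> \<and> n \<ge> 1 \<and> (f (V, n) x = 1 \<longleftrightarrow> f (V, n) y \<noteq> 1)"
    proof
      assume V: "T \<in> \<alpha>"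
      then obtain n where n: "n \<ge> 1" "x \<in> U T n"
        using T(2) U(1)[OF V] by auto
      have "U T n \<subseteq> U T (n + k)" for k
      proof (induction k)
        case (Suc k)
        then show ?case
          using U(2)[OF V, of "n + k"] n(1) by auto
      qed simp
      \<comment> \<open>The odd index \<open>2n - 1\<close> is at least \<open>n\<close>.\<close>
      from this[of "n - 1"] have "x \<in> U T (2 * n - 1)"
        using n by (auto simp: mult_2)
      moreover have "2 * n - 1 \<in> {1..}"
        using n(1) by auto
      then have "y \<notin> U T (2 * n - 1)"
        using T(3) U(1)[OF V] by blast
      ultimately show ?thesis
        using f[of "(T, n)"] V n(1) x y unfolding Q_def by (intro exI[of _ T] exI[of _ n]) auto
    next
      assume "T \<in> {topspace X - U V (2 * n - 1) |V n. V \<in> \<alpha> \<and> n \<ge> 1}"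
      then obtain V n where V: "T = topspace X - U V (2 * n - 1)" "V \<in> \<alpha>" "n \<ge> 1"
        by blast
      then show ?thesis
        using f[of "(V, n)"] T(2,3) x y unfolding Q_def by (intro exI[of _ V] exI[of _ n]) auto
    qed
    then show "\<exists>s. f s x \<noteq> f s y"
      by metis
  qed
qed

definition cofinite_on :: "'s set \<Rightarrow> 's filter" where
  "cofinite_on S = inf cofinite (principal S)"

lemma eventually_cofinite_on: "eventually P (cofinite_on S) \<longleftrightarrow> finite {s \<in> S. \<not> P s}"
  unfolding cofinite_on_def eventually_inf_principal eventually_cofinite
  by (rule arg_cong[where f = finite]) auto

lemma filter_space_cofinite_on:
  "filter_space S (cofinite_on S) = Alexandroff_compactification (discrete_topology S)"
proof (rule topology_eq[THEN iffD2], intro allI)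
  fix W :: "'a option set"
  have "{s \<in> S. Some s \<notin> W} = S - Some -` W"
    by auto
  then have ev: "(\<forall>\<^sub>F s in cofinite_on S. Some s \<in> W) \<longleftrightarrow> finite (S - Some -` W)"
    unfolding eventually_cofinite_on by simp
  show "openin (filter_space S (cofinite_on S)) W \<longleftrightarrow>
      openin (Alexandroff_compactification (discrete_topology S)) W"
  proof
    assume W: "openin (filter_space S (cofinite_on S)) W"
    then have sub: "W \<subseteq> insert None (Some ` S)"
      unfolding openin_filter_space by blast
    show "openin (Alexandroff_compactification (discrete_topology S)) W"
    proof (cases "None \<in> W")
      case True
      then have "finite (S - Some -` W)"
        using W ev unfolding openin_filter_space by blast
      moreover have "W = insert None (Some ` (S - (S - Some -` W)))"
        using sub True by auto
      ultimately show ?thesis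
        unfolding openin_Alexandroff_compactification
        by (intro disjI2 exI[of _ "S - Some -` W"]) (simp add: compactin_discrete_topology)
    next
      case False
      then have "W = Some ` (Some -` W)" "Some -` W \<subseteq> S"
        using sub by (auto simp: image_iff)
      then show ?thesis
        unfolding openin_Alexandroff_compactification
        by (intro disjI1 exI[of _ "Some -` W"]) simp
    qed
  next
    assume "openin (Alexandroff_compactification (discrete_topology S)) W"
    then show "openin (filter_space S (cofinite_on S)) W"
      unfolding openin_Alexandroff_compactification openin_filter_space ev
    proof (elim disjE exE conjE)
      fix U assume "openin (discrete_topology S) U" "W = Some ` U"
      then show "W \<subseteq> insert None (Some ` S) \<and> (None \<in> W \<longrightarrow> finite (S - Some -` W))"
        by auto
    next
      fix C assume C: "compactin (discrete_topology S) C" "W = insert None (Some ` (topspace (discrete_topology S) - C))"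
      then have "S - Some -` W \<subseteq> C"
        by auto
      then have "finite (S - Some -` W)"
        using C(1) finite_subset unfolding compactin_discrete_topology by blast
      then show "W \<subseteq> insert None (Some ` S) \<and> (None \<in> W \<longrightarrow> finite (S - Some -` W))"
        using C(2) by auto
    qed
  qed
qed

lemma free_filter_onI:
  assumes "F \<le> principal S" "\<And>s. s \<in> S \<Longrightarrow> \<forall>\<^sub>F t in F. t \<noteq> s"
  shows "free_filter_on S F"
  unfolding free_filter_on_def
proof (intro conjI equals0I)
  have S: "\<forall>\<^sub>F t in F. t \<in> S"
    using assms(1) by (simp add: le_principal)
  fix s assume s: "s \<in> \<Inter>{U. U \<subseteq> S \<and> (\<forall>\<^sub>F s in F. s \<in> U)}"
  then have "s \<in> S"
    using S by blast
  then have "\<forall>\<^sub>F t in F. t \<in> S - {s}"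
    using eventually_conj[OF S assms(2)[of s]] by simp
  then show False
    using s by blast
qed (rule assms(1))

lemma Cp_Alexandroff_imp_Cp_filter_space:
  assumes "embeds_in_Cp_Alexandroff TYPE('s) X"
  shows "embeds_in_Cp_filter_space TYPE('s) TYPE('p::order) X"
proof -
  obtain S :: "'s set" where S: "infinite S"
    "embeds_in X (Cp (Alexandroff_compactification (discrete_topology S)))"
    using assms unfolding embeds_in_Cp_Alexandroff_def by blast
  have "free_filter_on S (cofinite_on S)"
  proof (rule free_filter_onI)
    show "cofinite_on S \<le> principal S"
      unfolding cofinite_on_def by simp
    show "\<forall>\<^sub>F t in cofinite_on S. t \<noteq> s" if "s \<in> S" for s
      unfolding eventually_cofinite_on by simp
  qed
  moreover have "compactin (filter_space S (cofinite_on S)) (topspace (filter_space S (cofinite_on S)))"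
    using compact_space_Alexandroff_compactification
    unfolding filter_space_cofinite_on compact_space_def .
  then have "has_ordered_compact_cover TYPE('p) (filter_space S (cofinite_on S))"
    unfolding has_ordered_compact_cover_def
    by (intro exI[of _ "\<lambda>_. topspace (filter_space S (cofinite_on S))"]) (simp add: mono_def)
  ultimately show ?thesis
    unfolding embeds_in_Cp_filter_space_def using S
    by (intro exI[of _ S] exI[of _ "cofinite_on S"]) (simp add: filter_space_cofinite_on)
qed

context unbounded_directed
begin

text \<open>The members of the filter are the sets cofinite in each \<open>K p\<close>, so that \<open>K p\<close> converges to \<open>\<ast>\<close>. The
  sets \<open>V \<notin> \<alpha>\<close> are admitted in every \<open>K p\<close> in order that these cover all indices.\<close>

lemma almost_subbase_imp_Cp_embedding:
  fixes X :: "'a topology"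
  assumes X: "compact_space X" "Hausdorff_space X"
    and ex: "has_point_finite_almost_subbase TYPE('p) X"
  shows "embeds_in_Cp_filter_space TYPE('a set \<times> nat) TYPE('p) X"
proof -
  obtain \<alpha> where \<alpha>: "almost_subbase X \<alpha>" "ordered_property TYPE('p) (point_finite X) \<alpha>"
    using ex unfolding has_point_finite_almost_subbase_def by blast
  from \<alpha>(2) obtain C where C: "mono (C :: 'p \<Rightarrow> _)" "\<alpha> = (\<Union>p. C p)" "\<forall>p. point_finite X (C p)"
    unfolding ordered_property_def by (elim exE conjE)
  obtain f :: "'a set \<times> nat \<Rightarrow> 'a \<Rightarrow> real"
    where cont: "\<And>s. continuous_map X euclideanreal (f s)"
      and supp: "\<And>V n x. x \<in> topspace X \<Longrightarrow> f (V, n) x \<noteq> 0 \<Longrightarrow> V \<in> \<alpha> \<and> x \<in> V"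
      and sep: "\<And>x y. x \<in> topspace X \<Longrightarrow> y \<in> topspace X \<Longrightarrow> x \<noteq> y \<Longrightarrow> \<exists>s. f s x \<noteq> f s y"
    by (rule small_separating_functions[OF X(2) \<alpha>(1)]) blast
  define K where "K p = (C p \<union> - \<alpha>) \<times> {..\<phi> p}" for p
  define F where "F = Sup (range (\<lambda>p. cofinite_on (K p)))"
  have ev: "eventually P F \<longleftrightarrow> (\<forall>p. finite {s \<in> K p. \<not> P s})" for P
    unfolding F_def eventually_Sup by (simp add: eventually_cofinite_on)
  have mono_K: "K p \<subseteq> K q" if "p \<le> q" for p q
    unfolding K_def using monoD[OF C(1) that] monoD[OF mono_\<phi> that] by auto
  have cover_K: "(\<Union>p. K p) = UNIV"
  proof (intro equalityI subsetI UNIV_I)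
    fix s :: "'a set \<times> nat"
    have "\<exists>p. fst s \<in> C p \<union> - \<alpha>"
      unfolding C(2) by blast
    then obtain p where p: "fst s \<in> C p \<union> - \<alpha>"
      by blast
    obtain q where q: "p \<le> q" "snd s \<le> \<phi> q"
      using upper_bound2_index by blast
    have "s \<in> K q"
      unfolding K_def using p q(2) monoD[OF C(1) q(1)] by (auto simp: mem_Times_iff)
    then show "s \<in> (\<Union>p. K p)"
      by blast
  qed
  have F: "F \<le> principal UNIV"
    by simp
  note top = topspace_filter_space[OF F]
  have "free_filter_on UNIV F"
    by (rule free_filter_onI[OF F]) (auto simp: ev)
  moreover have "has_ordered_compact_cover TYPE('p) (filter_space UNIV F)"
    unfolding has_ordered_compact_cover_def
  proof (intro exI conjI allI)
    show "mono (\<lambda>p. insert None (Some ` K p))"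
      using mono_K by (intro monoI insert_mono image_mono)
    show "(\<Union>p. insert None (Some ` K p)) = topspace (filter_space UNIV F)"
      unfolding top using cover_K by (auto simp: image_iff)
    fix p
    show "compactin (filter_space UNIV F) (insert None (Some ` K p))"
      unfolding compactin_def
    proof (intro conjI allI impI)
      fix \<U> assume \<U>: "(\<forall>U\<in>\<U>. openin (filter_space UNIV F) U) \<and> insert None (Some ` K p) \<subseteq> \<Union>\<U>"
      then obtain U where U: "U \<in> \<U>" "None \<in> U"
        by blast
      have "\<forall>\<^sub>F s in F. Some s \<in> U"
        using \<U> U unfolding openin_filter_space by blast
      then have fin: "finite {s \<in> K p. Some s \<notin> U}"
        unfolding ev by blast
      have "\<forall>s\<in>{s \<in> K p. Some s \<notin> U}. \<exists>V. V \<in> \<U> \<and> Some s \<in> V"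
        using \<U> by blast
      from bchoice[OF this] obtain V where V: "\<forall>s\<in>{s \<in> K p. Some s \<notin> U}. V s \<in> \<U> \<and> Some s \<in> V s" ..
      show "\<exists>\<F>. finite \<F> \<and> \<F> \<subseteq> \<U> \<and> insert None (Some ` K p) \<subseteq> \<Union>\<F>"
      proof (intro exI conjI)
        show "finite (insert U (V ` {s \<in> K p. Some s \<notin> U}))"
          using fin by simp
        show "insert U (V ` {s \<in> K p. Some s \<notin> U}) \<subseteq> \<U>"
          using U(1) V by auto
        show "insert None (Some ` K p) \<subseteq> \<Union>(insert U (V ` {s \<in> K p. Some s \<notin> U}))"
          using U(2) V by auto
      qed
    qed (auto simp: top)
  qed
  moreover have "embeds_in X (Cp (filter_space UNIV F))"
  proof (rule embeds_in_Cp_filter_spaceI[OF X(1) F cont])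
    fix x :: 'a and \<epsilon> :: real assume x: "x \<in> topspace X" and \<epsilon>: "0 < \<epsilon>"
    show "\<forall>\<^sub>F s in F. \<bar>f s x\<bar> < \<epsilon>"
      unfolding ev
    proof
      fix p
      have "{s \<in> K p. \<not> \<bar>f s x\<bar> < \<epsilon>} \<subseteq> {V \<in> C p. x \<in> V} \<times> {..\<phi> p}"
      proof
        fix s assume s: "s \<in> {s \<in> K p. \<not> \<bar>f s x\<bar> < \<epsilon>}"
        then have "f (fst s, snd s) x \<noteq> 0"
          using \<epsilon> by auto
        then have "fst s \<in> \<alpha> \<and> x \<in> fst s"
          by (rule supp[OF x])
        then show "s \<in> {V \<in> C p. x \<in> V} \<times> {..\<phi> p}"
          using s unfolding K_def by (auto simp: mem_Times_iff)
      qed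
      moreover have "finite {V \<in> C p. x \<in> V}"
        using C(3) x unfolding point_finite_def by simp
      ultimately show "finite {s \<in> K p. \<not> \<bar>f s x\<bar> < \<epsilon>}"
        by (rule_tac finite_subset) auto
    qed
  qed (use sep in simp)
  moreover have "infinite (UNIV :: ('a set \<times> nat) set)"
    by (simp add: finite_prod)
  ultimately show ?thesis
    unfolding embeds_in_Cp_filter_space_def by blast
qed

end

text \<open>For a sequence of point finite families the functions can be scaled by the reciprocal of the level, so
  that at each point only finitely many values exceed a given \<open>\<epsilon>\<close>.\<close>

lemma almost_subbase_imp_Cp_Alexandroff_embedding:
  fixes X :: "'a topology"
  assumes X: "compact_space X" "Hausdorff_space X"
    and ex: "has_point_finite_almost_subbase TYPE(nat) X"
  shows "embeds_in_Cp_Alexandroff TYPE('a set \<times> nat) X"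
proof -
  obtain \<alpha> where \<alpha>: "almost_subbase X \<alpha>" "ordered_property TYPE(nat) (point_finite X) \<alpha>"
    using ex unfolding has_point_finite_almost_subbase_def by blast
  from \<alpha>(2) obtain C where C: "mono (C :: nat \<Rightarrow> _)" "\<alpha> = (\<Union>p. C p)" "\<forall>p. point_finite X (C p)"
    unfolding ordered_property_def by (elim exE conjE)
  obtain f :: "'a set \<times> nat \<Rightarrow> 'a \<Rightarrow> real"
    where cont: "\<And>s. continuous_map X euclideanreal (f s)"
      and bound: "\<And>s x. x \<in> topspace X \<Longrightarrow> \<bar>f s x\<bar> \<le> 1"
      and supp: "\<And>V n x. x \<in> topspace X \<Longrightarrow> f (V, n) x \<noteq> 0 \<Longrightarrow> V \<in> \<alpha> \<and> x \<in> V"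
      and sep: "\<And>x y. x \<in> topspace X \<Longrightarrow> y \<in> topspace X \<Longrightarrow> x \<noteq> y \<Longrightarrow> \<exists>s. f s x \<noteq> f s y"
    by (rule small_separating_functions[OF X(2) \<alpha>(1)]) blast
  define m where "m s = (LEAST p. fst s \<in> C p) + snd s" for s :: "'a set \<times> nat"
  have m: "fst s \<in> C (m s)" "snd s \<le> m s" if "fst s \<in> \<alpha>" for s
  proof -
    have "fst s \<in> C (LEAST p. fst s \<in> C p)"
      using that unfolding C(2) by (auto intro: LeastI)
    moreover have "C (LEAST p. fst s \<in> C p) \<subseteq> C (m s)"
      unfolding m_def by (intro monoD[OF C(1)]) simp
    ultimately show "fst s \<in> C (m s)"
      by blast
    show "snd s \<le> m s"
      unfolding m_def by simp
  qed
  define g where "g s x = f s x / real (Suc (m s))" for s x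
  have "embeds_in X (Cp (filter_space (UNIV :: ('a set \<times> nat) set) (cofinite_on UNIV)))"
  proof (rule embeds_in_Cp_filter_spaceI[OF X(1), where f = g])
    show "continuous_map X euclideanreal (g s)" for s
      unfolding g_def[abs_def] using cont by (intro continuous_map_real_divide) auto
    fix x :: 'a and \<epsilon> :: real assume x: "x \<in> topspace X" and \<epsilon>: "0 < \<epsilon>"
    obtain N where N: "inverse (real (Suc N)) < \<epsilon>"
      using reals_Archimedean[OF \<epsilon>] by blast
    have "{s \<in> UNIV. \<not> \<bar>g s x\<bar> < \<epsilon>} \<subseteq> {V \<in> C N. x \<in> V} \<times> {..N}"
    proof
      fix s assume "s \<in> {s \<in> UNIV. \<not> \<bar>g s x\<bar> < \<epsilon>}"
      then have far: "\<epsilon> \<le> \<bar>g s x\<bar>"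
        by simp
      then have "f (fst s, snd s) x \<noteq> 0"
        using \<epsilon> unfolding g_def by auto
      then have s: "fst s \<in> \<alpha> \<and> x \<in> fst s"
        by (rule supp[OF x])
      have "inverse (real (Suc N)) < \<bar>f s x\<bar> * inverse (real (Suc (m s)))"
        using N far unfolding g_def by (simp add: divide_inverse abs_mult)
      also have "\<dots> \<le> 1 * inverse (real (Suc (m s)))"
        by (intro mult_right_mono bound x) simp
      finally have "real (Suc (m s)) < real (Suc N)"
        by (simp add: inverse_less_iff_less del: of_nat_Suc)
      then have "m s \<le> N"
        by simp
      then have "fst s \<in> C N" "snd s \<le> N"
        using m[of s] s monoD[OF C(1) \<open>m s \<le> N\<close>] by auto
      then show "s \<in> {V \<in> C N. x \<in> V} \<times> {..N}"
        using s by (auto simp: mem_Times_iff)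
    qed
    moreover have "finite {V \<in> C N. x \<in> V}"
      using C(3) x unfolding point_finite_def by simp
    ultimately show "\<forall>\<^sub>F s in cofinite_on UNIV. \<bar>g s x\<bar> < \<epsilon>"
      unfolding eventually_cofinite_on by (rule_tac finite_subset) auto
  next
    fix x y assume xy: "x \<in> topspace X" "y \<in> topspace X" "x \<noteq> y"
    then obtain s where "f s x \<noteq> f s y"
      using sep by blast
    then show "\<exists>s\<in>UNIV. g s x \<noteq> g s y"
      unfolding g_def by (intro bexI[of _ s]) auto
  qed simp
  moreover have "infinite (UNIV :: ('a set \<times> nat) set)"
    by (simp add: finite_prod)
  ultimately show ?thesis
    unfolding embeds_in_Cp_Alexandroff_def filter_space_cofinite_on by blast
qed

section \<open>The cycle of conditions\<close>

text \<open>The conditions that, unlike the embeddings, do not involve the type of an additional index set.\<close>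

definition network_conditions :: "'p::order itself \<Rightarrow> 'a topology \<Rightarrow> bool" where
  "network_conditions TYPE('p) X \<longleftrightarrow>
     has_point_finite_almost_subbase TYPE('p) X \<and>
     has_point_additively_Noetherian_base TYPE('p) X \<and>
     has_point_additively_Noetherian_expandable_network TYPE('p) X \<and>
     has_strong_point_network TYPE('p) additively_Noetherian X \<and>
     has_point_network TYPE('p) additively_Noetherian X"

context unbounded_directed
begin

lemma separating_family_imp_network_conditions:
  assumes X: "compact_space X" "Hausdorff_space X"
    and "\<exists>L :: 'p \<Rightarrow> _. separating_family X L {g. continuous_map X euclideanreal g}"
  shows "network_conditions TYPE('p) X"
proof -
  have subbase: "has_point_finite_almost_subbase TYPE('p) X"
    using assms separating_family_imp_almost_subbase by blast
  then have "has_point_additively_Noetherian_base TYPE('p) X"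
    by (rule almost_subbase_imp_base[OF X(1)])
  then show ?thesis
    unfolding network_conditions_def
    using subbase base_imp_expandable_network base_imp_strong_point_network
      strong_point_network_imp_point_network by blast
qed

lemma any_condition_imp_network_conditions:
  assumes X: "compact_space X" "Hausdorff_space X"
    and "embeds_in_Cp_filter_space TYPE('s) TYPE('p) X \<or>
      has_point_finite_almost_subbase TYPE('p) X \<or>
      has_point_additively_Noetherian_base TYPE('p) X \<or>
      has_point_additively_Noetherian_expandable_network TYPE('p) X \<or>
      has_strong_point_network TYPE('p) additively_Noetherian X \<or>
      has_point_network TYPE('p) additively_Noetherian X"
  shows "network_conditions TYPE('p) X"
proof (rule separating_family_imp_network_conditions[OF X])
  have net: "has_point_network TYPE('p) additively_Noetherian X"
    if "\<not> embeds_in_Cp_filter_space TYPE('s) TYPE('p) X"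
    using assms(3) that almost_subbase_imp_base[OF X(1)] base_imp_strong_point_network
      strong_point_network_imp_point_network expandable_network_imp_point_network by blast
  show "\<exists>L :: 'p \<Rightarrow> _. separating_family X L {g. continuous_map X euclideanreal g}"
    using net Cp_embedding_imp_separating_family point_network_imp_separating_family[OF X] by blast
qed

lemma continuous_image_network_conditions:
  assumes X: "compact_space X" and Y: "compact_space Y" "Hausdorff_space Y"
    and f: "continuous_map X Y f" "f ` topspace X = topspace Y"
    and "network_conditions TYPE('p) X"
  shows "network_conditions TYPE('p) Y"
proof (rule separating_family_imp_network_conditions[OF Y])
  have "has_point_network TYPE('p) additively_Noetherian X"
    using assms(6) unfolding network_conditions_def by blast
  then show "\<exists>L :: 'p \<Rightarrow> _. separating_family Y L {g. continuous_map Y euclideanreal g}"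
    by (intro point_network_imp_separating_family[OF Y] continuous_image_point_network[OF X Y(2) f])
qed

end

text \<open>If the range of \<open>a\<close> has no upper bound, the first \<open>n\<close> with \<open>\<not> a n \<le> p\<close> is monotone in \<open>p\<close>, and
  it exceeds \<open>k\<close> at every upper bound of \<open>a 0\<close>, \<dots>, \<open>a k\<close>.\<close>

lemma unbounded_map_to_nat:
  assumes dir: "directed_poset TYPE('p::order)" and "\<not> countably_directed TYPE('p::order)"
  obtains \<phi> :: "'p::order \<Rightarrow> nat" where "unbounded_directed \<phi>"
proof -
  from assms(2) have "\<exists>A :: 'p set. countable A \<and> \<not> bdd_above A"
    unfolding countably_directed_def by simp
  then obtain A :: "'p set" where A: "countable A" "\<not> bdd_above A"
    by (elim exE conjE)
  then have "A \<noteq> {}"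
    by auto
  define a where "a = from_nat_into A"
  have range_a: "range a = A"
    unfolding a_def using A(1) \<open>A \<noteq> {}\<close> by (rule range_from_nat_into[rotated])
  define \<phi> where "\<phi> p = (LEAST n. \<not> a n \<le> p)" for p
  have \<phi>: "\<not> a (\<phi> p) \<le> p" for p
  proof -
    have "\<exists>n. \<not> a n \<le> p"
      using A(2) unfolding bdd_above_def range_a[symmetric] by blast
    then show ?thesis
      unfolding \<phi>_def by (rule LeastI_ex)
  qed
  have "unbounded_directed \<phi>"
  proof
    show "directed_poset TYPE('p)"
      by (rule dir)
    show "mono \<phi>"
    proof (rule monoI)
      fix p q :: 'p assume "p \<le> q"
      then have "\<not> a (\<phi> q) \<le> p"
        using \<phi>[of q] order_trans by blast
      then show "\<phi> p \<le> \<phi> q"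
        unfolding \<phi>_def[of p] by (rule Least_le)
    qed
    show "\<exists>p. n \<le> \<phi> p" for n
    proof -
      have "\<exists>p. \<forall>k<n. a k \<le> p"
      proof (induction n)
        case (Suc n)
        then obtain p where p: "\<forall>k<n. a k \<le> p"
          by blast
        obtain r where "p \<le> r" "a n \<le> r"
          using dir unfolding directed_poset_def by blast
        then show ?case
          using p by (intro exI[of _ r]) (auto simp: less_Suc_eq intro: order_trans)
      qed simp
      then obtain p where "\<forall>k<n. a k \<le> p"
        by blast
      then have "n \<le> \<phi> p"
        using \<phi>[of p] not_le_imp_less by blast
      then show ?thesis
        by blast
    qed
  qed
  then show thesis
    by (rule that)
qed

lemma unbounded_directed_nat: "unbounded_directed (\<lambda>n::nat. n)"
proof
  show "directed_poset TYPE(nat)"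
    unfolding directed_poset_def by (meson max.cobounded1 max.cobounded2)
  show "mono (\<lambda>n::nat. n)"
    by (simp add: mono_def)
  show "\<exists>p. n \<le> p" for n :: nat
    by blast
qed

theorem theorem22:
  fixes X :: "'a topology" and Y :: "'b topology" and f :: "'a \<Rightarrow> 'b"
  assumes "tychonoff_space X" and "compact_space X"
    and "directed_poset TYPE('p::order)"
    and "\<not> countably_directed TYPE('p) \<or> tukey_equivalent TYPE('p) TYPE(unit)"
    and "tychonoff_space Y" and "continuous_map X Y f" and "f ` topspace X = topspace Y"
  shows
    "(\<not> countably_directed TYPE('p) \<longrightarrow>
       (embeds_in_Cp_filter_space TYPE('s) TYPE('p) X \<or>
        has_point_finite_almost_subbase TYPE('p) X \<or>
        has_point_additively_Noetherian_base TYPE('p) X \<or>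
        has_point_additively_Noetherian_expandable_network TYPE('p) X \<or>
        has_strong_point_network TYPE('p) additively_Noetherian X \<or>
        has_point_network TYPE('p) additively_Noetherian X)
       \<longrightarrow>
       (embeds_in_Cp_filter_space TYPE('a set \<times> nat) TYPE('p) X \<and>
        has_point_finite_almost_subbase TYPE('p) X \<and>
        has_point_additively_Noetherian_base TYPE('p) X \<and>
        has_point_additively_Noetherian_expandable_network TYPE('p) X \<and>
        has_strong_point_network TYPE('p) additively_Noetherian X \<and>
        has_point_network TYPE('p) additively_Noetherian X) \<and>
       (embeds_in_Cp_filter_space TYPE('b set \<times> nat) TYPE('p) Y \<and>
        has_point_finite_almost_subbase TYPE('p) Y \<and>
        has_point_additively_Noetherian_base TYPE('p) Y \<and>
        has_point_additively_Noetherian_expandable_network TYPE('p) Y \<and>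
        has_strong_point_network TYPE('p) additively_Noetherian Y \<and>
        has_point_network TYPE('p) additively_Noetherian Y)) \<and>
     (tukey_equivalent TYPE('p) TYPE(unit) \<longrightarrow>
       (embeds_in_Cp_Alexandroff TYPE('s) X \<or>
        has_point_finite_almost_subbase TYPE(nat) X \<or>
        has_point_additively_Noetherian_base TYPE(nat) X \<or>
        has_point_additively_Noetherian_expandable_network TYPE(nat) X \<or>
        has_strong_point_network TYPE(nat) additively_Noetherian X \<or>
        has_point_network TYPE(nat) additively_Noetherian X)
       \<longrightarrow>
       (embeds_in_Cp_Alexandroff TYPE('a set \<times> nat) X \<and>
        has_point_finite_almost_subbase TYPE(nat) X \<and>
        has_point_additively_Noetherian_base TYPE(nat) X \<and>
        has_point_additively_Noetherian_expandable_network TYPE(nat) X \<and>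
        has_strong_point_network TYPE(nat) additively_Noetherian X \<and>
        has_point_network TYPE(nat) additively_Noetherian X) \<and>
       (embeds_in_Cp_Alexandroff TYPE('b set \<times> nat) Y \<and>
        has_point_finite_almost_subbase TYPE(nat) Y \<and>
        has_point_additively_Noetherian_base TYPE(nat) Y \<and>
        has_point_additively_Noetherian_expandable_network TYPE(nat) Y \<and>
        has_strong_point_network TYPE(nat) additively_Noetherian Y \<and>
        has_point_network TYPE(nat) additively_Noetherian Y))"
proof -
  have X: "compact_space X" "Hausdorff_space X" and "Hausdorff_space Y"
    using assms(1,2,5) unfolding tychonoff_space_def by blast+
  moreover have "compactin Y (f ` topspace X)"
    using assms(2,6) image_compactin unfolding compact_space_def by blast
  ultimately have Y: "compact_space Y" "Hausdorff_space Y"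
    using assms(7) unfolding compact_space_def by simp_all
  have general: "(network_conditions TYPE('p) X \<and> embeds_in_Cp_filter_space TYPE('a set \<times> nat) TYPE('p) X) \<and>
      (network_conditions TYPE('p) Y \<and> embeds_in_Cp_filter_space TYPE('b set \<times> nat) TYPE('p) Y)"
    if not_cd: "\<not> countably_directed TYPE('p)"
      and any: "embeds_in_Cp_filter_space TYPE('s) TYPE('p) X \<or>
        has_point_finite_almost_subbase TYPE('p) X \<or>
        has_point_additively_Noetherian_base TYPE('p) X \<or>
        has_point_additively_Noetherian_expandable_network TYPE('p) X \<or>
        has_strong_point_network TYPE('p) additively_Noetherian X \<or>
        has_point_network TYPE('p) additively_Noetherian X"
  proof -
    obtain \<phi> :: "'p \<Rightarrow> nat" where "unbounded_directed \<phi>"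
      by (rule unbounded_map_to_nat[OF assms(3) not_cd])
    then interpret unbounded_directed \<phi> .
    have nX: "network_conditions TYPE('p) X"
      by (rule any_condition_imp_network_conditions[OF X any])
    moreover have nY: "network_conditions TYPE('p) Y"
      by (rule continuous_image_network_conditions[OF X(1) Y assms(6,7) nX])
    ultimately show ?thesis
      using almost_subbase_imp_Cp_embedding[OF X] almost_subbase_imp_Cp_embedding[OF Y]
      unfolding network_conditions_def by simp
  qed
  have eberlein: "(network_conditions TYPE(nat) X \<and> embeds_in_Cp_Alexandroff TYPE('a set \<times> nat) X) \<and>
      (network_conditions TYPE(nat) Y \<and> embeds_in_Cp_Alexandroff TYPE('b set \<times> nat) Y)"
    if any: "embeds_in_Cp_Alexandroff TYPE('s) X \<or>
        has_point_finite_almost_subbase TYPE(nat) X \<or>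
        has_point_additively_Noetherian_base TYPE(nat) X \<or>
        has_point_additively_Noetherian_expandable_network TYPE(nat) X \<or>
        has_strong_point_network TYPE(nat) additively_Noetherian X \<or>
        has_point_network TYPE(nat) additively_Noetherian X"
  proof -
    interpret unbounded_directed "\<lambda>n::nat. n"
      by (rule unbounded_directed_nat)
    have nX: "network_conditions TYPE(nat) X"
      by (rule any_condition_imp_network_conditions[where 's = 's, OF X])
        (use any Cp_Alexandroff_imp_Cp_filter_space in blast)
    moreover have nY: "network_conditions TYPE(nat) Y"
      by (rule continuous_image_network_conditions[OF X(1) Y assms(6,7) nX])
    ultimately show ?thesis
      using almost_subbase_imp_Cp_Alexandroff_embedding[OF X]
        almost_subbase_imp_Cp_Alexandroff_embedding[OF Y]
      unfolding network_conditions_def by simp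
  qed
  show ?thesis
    using general eberlein unfolding network_conditions_def by argo
qed

end
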